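(* As $b\to\infty$, $$\frac{1}{6e}\log_2 b \;\lesssim\; \rho_b \;\lesssim\; 4\log_2\left(\tfrac{8}{3}b\right),$$ where $\rho_b=\sup\{\mu(\Lambda(\Gamma,w)) \mid (\Gamma,w) \text{ a weighted graph of first Betti number } b\}$, and where, for positive functions $f,g$ of $b$, $f(b)\lesssim g(b)$ means $\limsup_{b\to\infty} f(b)/g(b)\le 1$.
   Context: A graph $\Gamma=(V,E)$ is a simplicial complex of dimension 1 with vertex set $V$ and edge set $E$; all graphs are assumed connected and finite, with every vertex of valence (number of incident edges) at least $2$. Its first Betti number is $b_1(\Gamma)=|E|-|V|+1$. A weighted graph is a pair $(\Gamma,w)$ with $w:E\to\mathbb{R}_+=[0,\infty)$ a weight function such that the form $\langle\cdot,\cdot\rangle_w$ below is positive definite on $H_1(\Gamma,\mathbb{R})$. Jacobian of a weighted graph: let $(\Gamma,w)$ have first Betti number $b\ge 1$. Choose an arbitrary orientation of each edge, giving oriented edges $e_1,\dots,e_k$, and let $\mathcal{C}(\Gamma,\mathbb{R})=\{\sum_i a_i e_i \mid a_i\in\mathbb{R}\}$ be the space of simplicial 1-chains, with the bilinear form $\langle e_i,e_j\rangle_w=w(e_i)\delta_{ij}$. The homology $H_1(\Gamma,\mathbb{R})$ is the $b$-dimensional subspace of cycles in $\mathcal{C}(\Gamma,\mathbb{R})$, equipped with the restriction of $\langle\cdot,\cdot\rangle_w$, and $\Lambda(\Gamma,w)=H_1(\Gamma,\mathbb{Z})\subset(H_1(\Gamma,\mathbb{R}),\langle\cdot,\cdot\rangle_w)$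 is a lattice of dimension $b$, called the Jacobian of $(\Gamma,w)$. Hermite invariant: for a lattice $\Lambda$ in an $n$-dimensional Euclidean space, $\det(\Lambda)$ is the square of the Euclidean volume of a fundamental domain, $\|\Lambda\|=\min\{\langle\lambda,\lambda\rangle \mid \lambda\in\Lambda\setminus\{0\}\}$, and $\mu(\Lambda)=\|\Lambda\|/\det(\Lambda)^{1/n}$. The invariant $\mu(\Lambda(\Gamma,w))$ does not depend on the chosen orientations. *)

theory Defs
  imports "HOL-Analysis.Analysis"
begin

section \<open>Finite graphs\<close>

text \<open>A one-dimensional simplicial complex is given by its vertices and its edges, an edge being a
  two-element set of vertices (so there are neither loops nor multiple edges).\<close>

definition graph :: "'a set \<Rightarrow> 'a set set \<Rightarrow> bool" where
  "graph V E \<longleftrightarrow>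
     finite V \<and> V \<noteq> {} \<and> (\<forall>e\<in>E. e \<subseteq> V \<and> card e = 2) \<and>
     (\<forall>u\<in>V. \<forall>v\<in>V. (u, v) \<in> {(x, y). {x, y} \<in> E}\<^sup>*) \<and>
     (\<forall>v\<in>V. 2 \<le> card {e \<in> E. v \<in> e})"

definition betti1 :: "'a set \<Rightarrow> 'a set set \<Rightarrow> int" where
  "betti1 V E = int (card E) - int (card V) + 1"

section \<open>Simplicial chains and first homology\<close>

text \<open>An orientation assigns to each edge the pair (initial vertex, terminal vertex).\<close>

definition orientation :: "'a set set \<Rightarrow> ('a set \<Rightarrow> 'a \<times> 'a) \<Rightarrow> bool" where
  "orientation E ori \<longleftrightarrow> (\<forall>e\<in>E. e = {fst (ori e), snd (ori e)})"

text \<open>The chain with coefficients \<open>c e\<close> is represented by the function \<open>c\<close>, extended by zero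
  outside the edge set.\<close>

definition chains :: "'a set set \<Rightarrow> ('a set \<Rightarrow> real) set" where
  "chains E = {c. \<forall>e. e \<notin> E \<longrightarrow> c e = 0}"

definition boundary :: "'a set set \<Rightarrow> ('a set \<Rightarrow> 'a \<times> 'a) \<Rightarrow> ('a set \<Rightarrow> real) \<Rightarrow> 'a \<Rightarrow> real" where
  "boundary E ori c v =
     (\<Sum>e\<in>E. c e * (of_bool (snd (ori e) = v) - of_bool (fst (ori e) = v)))"

text \<open>There are no 2-simplices, so homology classes are cycles.\<close>

definition H1_real :: "'a set \<Rightarrow> 'a set set \<Rightarrow> ('a set \<Rightarrow> 'a \<times> 'a) \<Rightarrow> ('a set \<Rightarrow> real) set" where
  "H1_real V E ori = {c \<in> chains E. \<forall>v\<in>V. boundary E ori c v = 0}"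

definition H1_int :: "'a set \<Rightarrow> 'a set set \<Rightarrow> ('a set \<Rightarrow> 'a \<times> 'a) \<Rightarrow> ('a set \<Rightarrow> real) set" where
  "H1_int V E ori = {c \<in> H1_real V E ori. \<forall>e\<in>E. c e \<in> \<int>}"

definition weight_form ::
    "'a set set \<Rightarrow> ('a set \<Rightarrow> real) \<Rightarrow> ('a set \<Rightarrow> real) \<Rightarrow> ('a set \<Rightarrow> real) \<Rightarrow> real" where
  "weight_form E w c d = (\<Sum>e\<in>E. w e * c e * d e)"

definition weighted_graph :: "'a set \<Rightarrow> 'a set set \<Rightarrow> ('a set \<Rightarrow> real) \<Rightarrow> bool" where
  "weighted_graph V E w \<longleftrightarrow>
     graph V E \<and> (\<forall>e\<in>E. 0 \<le> w e) \<and>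
     (\<forall>ori. orientation E ori \<longrightarrow>
        (\<forall>c\<in>H1_real V E ori. c \<noteq> (\<lambda>_. 0) \<longrightarrow> 0 < weight_form E w c c))"

section \<open>Lattices in Euclidean spaces\<close>

text \<open>The ambient \<open>n\<close>-dimensional Euclidean space is a linear subspace \<open>W\<close> of a space of real
  functions, with inner product \<open>B\<close> on \<open>W\<close>.\<close>

definition lincomb :: "nat \<Rightarrow> (nat \<Rightarrow> 'e \<Rightarrow> real) \<Rightarrow> (nat \<Rightarrow> real) \<Rightarrow> 'e \<Rightarrow> real" where
  "lincomb n u t = (\<lambda>e. \<Sum>i<n. t i * u i e)"

definition orthonormal_basis ::
    "nat \<Rightarrow> ('e \<Rightarrow> real) set \<Rightarrow> (('e \<Rightarrow> real) \<Rightarrow> ('e \<Rightarrow> real) \<Rightarrow> real) \<Rightarrow> (nat \<Rightarrow> 'e \<Rightarrow> real) \<Rightarrow> bool"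
  where
  "orthonormal_basis n W B u \<longleftrightarrow>
     (\<forall>i<n. \<forall>j<n. B (u i) (u j) = (if i = j then 1 else 0)) \<and> W = range (lincomb n u)"

definition fundamental_domain ::
    "('e \<Rightarrow> real) set \<Rightarrow> ('e \<Rightarrow> real) set \<Rightarrow> ('e \<Rightarrow> real) set \<Rightarrow> bool" where
  "fundamental_domain W L F \<longleftrightarrow>
     F \<subseteq> W \<and> (\<forall>x\<in>W. \<exists>!l. l \<in> L \<and> (\<lambda>e. x e - l e) \<in> F)"

abbreviation lebesgue_n :: "nat \<Rightarrow> (nat \<Rightarrow> real) measure" where
  "lebesgue_n n \<equiv> \<Pi>\<^sub>M i\<in>{..<n}. lborel"

definition coordinates :: "nat \<Rightarrow> (nat \<Rightarrow> 'e \<Rightarrow> real) \<Rightarrow> ('e \<Rightarrow> real) set \<Rightarrow> (nat \<Rightarrow> real) set" where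
  "coordinates n u F = {t \<in> space (lebesgue_n n). lincomb n u t \<in> F}"

text \<open>Euclidean volume on \<open>W\<close> is Lebesgue measure in the coordinates of an orthonormal basis. The
  volume of a measurable fundamental domain depends neither on the domain nor on the basis.\<close>

definition lattice_det ::
    "nat \<Rightarrow> ('e \<Rightarrow> real) set \<Rightarrow> (('e \<Rightarrow> real) \<Rightarrow> ('e \<Rightarrow> real) \<Rightarrow> real) \<Rightarrow> ('e \<Rightarrow> real) set \<Rightarrow> real" where
  "lattice_det n W B L =
     (THE d. \<exists>u F. orthonormal_basis n W B u \<and> fundamental_domain W L F \<and>
        coordinates n u F \<in> sets (lebesgue_n n) \<and>
        d = (measure (lebesgue_n n) (coordinates n u F))\<^sup>2)"

definition lattice_norm ::
    "(('e \<Rightarrow> real) \<Rightarrow> ('e \<Rightarrow> real) \<Rightarrow> real) \<Rightarrow> ('e \<Rightarrow> real) set \<Rightarrow> real" where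
  "lattice_norm B L = (LEAST r. \<exists>l\<in>L. l \<noteq> (\<lambda>_. 0) \<and> r = B l l)"

definition hermite_invariant ::
    "nat \<Rightarrow> ('e \<Rightarrow> real) set \<Rightarrow> (('e \<Rightarrow> real) \<Rightarrow> ('e \<Rightarrow> real) \<Rightarrow> real) \<Rightarrow> ('e \<Rightarrow> real) set \<Rightarrow> real" where
  "hermite_invariant n W B L = lattice_norm B L / lattice_det n W B L powr (1 / real n)"

section \<open>The extremal Hermite invariant of Jacobians of weighted graphs\<close>

definition jacobian_hermite ::
    "nat \<Rightarrow> 'a set \<Rightarrow> 'a set set \<Rightarrow> ('a set \<Rightarrow> real) \<Rightarrow> ('a set \<Rightarrow> 'a \<times> 'a) \<Rightarrow> real" where
  "jacobian_hermite b V E w ori =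
     hermite_invariant b (H1_real V E ori) (weight_form E w) (H1_int V E ori)"

text \<open>Every finite graph is isomorphic to one whose vertices are natural numbers. The supremum is
  taken in the extended reals, so that its finiteness is not presupposed.\<close>

definition rho :: "nat \<Rightarrow> ereal" where
  "rho b = Sup {ereal (jacobian_hermite b V E w ori) | (V :: nat set) E w ori.
     weighted_graph V E w \<and> betti1 V E = int b \<and> orientation E ori}"

definition asymp_le :: "(nat \<Rightarrow> ereal) \<Rightarrow> (nat \<Rightarrow> ereal) \<Rightarrow> bool" where
  "asymp_le f g \<longleftrightarrow> limsup (\<lambda>b. f b / g b) \<le> 1"

end

theory Submission
  imports Defs "HOL-Real_Asymp.Real_Asymp"
begin

text \<open>
  Both bounds rest on one description of the determinant of a lattice: for any integral basis it is the product of the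
  squared distances of each basis vector from the span of the preceding ones (\<open>lattice_det_gram_schmidt\<close>). This
  includes that the volume of a fundamental domain is well defined. Boxes along a Gram-Schmidt basis are fundamental
  domains; two fundamental domains in the same coordinates have the same measure by cutting and translating; and two
  orthonormal coordinate systems give the same volume because counting lattice points in large balls compares both
  with the volume of a ball, whose coordinate description is the same in both.

  Upper bound. Let \<open>s\<close> be the squared length of the shortest cycle of a weighted graph of first Betti number \<open>b\<close>, and
  let \<open>2 b \<le> 2 ^ L\<close>. It suffices to find an integral basis of cycles in which each vector has squared distance at least
  \<open>s / (4 L)\<close> from the span of the preceding ones, for then the Hermite invariant is at most \<open>4 L\<close>. The basis is obtained by
  dismantling the graph (\<open>separated_basis_exists\<close>). Vertices of valence one are irrelevant for cycles, and vertices of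
  valence two are smoothed, the weights of their edges being added. Once all valences are at least three there are
  fewer than \<open>2 b\<close> vertices, and a ball whose size doubles with its radius must close up to a cycle \<open>c\<close> with
  \<open>\<Sum>e. (c e)\<^sup>2 \<le> 4 L\<close> (\<open>short_cycle\<close>). As this cycle has weight at least \<open>s\<close>, the heaviest edge has weight at least
  \<open>s / (4 L)\<close>. Deleting this edge removes at most one basis vector, which has coefficient 1 at that edge, whereas the cycles of
  the remaining graph have coefficient 0 there. With \<open>L\<close> about \<open>log\<^sub>2 (2 b) + 1\<close> this is asymptotic to the claimed bound.

  Lower bound. A path on \<open>n\<close> vertices is closed to a cycle, and then chords with disjoint ends are added greedily, each
  between vertices that are far apart (\<open>high_girth_edges\<close>). With \<open>n = 2 b + 3 * 2 ^ g\<close> vertices there is room for \<open>b\<close> edges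
  outside the path, and the girth is at least \<open>g\<close>. For unit weights the determinant of the cycle lattice is at most the
  product of the degrees of all vertices but one (\<open>lattice_det_le_degree\<close>): extend a basis of cycles by the edges of a
  spanning tree to a basis of the lattice of all integral chains, whose determinant is 1; the squared distance of a
  tree edge from the preceding vectors is at least the inverse of the degree of the vertex that it adds, as one sees by
  pairing with the star of this vertex. As all degrees are at most 3, the Hermite invariant is at least \<open>g / 3 ^ (n / b)\<close>.
  For \<open>g\<close> close to \<open>(2 / 3) log\<^sub>2 b\<close> this is about \<open>(2 / 27) log\<^sub>2 b\<close>, more than \<open>log\<^sub>2 b / (6 e)\<close>.
\<close>

section \<open>Translations and tilings of coordinate space\<close>

definition shift :: "nat \<Rightarrow> (nat \<Rightarrow> real) \<Rightarrow> (nat \<Rightarrow> real) \<Rightarrow> nat \<Rightarrow> real" where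
  "shift n c t = (\<lambda>i\<in>{..<n}. t i + c i)"

interpretation lborel_n: product_sigma_finite "\<lambda>_::nat. lborel :: real measure"
  by standard

lemma space_lebesgue_n: "space (lebesgue_n n) = extensional {..<n}"
  by (auto simp: space_PiM PiE_def)

lemma shift_in_space [simp]: "shift n c t \<in> extensional {..<n}"
  by (simp add: shift_def)

lemma shift_cancel:
  "t \<in> extensional {..<n} \<Longrightarrow> shift n c (shift n (\<lambda>i. - c i) t) = t"
  "t \<in> extensional {..<n} \<Longrightarrow> shift n (\<lambda>i. - c i) (shift n c t) = t"
  by (auto simp: shift_def fun_eq_iff extensional_def)

lemma measurable_shift [measurable]: "shift n c \<in> measurable (lebesgue_n n) (lebesgue_n n)"
  unfolding shift_def by measurable

lemma distr_shift: "distr (lebesgue_n n) (lebesgue_n n) (shift n c) = lebesgue_n n"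
proof (rule lborel_n.PiM_eqI)
  fix A :: "nat \<Rightarrow> real set"
  assume A: "\<And>i. i \<in> {..<n} \<Longrightarrow> A i \<in> sets lborel"
  have meas: "Pi\<^sub>E {..<n} A \<in> sets (lebesgue_n n)"
    using A by (intro sets_PiM_I_finite) auto
  define A' where "A' i = (\<lambda>x. c i + x) -` A i" for i
  have A': "A' i \<in> sets lborel" if "i < n" for i
  proof -
    have "(\<lambda>x. c i + x) -` A i \<inter> space lborel \<in> sets lborel"
      by (rule measurable_sets[where A = "lborel :: real measure"]) (use A that in auto)
    then show ?thesis by (simp add: A'_def)
  qed
  have "emeasure (distr (lebesgue_n n) (lebesgue_n n) (shift n c)) (Pi\<^sub>E {..<n} A)
      = emeasure (lebesgue_n n) (shift n c -` Pi\<^sub>E {..<n} A \<inter> space (lebesgue_n n))"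
    using meas by (intro emeasure_distr) auto
  also have "shift n c -` Pi\<^sub>E {..<n} A \<inter> space (lebesgue_n n) = Pi\<^sub>E {..<n} A'"
    by (auto simp: space_lebesgue_n shift_def A'_def PiE_def Pi_def add.commute)
  also have "emeasure (lebesgue_n n) (Pi\<^sub>E {..<n} A') = (\<Prod>i<n. emeasure lborel (A' i))"
    using A' by (intro lborel_n.emeasure_PiM) auto
  also have "\<dots> = (\<Prod>i<n. emeasure lborel (A i))"
  proof (rule prod.cong[OF refl])
    fix i assume i: "i \<in> {..<n}"
    have "emeasure lborel (A' i) = emeasure (distr lborel borel (\<lambda>x. c i + x)) (A i)"
      using A[OF i] by (subst emeasure_distr) (auto simp: A'_def)
    then show "emeasure lborel (A' i) = emeasure lborel (A i)"
      by (simp add: lborel_distr_plus)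
  qed
  finally show "emeasure (distr (lebesgue_n n) (lebesgue_n n) (shift n c)) (Pi\<^sub>E {..<n} A)
    = (\<Prod>i<n. emeasure lborel (A i))" .
qed simp_all

lemma emeasure_shift_vimage:
  assumes "X \<in> sets (lebesgue_n n)"
  shows "emeasure (lebesgue_n n) (shift n c -` X \<inter> space (lebesgue_n n)) = emeasure (lebesgue_n n) X"
  using emeasure_distr[OF measurable_shift assms, of c] by (simp add: distr_shift)

text \<open>In the application \<open>C\<close> consists of the coordinate vectors of the lattice points, and \<open>P\<close> is a fundamental
  domain in coordinates.\<close>

definition tiles :: "nat \<Rightarrow> (nat \<Rightarrow> real) set \<Rightarrow> (nat \<Rightarrow> real) set \<Rightarrow> bool" where
  "tiles n C P \<longleftrightarrow> P \<in> sets (lebesgue_n n) \<and>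
     (\<forall>t\<in>extensional {..<n}. \<exists>!c. c \<in> C \<and> shift n (\<lambda>i. - c i) t \<in> P)"

lemma tiles_emeasure_split:
  assumes C: "countable C"
    and Q: "tiles n C Q" and P: "P \<in> sets (lebesgue_n n)"
  shows "emeasure (lebesgue_n n) P =
    (\<integral>\<^sup>+c. emeasure (lebesgue_n n) (P \<inter> (shift n (\<lambda>i. - c i) -` Q \<inter> space (lebesgue_n n))) \<partial>count_space C)"
proof -
  let ?X = "\<lambda>c. P \<inter> (shift n (\<lambda>i. - c i) -` Q \<inter> space (lebesgue_n n))"
  have Qs: "Q \<in> sets (lebesgue_n n)" using Q by (simp add: tiles_def)
  have meas: "?X c \<in> sets (lebesgue_n n)" for c
    using P Qs measurable_sets[OF measurable_shift Qs] by blast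
  have "P = (\<Union>c\<in>C. ?X c)"
    using Q sets.sets_into_space[OF P] by (auto simp: tiles_def space_lebesgue_n) blast
  moreover have "disjoint_family_on ?X C"
    using Q by (auto simp: disjoint_family_on_def tiles_def space_lebesgue_n)
  ultimately show ?thesis
    using emeasure_UN_countable[of C ?X "lebesgue_n n"] meas C by simp
qed

text \<open>Cut each of two tiles along the translates of the other one. The pieces \<open>P \<inter> (Q + c)\<close> of the first and
  \<open>Q \<inter> (P - c)\<close> of the second are translates of each other, so the two measures are the same countable sum.\<close>

lemma tiles_emeasure_eq:
  assumes C: "countable C" "C \<subseteq> extensional {..<n}"
    and neg: "\<And>c. c \<in> C \<Longrightarrow> (\<lambda>i\<in>{..<n}. - c i) \<in> C"
    and P: "tiles n C P" and Q: "tiles n C Q"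
  shows "emeasure (lebesgue_n n) P = emeasure (lebesgue_n n) Q"
proof -
  let ?M = "lebesgue_n n"
  let ?neg = "\<lambda>c. \<lambda>i\<in>{..<n}. - c i"
  have Ps: "P \<in> sets ?M" and Qs: "Q \<in> sets ?M" using P Q by (auto simp: tiles_def)
  have negneg: "?neg (?neg c) = c" if "c \<in> C" for c
    using C(2) that by (auto simp: fun_eq_iff extensional_def)
  have bij: "bij_betw ?neg C C"
    by (rule bij_betw_byWitness[where f' = ?neg]) (use negneg neg in auto)
  have eq: "emeasure ?M (P \<inter> (shift n (\<lambda>i. - c i) -` Q \<inter> space ?M))
      = emeasure ?M (Q \<inter> (shift n (\<lambda>i. - (?neg c) i) -` P \<inter> space ?M))" for c
  proof -
    have meas: "P \<inter> (shift n (\<lambda>i. - c i) -` Q \<inter> space ?M) \<in> sets ?M"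
      using Ps measurable_sets[OF measurable_shift Qs] by blast
    have s: "shift n (\<lambda>i. - (?neg c) i) = shift n c"
      by (auto simp: shift_def fun_eq_iff)
    have "shift n c -` (P \<inter> (shift n (\<lambda>i. - c i) -` Q \<inter> space ?M)) \<inter> space ?M
        = Q \<inter> (shift n c -` P \<inter> space ?M)"
      using sets.sets_into_space[OF Qs] by (auto simp: space_lebesgue_n shift_cancel)
    then show ?thesis using emeasure_shift_vimage[OF meas, of c] s by simp
  qed
  have "emeasure ?M P = (\<integral>\<^sup>+c. emeasure ?M (P \<inter> (shift n (\<lambda>i. - c i) -` Q \<inter> space ?M)) \<partial>count_space C)"
    by (rule tiles_emeasure_split) fact+
  also have "\<dots> = (\<integral>\<^sup>+c. emeasure ?M (Q \<inter> (shift n (\<lambda>i. - (?neg c) i) -` P \<inter> space ?M)) \<partial>count_space C)"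
    by (simp only: eq)
  also have "\<dots> = (\<integral>\<^sup>+c. emeasure ?M (Q \<inter> (shift n (\<lambda>i. - c i) -` P \<inter> space ?M)) \<partial>count_space C)"
    using nn_integral_bij_count_space[OF bij, of "\<lambda>c. emeasure ?M (Q \<inter> (shift n (\<lambda>i. - c i) -` P \<inter> space ?M))"] .
  also have "\<dots> = emeasure ?M Q"
    by (rule tiles_emeasure_split[symmetric]) fact+
  finally show ?thesis .
qed

section \<open>Counting lattice points in balls\<close>

definition eucl_norm :: "nat \<Rightarrow> (nat \<Rightarrow> real) \<Rightarrow> real" where "eucl_norm n t = L2_set t {..<n}"

definition eucl_ball :: "nat \<Rightarrow> real \<Rightarrow> (nat \<Rightarrow> real) set" where
  "eucl_ball n R = {t \<in> extensional {..<n}. eucl_norm n t \<le> R}"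

lemma eucl_norm_shift: "eucl_norm n (shift n c t) \<le> eucl_norm n t + eucl_norm n c"
proof -
  have "eucl_norm n (shift n c t) = L2_set (\<lambda>i. t i + c i) {..<n}"
    unfolding eucl_norm_def by (intro L2_set_cong) (auto simp: shift_def)
  then show ?thesis using L2_set_triangle_ineq[of t c "{..<n}"] by (simp add: eucl_norm_def)
qed

lemma eucl_norm_uminus: "eucl_norm n (\<lambda>i. - c i) = eucl_norm n c"
  by (simp add: eucl_norm_def L2_set_def)

lemma eucl_norm_shift_minus: "eucl_norm n (shift n (\<lambda>i. - c i) t) \<le> eucl_norm n t + eucl_norm n c"
  using eucl_norm_shift[of n "\<lambda>i. - c i" t] by (simp add: eucl_norm_uminus)

lemma eucl_ball_sets [measurable]: "eucl_ball n R \<in> sets (lebesgue_n n)"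
proof -
  have "(\<lambda>t. eucl_norm n t) \<in> borel_measurable (lebesgue_n n)"
    unfolding eucl_norm_def L2_set_def by measurable
  then have "{t \<in> space (lebesgue_n n). eucl_norm n t \<le> R} \<in> sets (lebesgue_n n)" by measurable
  then show ?thesis by (simp add: eucl_ball_def space_lebesgue_n)
qed

lemma emeasure_eucl_ball_le: assumes "R \<ge> 0" shows "emeasure (lebesgue_n n) (eucl_ball n R) \<le> ennreal ((2 * R) ^ n)"
proof -
  have "eucl_ball n R \<subseteq> Pi\<^sub>E {..<n} (\<lambda>_. {-R..R})"
  proof
    fix t assume t: "t \<in> eucl_ball n R"
    have "\<bar>t i\<bar> \<le> R" if "i < n" for i
    proof -
      have "\<bar>t i\<bar> \<le> L2_set (\<lambda>i. \<bar>t i\<bar>) {..<n}"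
        using that by (intro member_le_L2_set) auto
      also have "\<dots> = eucl_norm n t" by (simp add: eucl_norm_def L2_set_def)
      finally show ?thesis using t by (simp add: eucl_ball_def)
    qed
    then show "t \<in> Pi\<^sub>E {..<n} (\<lambda>_. {-R..R})"
      using t by (auto simp: eucl_ball_def PiE_def abs_le_iff) (metis minus_le_iff)
  qed
  then have "emeasure (lebesgue_n n) (eucl_ball n R) \<le> emeasure (lebesgue_n n) (Pi\<^sub>E {..<n} (\<lambda>_. {-R..R}))"
    by (intro emeasure_mono sets_PiM_I_finite) auto
  also have "\<dots> = (\<Prod>i<n. emeasure lborel {-R..R})"
    by (intro lborel_n.emeasure_PiM) auto
  also have "\<dots> = ennreal ((2 * R) ^ n)"
    using assms by (simp add: ennreal_power)
  finally show ?thesis .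
qed

lemma emeasure_eucl_ball_pos: "emeasure (lebesgue_n n) (eucl_ball n 1) > 0"
proof -
  let ?r = "1 / (real n + 1)"
  have "Pi\<^sub>E {..<n} (\<lambda>_. {0..?r}) \<subseteq> eucl_ball n 1"
  proof
    fix t assume t: "t \<in> Pi\<^sub>E {..<n} (\<lambda>_. {0..?r})"
    have "eucl_norm n t \<le> (\<Sum>i<n. t i)"
      unfolding eucl_norm_def by (rule L2_set_le_sum) (use t in \<open>auto simp: PiE_def Pi_def\<close>)
    also have "\<dots> \<le> (\<Sum>i<n. ?r)"
      by (rule sum_mono) (use t in \<open>auto simp: PiE_def Pi_def\<close>)
    also have "\<dots> \<le> 1" by simp
    finally show "t \<in> eucl_ball n 1" using t by (auto simp: eucl_ball_def PiE_def)
  qed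
  then have "emeasure (lebesgue_n n) (Pi\<^sub>E {..<n} (\<lambda>_. {0..?r})) \<le> emeasure (lebesgue_n n) (eucl_ball n 1)"
    by (intro emeasure_mono) auto
  moreover have "emeasure (lebesgue_n n) (Pi\<^sub>E {..<n} (\<lambda>_. {0..?r})) = (\<Prod>i<n. emeasure lborel {0..?r})"
    by (intro lborel_n.emeasure_PiM) auto
  moreover have "\<dots> = ennreal (?r ^ n)"
    by (simp add: ennreal_power)
  moreover have "?r ^ n > 0" by simp
  ultimately show ?thesis by (metis ennreal_less_zero_iff less_le_trans)
qed

definition ball_vol :: "nat \<Rightarrow> real \<Rightarrow> real" where "ball_vol n R = measure (lebesgue_n n) (eucl_ball n R)"

lemma emeasure_eucl_ball: "emeasure (lebesgue_n n) (eucl_ball n R) = ennreal (ball_vol n R)"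
proof -
  have "emeasure (lebesgue_n n) (eucl_ball n R) \<le> emeasure (lebesgue_n n) (eucl_ball n (max R 0))"
    by (intro emeasure_mono eucl_ball_sets) (auto simp: eucl_ball_def)
  also have "\<dots> \<le> ennreal ((2 * max R 0) ^ n)" by (rule emeasure_eucl_ball_le) simp
  finally have "emeasure (lebesgue_n n) (eucl_ball n R) \<noteq> \<infinity>"
    by (metis ennreal_less_top infinity_ennreal_def leD)
  then show ?thesis by (simp add: ball_vol_def emeasure_eq_ennreal_measure)
qed

lemma ball_vol_nonneg: "ball_vol n R \<ge> 0" by (simp add: ball_vol_def)

lemma ball_vol_le: "R \<ge> 0 \<Longrightarrow> ball_vol n R \<le> (2 * R) ^ n"
  using emeasure_eucl_ball_le[of R n] by (simp add: emeasure_eucl_ball)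

lemma ball_vol_pos: assumes "R \<ge> 1" shows "ball_vol n R > 0"
proof -
  have "emeasure (lebesgue_n n) (eucl_ball n 1) \<le> emeasure (lebesgue_n n) (eucl_ball n R)"
    using assms by (intro emeasure_mono eucl_ball_sets) (auto simp: eucl_ball_def)
  then have "ball_vol n 1 \<le> ball_vol n R" by (simp add: emeasure_eucl_ball ball_vol_nonneg)
  then show ?thesis using emeasure_eucl_ball_pos[of n] by (simp add: emeasure_eucl_ball)
qed

lemma lattice_points_le:
  assumes P: "tiles n C P" and C: "C \<subseteq> extensional {..<n}"
    and d: "P \<subseteq> eucl_ball n d"
    and S: "finite S" "S \<subseteq> {c \<in> C. eucl_norm n c \<le> R}"
  shows "real (card S) * measure (lebesgue_n n) P \<le> ball_vol n (R + d)"
proof -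
  let ?M = "lebesgue_n n"
  let ?X = "\<lambda>c. shift n (\<lambda>i. - c i) -` P \<inter> space ?M"
  have Ps: "P \<in> sets ?M" using P by (simp add: tiles_def)
  have "emeasure ?M P \<le> emeasure ?M (eucl_ball n d)" by (intro emeasure_mono d) simp
  then have fin: "emeasure ?M P = ennreal (measure ?M P)"
    by (metis emeasure_eucl_ball ennreal_less_top emeasure_eq_ennreal_measure infinity_ennreal_def leD)
  have "ennreal (real (card S) * measure ?M P) = (\<Sum>c\<in>S. emeasure ?M (?X c))"
    using Ps by (simp add: emeasure_shift_vimage fin ennreal_mult ennreal_of_nat_eq_real_of_nat)
  also have "\<dots> = emeasure ?M (\<Union>c\<in>S. ?X c)"
  proof (rule sum_emeasure)
    show "?X ` S \<subseteq> sets ?M" using measurable_sets[OF measurable_shift Ps] by auto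
    show "disjoint_family_on ?X S"
      using P S unfolding disjoint_family_on_def tiles_def space_lebesgue_n by blast
  qed fact
  also have "\<dots> \<le> emeasure ?M (eucl_ball n (R + d))"
  proof (rule emeasure_mono)
    show "(\<Union>c\<in>S. ?X c) \<subseteq> eucl_ball n (R + d)"
    proof
      fix t assume "t \<in> (\<Union>c\<in>S. ?X c)"
      then obtain c where c: "c \<in> S" "shift n (\<lambda>i. - c i) t \<in> P" "t \<in> extensional {..<n}"
        by (auto simp: space_lebesgue_n)
      have "eucl_norm n t = eucl_norm n (shift n c (shift n (\<lambda>i. - c i) t))" using c by (simp add: shift_cancel)
      also have "\<dots> \<le> eucl_norm n (shift n (\<lambda>i. - c i) t) + eucl_norm n c" by (rule eucl_norm_shift)
      also have "\<dots> \<le> R + d"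
      proof -
        have "eucl_norm n (shift n (\<lambda>i. - c i) t) \<le> d" "eucl_norm n c \<le> R"
          using c d S by (auto simp: eucl_ball_def)
        then show ?thesis by simp
      qed
      finally show "t \<in> eucl_ball n (R + d)" using c by (simp add: eucl_ball_def)
    qed
  qed simp
  finally show ?thesis by (simp add: emeasure_eucl_ball ball_vol_nonneg)
qed

lemma lattice_points_ge:
  assumes P: "tiles n C P" and C: "C \<subseteq> extensional {..<n}"
    and d: "P \<subseteq> eucl_ball n d"
    and fin: "finite {c \<in> C. eucl_norm n c \<le> R}"
  shows "ball_vol n (R - d) \<le> real (card {c \<in> C. eucl_norm n c \<le> R}) * measure (lebesgue_n n) P"
proof -
  let ?M = "lebesgue_n n"
  let ?X = "\<lambda>c. shift n (\<lambda>i. - c i) -` P \<inter> space ?M"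
  let ?S = "{c \<in> C. eucl_norm n c \<le> R}"
  have Ps: "P \<in> sets ?M" using P by (simp add: tiles_def)
  have "emeasure ?M P \<le> emeasure ?M (eucl_ball n d)" by (intro emeasure_mono d) simp
  then have fin': "emeasure ?M P = ennreal (measure ?M P)"
    by (metis emeasure_eucl_ball ennreal_less_top emeasure_eq_ennreal_measure infinity_ennreal_def leD)
  have "ennreal (ball_vol n (R - d)) = emeasure ?M (eucl_ball n (R - d))" by (simp add: emeasure_eucl_ball)
  also have "\<dots> \<le> emeasure ?M (\<Union>c\<in>?S. ?X c)"
  proof (rule emeasure_mono)
    show "(\<Union>c\<in>?S. ?X c) \<in> sets ?M"
      using measurable_sets[OF measurable_shift Ps] fin by blast
    show "eucl_ball n (R - d) \<subseteq> (\<Union>c\<in>?S. ?X c)"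
    proof
      fix t assume t: "t \<in> eucl_ball n (R - d)"
      then have te: "t \<in> extensional {..<n}" by (simp add: eucl_ball_def)
      then obtain c where c: "c \<in> C" "shift n (\<lambda>i. - c i) t \<in> P"
        using P by (auto simp: tiles_def)
      let ?p = "shift n (\<lambda>i. - c i) t"
      have "c = shift n (\<lambda>i. - ?p i) t"
        using c(1) C by (auto simp: shift_def fun_eq_iff extensional_def)
      then have "eucl_norm n c \<le> eucl_norm n t + eucl_norm n ?p" using eucl_norm_shift_minus by metis
      also have "\<dots> \<le> R" using t c d by (auto simp: eucl_ball_def)
      finally show "t \<in> (\<Union>c\<in>?S. ?X c)" using c te by (auto simp: space_lebesgue_n)
    qed
  qed
  also have "\<dots> \<le> (\<Sum>c\<in>?S. emeasure ?M (?X c))"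
    using measurable_sets[OF measurable_shift Ps] fin
    by (intro emeasure_subadditive_finite) auto
  also have "\<dots> = ennreal (real (card ?S) * measure ?M P)"
    using Ps by (simp add: emeasure_shift_vimage fin' ennreal_mult ennreal_of_nat_eq_real_of_nat)
  finally show ?thesis by (simp add: ball_vol_nonneg)
qed

text \<open>The hypotheses say that \<open>D\<close> times the number \<open>N R\<close> of lattice points in a ball of radius \<open>R\<close> is at
  least the volume of a slightly smaller ball, and \<open>D'\<close> times it at most the volume of a slightly larger one.
  If \<open>D'\<close> exceeded \<open>D\<close>, the volume would gain the factor \<open>D' / D\<close> at each increase of the radius by
  \<open>2 d\<close>, hence grow exponentially; but it is bounded by a polynomial in the radius.\<close>

lemma growth_comparison:
  assumes 1: "\<And>R. R \<ge> d \<Longrightarrow> ball_vol n (R - d) \<le> N R * D"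
    and 2: "\<And>R. R \<ge> d \<Longrightarrow> N R * D' \<le> ball_vol n (R + d)"
    and D: "D \<ge> 0" "D' \<ge> 0" and d: "d > 0" and N: "\<And>R. N R \<ge> 0"
  shows "D' \<le> D"
proof (rule ccontr)
  assume "\<not> D' \<le> D"
  then have lt: "D < D'" by simp
  have Dpos: "D > 0"
  proof (rule ccontr)
    assume "\<not> D > 0" then have "D = 0" using D by simp
    then show False using 1[of "1 + d"] ball_vol_pos[of 1 n] d by simp
  qed
  define q where "q = D' / D"
  have q: "q > 1" using lt Dpos by (simp add: q_def)
  have step: "q * ball_vol n r \<le> ball_vol n (r + 2 * d)" if "r \<ge> 0" for r
  proof -
    have "ball_vol n r * D' \<le> N (r + d) * D * D'"
      using 1[of "r + d"] that d D by (intro mult_right_mono) auto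
    also have "\<dots> \<le> ball_vol n (r + 2 * d) * D"
      using 2[of "r + d"] that d D by (simp add: mult.commute mult.left_commute mult_left_mono algebra_simps)
    finally show ?thesis using Dpos by (simp add: q_def field_simps)
  qed
  have it: "q ^ k * ball_vol n 1 \<le> ball_vol n (1 + 2 * d * real k)" for k
  proof (induction k)
    case (Suc k)
    have "q ^ Suc k * ball_vol n 1 \<le> q * ball_vol n (1 + 2 * d * real k)"
      using Suc q by (simp add: mult_left_mono)
    also have "\<dots> \<le> ball_vol n (1 + 2 * d * real k + 2 * d)" by (rule step) (use d in auto)
    finally show ?case by (simp add: algebra_simps)
  qed simp
  define K where "K = 2 * (1 + 2 * d)"
  have up: "q ^ k * ball_vol n 1 \<le> K ^ n * real k ^ n" if "k \<ge> 1" for k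
  proof -
    have "ball_vol n (1 + 2 * d * real k) \<le> (2 * (1 + 2 * d * real k)) ^ n"
      using d by (intro ball_vol_le) auto
    also have "\<dots> \<le> (K * real k) ^ n"
      using d that by (intro power_mono) (auto simp: K_def algebra_simps)
    finally show ?thesis using it[of k] by (simp add: power_mult_distrib)
  qed
  have "((\<lambda>k. real k ^ n * (1 / q) ^ k) \<longlongrightarrow> 0) at_top"
    using q by real_asymp
  then have "((\<lambda>k. K ^ n * (real k ^ n * (1 / q) ^ k)) \<longlongrightarrow> K ^ n * 0) at_top"
    by (intro tendsto_mult tendsto_const)
  moreover have "eventually (\<lambda>k. ball_vol n 1 \<le> K ^ n * (real k ^ n * (1 / q) ^ k)) at_top"
    using eventually_ge_at_top[of 1]
  proof eventually_elim
    case (elim k)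
    show ?case using up[OF elim] q by (simp add: field_simps)
  qed
  ultimately have "ball_vol n 1 \<le> K ^ n * 0"
    by (rule tendsto_lowerbound) simp
  then show False using ball_vol_pos[of 1 n] by simp
qed

section \<open>Linear combinations and triangular reduction\<close>

text \<open>The squared length of the Gram-Schmidt vector at \<open>v i\<close> is the minimum of the form over these vectors. All
  estimates of determinants below bound the form on this coset.\<close>

abbreviation coset_vec :: "(nat \<Rightarrow> 'e \<Rightarrow> real) \<Rightarrow> nat \<Rightarrow> (nat \<Rightarrow> real) \<Rightarrow> 'e \<Rightarrow> real" where
  "coset_vec v i t \<equiv> (\<lambda>e. v i e + lincomb i v t e)"

lemma lincomb_0 [simp]: "lincomb 0 u t = (\<lambda>_. 0)"
  by (simp add: lincomb_def)

lemma lincomb_Suc: "lincomb (Suc n) u t = (\<lambda>e. t n * u n e + lincomb n u t e)"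
  by (auto simp: lincomb_def)

lemma lincomb_cong:
  "(\<And>i. i < n \<Longrightarrow> u i = u' i) \<Longrightarrow> (\<And>i. i < n \<Longrightarrow> t i = t' i) \<Longrightarrow> lincomb n u t = lincomb n u' t'"
  by (auto simp: lincomb_def fun_eq_iff intro!: sum.cong)

lemma lincomb_linear:
  "lincomb n u (\<lambda>i. r * s i + t i) = (\<lambda>e. r * lincomb n u s e + lincomb n u t e)"
  by (auto simp: lincomb_def sum.distrib sum_distrib_left algebra_simps)

lemma lincomb_fun_upd [simp]:
  "lincomb n u (t(n := x)) = lincomb n u t" "lincomb n (u(n := w)) t = lincomb n u t"
  by (auto intro: lincomb_cong)

lemma lincomb_uminus: "lincomb n u (\<lambda>i. - t i) = (\<lambda>e. - lincomb n u t e)"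
  by (auto simp: lincomb_def sum_negf)

lemma lincomb_zero [simp]: "lincomb n u (\<lambda>_. 0) = (\<lambda>_. 0)"
  by (simp add: lincomb_def)

lemma lincomb_restrict [simp]: "lincomb n u (restrict t {..<n}) = lincomb n u t"
  by (rule lincomb_cong) auto

lemma lincomb_shift: "lincomb n u (shift n (\<lambda>i. - c i) t) = (\<lambda>e. lincomb n u t e - lincomb n u c e)"
  by (auto simp: lincomb_def shift_def fun_eq_iff algebra_simps simp flip: sum_subtractf)

definition int_comb :: "nat \<Rightarrow> (nat \<Rightarrow> 'e \<Rightarrow> real) \<Rightarrow> ('e \<Rightarrow> real) set" where
  "int_comb n v = {lincomb n v t | t. \<forall>i<n. t i \<in> \<int>}"

lemma int_comb_subset: "int_comb n v \<subseteq> range (lincomb n v)"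
  by (auto simp: int_comb_def)

lemma int_comb_uminus: "l \<in> int_comb n v \<Longrightarrow> (\<lambda>e. - l e) \<in> int_comb n v"
  unfolding int_comb_def by (force simp flip: lincomb_uminus)

lemma countable_int_comb: "countable (int_comb n v)"
proof -
  have "int_comb n v \<subseteq> lincomb n v ` (Pi\<^sub>E {..<n} (\<lambda>_. \<int>))"
  proof
    fix l assume "l \<in> int_comb n v"
    then obtain t where t: "l = lincomb n v t" "\<forall>i<n. t i \<in> \<int>" by (auto simp: int_comb_def)
    then have "l = lincomb n v (restrict t {..<n})" "restrict t {..<n} \<in> Pi\<^sub>E {..<n} (\<lambda>_. \<int>)"
      by auto
    then show "l \<in> lincomb n v ` (Pi\<^sub>E {..<n} (\<lambda>_. \<int>))" by blast
  qed
  moreover have "countable (Pi\<^sub>E {..<n} (\<lambda>_. \<int> :: real set))"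
    by (intro countable_PiE) (auto simp: Ints_def)
  ultimately show ?thesis by (meson countable_image countable_subset)
qed

text \<open>The last coordinate determines the last integer, after which the smaller system is solved: a box whose
  sides are the diagonal entries meets every coset of a lattice with triangular basis.\<close>

lemma triangular_reduction:
  fixes a :: "nat \<Rightarrow> nat \<Rightarrow> real"
  assumes "\<And>i. i < n \<Longrightarrow> a i i > 0" and "\<And>i j. i < j \<Longrightarrow> a i j = 0"
  shows "\<exists>k. (\<forall>i<n. k i \<in> \<int>) \<and>
    (\<forall>j<n. 0 \<le> y j - (\<Sum>i<n. k i * a i j) \<and> y j - (\<Sum>i<n. k i * a i j) < a j j)"
  using assms
proof (induction n arbitrary: y)
  case (Suc n)
  define q where "q = real_of_int \<lfloor>y n / a n n\<rfloor>"
  obtain k where k: "\<And>i. i < n \<Longrightarrow> k i \<in> \<int>"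
    "\<And>j. j < n \<Longrightarrow> 0 \<le> (y j - q * a n j) - (\<Sum>i<n. k i * a i j) \<and>
      (y j - q * a n j) - (\<Sum>i<n. k i * a i j) < a j j"
    using Suc.IH[of "\<lambda>j. y j - q * a n j"] Suc.prems by auto
  have an: "a n n > 0" using Suc.prems by simp
  have "q \<le> y n / a n n" "y n / a n n < q + 1" by (auto simp: q_def)
  then have q: "0 \<le> y n - q * a n n" "y n - q * a n n < a n n"
    using an by (auto simp: field_simps)
  let ?k = "k(n := q)"
  have s: "(\<Sum>i<Suc n. ?k i * a i j) = (\<Sum>i<n. k i * a i j) + q * a n j" for j by simp
  have z: "(\<Sum>i<n. k i * a i n) = 0" using Suc.prems by (intro sum.neutral) auto
  have "\<forall>i<Suc n. ?k i \<in> \<int>" using k by (auto simp: q_def less_Suc_eq)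
  moreover have "\<forall>j<Suc n. 0 \<le> y j - (\<Sum>i<Suc n. ?k i * a i j) \<and> y j - (\<Sum>i<Suc n. ?k i * a i j) < a j j"
    unfolding s using k(2) q z by (auto simp: less_Suc_eq algebra_simps)
  ultimately show ?case by blast
qed auto

lemma triangular_unique:
  fixes a :: "nat \<Rightarrow> nat \<Rightarrow> real"
  assumes "\<And>i. i < n \<Longrightarrow> a i i > 0" and "\<And>i j. i < j \<Longrightarrow> a i j = 0"
    and "\<And>i. i < n \<Longrightarrow> d i \<in> \<int>"
    and "\<And>j. j < n \<Longrightarrow> \<bar>\<Sum>i<n. d i * a i j\<bar> < a j j"
  shows "\<forall>i<n. d i = 0"
  using assms
proof (induction n)
  case (Suc n)
  have z: "(\<Sum>i<n. d i * a i n) = 0" using Suc.prems by (intro sum.neutral) auto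
  have "\<bar>d n * a n n\<bar> < a n n" using Suc.prems(4)[of n] z by simp
  then have "\<bar>d n\<bar> < 1" using Suc.prems(1)[of n] by (simp add: abs_mult)
  then have dn: "d n = 0" using Suc.prems(3)[of n] by (auto elim!: Ints_cases)
  have "\<forall>i<n. d i = 0"
  proof (rule Suc.IH)
    fix j assume "j < n"
    then show "\<bar>\<Sum>i<n. d i * a i j\<bar> < a j j" using Suc.prems(4)[of j] dn by simp
  qed (use Suc.prems in auto)
  then show ?case using dn by (auto simp: less_Suc_eq)
qed simp

section \<open>Gram-Schmidt orthogonalisation\<close>

locale symmetric_form =
  fixes B :: "('e \<Rightarrow> real) \<Rightarrow> ('e \<Rightarrow> real) \<Rightarrow> real"
  assumes sym: "B x y = B y x"
    and lin: "B (\<lambda>e. r * x e + y e) z = r * B x z + B y z"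
begin

lemma form_zero [simp]: "B (\<lambda>_. 0) z = 0" "B z (\<lambda>_. 0) = 0"
  using lin[of 1 "\<lambda>_. 0" "\<lambda>_. 0" z] sym[of z] by auto

lemma form_scale: "B (\<lambda>e. r * x e) z = r * B x z" "B z (\<lambda>e. r * x e) = r * B z x"
  using lin[of r x "\<lambda>_. 0" z] sym[of z] by auto

lemma form_diff: "B (\<lambda>e. x e - y e) z = B x z - B y z" "B z (\<lambda>e. x e - y e) = B z x - B z y"
  using lin[of "-1" y x z] sym[of z] by auto

lemma form_lincomb: "B (lincomb n u t) z = (\<Sum>i<n. t i * B (u i) z)"
  by (induction n) (auto simp: lincomb_Suc lin)

lemma form_lincomb': "B z (lincomb n u t) = (\<Sum>i<n. t i * B z (u i))"
  using form_lincomb[of n u t z] by (simp only: sym[of z])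

definition orthonormal :: "nat \<Rightarrow> (nat \<Rightarrow> 'e \<Rightarrow> real) \<Rightarrow> bool" where
  "orthonormal n u \<longleftrightarrow> (\<forall>i<n. \<forall>j<n. B (u i) (u j) = (if i = j then 1 else 0))"

lemma orthonormal_coord:
  assumes "orthonormal n u" "i < n" shows "B (lincomb n u t) (u i) = t i"
proof -
  have "B (lincomb n u t) (u i) = (\<Sum>j<n. if j = i then t j else 0)"
    unfolding form_lincomb using assms by (intro sum.cong) (auto simp: orthonormal_def)
  then show ?thesis using assms by simp
qed

lemma orthonormal_form:
  assumes "orthonormal n u"
  shows "B (lincomb n u s) (lincomb n u t) = (\<Sum>i<n. s i * t i)"
  unfolding form_lincomb'[of _ n u t] using orthonormal_coord[OF assms]
  by (intro sum.cong) auto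

lemma orthonormal_norm:
  assumes "orthonormal n u" shows "B (lincomb n u t) (lincomb n u t) = (eucl_norm n t)\<^sup>2"
  unfolding orthonormal_form[OF assms] eucl_norm_def L2_set_def
  by (subst real_sqrt_pow2) (auto simp: sum_nonneg power2_eq_square)

lemma orthonormal_inj:
  assumes "orthonormal n u" "t \<in> extensional {..<n}" "t' \<in> extensional {..<n}"
    and "lincomb n u t = lincomb n u t'"
  shows "t = t'"
proof (rule extensionalityI[of _ "{..<n}"])
  fix i assume "i \<in> {..<n}"
  then show "t i = t' i"
    using orthonormal_coord[OF assms(1), of i] assms(4) by (metis lessThan_iff)
qed fact+

text \<open>The matrix \<open>a\<close> expresses \<open>v\<close> triangularly in \<open>u\<close>. Only the entries \<open>a i j\<close> with \<open>j \<le> i\<close> matter. The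
  last conjunct puts the \<open>i\<close>-th orthogonal vector into the coset of \<open>v i\<close>, which makes its
  length a lower bound that is attained there.\<close>

definition gram_schmidt ::
    "nat \<Rightarrow> (nat \<Rightarrow> 'e \<Rightarrow> real) \<Rightarrow> (nat \<Rightarrow> 'e \<Rightarrow> real) \<Rightarrow> (nat \<Rightarrow> nat \<Rightarrow> real) \<Rightarrow> bool" where
  "gram_schmidt n v u a \<longleftrightarrow> orthonormal n u \<and>
     (\<forall>i<n. 0 < a i i \<and> v i = lincomb (Suc i) u (a i) \<and>
        (\<exists>t. (\<lambda>e. a i i * u i e) = (coset_vec v i t)))"

lemma gram_schmidt_mono: "gram_schmidt n v u a \<Longrightarrow> m \<le> n \<Longrightarrow> gram_schmidt m v u a"
  unfolding gram_schmidt_def orthonormal_def by (meson order.strict_trans2)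

lemma gram_schmidt_range:
  assumes "gram_schmidt n v u a"
  shows "range (lincomb n u) = range (lincomb n v)"
  using assms
proof (induction n)
  case (Suc n)
  then have IH: "range (lincomb n u) = range (lincomb n v)"
    using gram_schmidt_mono[OF Suc.prems, of n] by simp
  have a: "a n n > 0" "v n = lincomb (Suc n) u (a n)" using Suc.prems by (auto simp: gram_schmidt_def)
  obtain t where t: "(\<lambda>e. a n n * u n e) = (\<lambda>e. v n e + lincomb n v t e)"
    using Suc.prems by (auto simp: gram_schmidt_def)
  show ?case
  proof (intro equalityI subsetI)
    fix x assume "x \<in> range (lincomb (Suc n) u)"
    then obtain s where s: "x = (\<lambda>e. s n * u n e + lincomb n u s e)" by (auto simp: lincomb_Suc)
    obtain s' where s': "lincomb n u s = lincomb n v s'" using IH by blast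
    let ?r = "s n / a n n"
    have "x e = ?r * v n e + (?r * lincomb n v t e + lincomb n v s' e)" for e
      using fun_cong[OF t, of e] a s s' by (simp add: field_simps)
    then have "x = (\<lambda>e. ?r * v n e + lincomb n v (\<lambda>i. ?r * t i + s' i) e)"
      by (intro ext) (simp only: lincomb_linear)
    also have "\<dots> = lincomb (Suc n) v ((\<lambda>i. ?r * t i + s' i)(n := ?r))"
      by (simp add: lincomb_Suc)
    finally show "x \<in> range (lincomb (Suc n) v)" by blast
  next
    fix x assume "x \<in> range (lincomb (Suc n) v)"
    then obtain s where s: "x = (\<lambda>e. s n * v n e + lincomb n v s e)" by (auto simp: lincomb_Suc)
    obtain s' where s': "lincomb n v s = lincomb n u s'" using IH by blast
    have "lincomb n u s' = lincomb (Suc n) u (s'(n := 0))"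
      by (simp add: lincomb_Suc)
    then have "x = lincomb (Suc n) u (\<lambda>i. s n * a n i + (s'(n := 0)) i)"
      unfolding lincomb_linear using s s' a by metis
    then show "x \<in> range (lincomb (Suc n) u)" by blast
  qed
qed simp

lemma gram_schmidt_exists:
  assumes "\<And>i t. i < n \<Longrightarrow> 0 < B (coset_vec v i t) (coset_vec v i t)"
  shows "\<exists>u a. gram_schmidt n v u a"
  using assms
proof (induction n)
  case 0
  show ?case by (auto simp: gram_schmidt_def orthonormal_def)
next
  case (Suc n)
  then obtain u a where gs: "gram_schmidt n v u a" by (meson less_SucI)
  then have on: "orthonormal n u" by (simp add: gram_schmidt_def)
  define p where "p = (\<lambda>i. B (v n) (u i))"
  obtain t where t: "lincomb n u (\<lambda>i. - p i) = lincomb n v t"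
    using gram_schmidt_range[OF gs] by blast
  define r where "r = (\<lambda>e. v n e + lincomb n v t e)"
  define c where "c = sqrt (B r r)"
  have "B r r > 0" using Suc.prems[of n t] by (simp add: r_def)
  then have c: "c > 0" "c * c = B r r" by (auto simp: c_def)
  have r: "r = (\<lambda>e. v n e - lincomb n u p e)" by (simp add: r_def lincomb_uminus flip: t)
  have orth: "B r (u i) = 0" if "i < n" for i
    unfolding r form_diff using orthonormal_coord[OF on that] by (simp add: p_def)
  define w where "w = (\<lambda>e. (1 / c) * r e)"
  let ?u = "u(n := w)" and ?a = "a(n := p(n := c))"
  have ww: "B w w = 1" unfolding w_def form_scale using c by (simp flip: c(2))
  have wu: "B w (u i) = 0" "B (u i) w = 0" if "i < n" for i
    using orth[OF that] sym unfolding w_def form_scale by auto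
  have on': "orthonormal (Suc n) ?u"
    using on ww wu unfolding orthonormal_def by (auto simp: less_Suc_eq)
  have "gram_schmidt (Suc n) v ?u ?a"
    unfolding gram_schmidt_def
  proof (intro conjI allI impI on')
    fix i assume "i < Suc n"
    then consider "i < n" | "i = n" by linarith
    then have "0 < ?a i i \<and> v i = lincomb (Suc i) ?u (?a i) \<and>
        (\<exists>t. (\<lambda>e. ?a i i * ?u i e) = (coset_vec v i t))"
    proof cases
      case 1
      have "lincomb (Suc i) ?u (?a i) = lincomb (Suc i) u (a i)"
        using 1 by (intro lincomb_cong) auto
      moreover have "?a i = a i" "?u i = u i" using 1 by auto
      moreover have "0 < a i i \<and> v i = lincomb (Suc i) u (a i) \<and>
        (\<exists>t. (\<lambda>e. a i i * u i e) = (coset_vec v i t))"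
        using gs 1 unfolding gram_schmidt_def by blast
      ultimately show ?thesis by metis
    next
      case 2
      have "lincomb (Suc n) ?u (?a n) = (\<lambda>e. c * w e + lincomb n u p e)"
        by (simp add: lincomb_Suc)
      also have "\<dots> = v n" using c by (auto simp: w_def r)
      finally have "v n = lincomb (Suc n) ?u (?a n)" by simp
      moreover have "(\<lambda>e. c * w e) = (\<lambda>e. v n e + lincomb n v t e)"
        using c by (auto simp: w_def r_def)
      moreover have "?a n n = c" "?u n = w" by auto
      ultimately show ?thesis using c(1) unfolding 2 by metis
    qed
    then show "0 < ?a i i" "v i = lincomb (Suc i) ?u (?a i)"
      "\<exists>t. (\<lambda>e. ?a i i * ?u i e) = (coset_vec v i t)" by blast+
  qed
  then show ?case by blast
qed

lemma gram_schmidt_coset: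
  assumes gs: "gram_schmidt n v u a" and i: "i < n"
  shows "(a i i)\<^sup>2 \<le> B (coset_vec v i t) (coset_vec v i t)"
proof -
  obtain s where s: "lincomb i v t = lincomb i u s"
    using gram_schmidt_range[OF gram_schmidt_mono[OF gs less_imp_le[OF i]]] by blast
  let ?s = "\<lambda>j. a i j + (s(i := 0)) j"
  have "lincomb i u s = lincomb (Suc i) u (s(i := 0))"
    by (simp add: lincomb_Suc)
  moreover have "v i = lincomb (Suc i) u (a i)" using gs i by (auto simp: gram_schmidt_def)
  ultimately have x: "(coset_vec v i t) = lincomb (Suc i) u ?s"
    using lincomb_linear[of "Suc i" u 1 "a i" "s(i := 0)"] s by simp
  have on: "orthonormal (Suc i) u" using gs i by (auto simp: gram_schmidt_def orthonormal_def)
  show ?thesis unfolding x orthonormal_form[OF on]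
    by (simp add: power2_eq_square sum_nonneg)
qed

lemma gram_schmidt_coset_attained:
  assumes gs: "gram_schmidt n v u a" and i: "i < n"
  shows "\<exists>t. (a i i)\<^sup>2 = B (coset_vec v i t) (coset_vec v i t)"
proof -
  obtain t where t: "(\<lambda>e. a i i * u i e) = (coset_vec v i t)"
    using gs i by (auto simp: gram_schmidt_def)
  have "B (u i) (u i) = 1" using gs i by (auto simp: gram_schmidt_def orthonormal_def)
  then have "B (\<lambda>e. a i i * u i e) (\<lambda>e. a i i * u i e) = (a i i)\<^sup>2"
    unfolding form_scale by (simp add: power2_eq_square)
  then show ?thesis unfolding t by metis
qed

end

section \<open>The determinant of a lattice\<close>

context symmetric_form
begin

lemma orthonormal_basis_iff:
  "orthonormal_basis n W B u \<longleftrightarrow> orthonormal n u \<and> W = range (lincomb n u)"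
  by (simp add: orthonormal_basis_def orthonormal_def)

text \<open>Parseval: the sum of all squared inner products \<open>B (u i) (u' j)\<close> equals both \<open>n\<close> and \<open>m\<close>.\<close>

lemma orthonormal_basis_size:
  assumes u: "orthonormal n u" and u': "orthonormal m u'"
    and eq: "range (lincomb n u) = range (lincomb m u')"
  shows "n = m"
proof -
  have unit: "\<exists>t. u i = lincomb n u t" if "i < n" for n i and u :: "nat \<Rightarrow> 'e \<Rightarrow> real"
    by (rule exI[of _ "\<lambda>j. of_bool (j = i)"]) (use that in \<open>auto simp: lincomb_def fun_eq_iff\<close>)
  have par: "(\<Sum>i<n. (B x (u i))\<^sup>2) = B x x" if "orthonormal n u" "x \<in> range (lincomb n u)"
    for n x and u :: "nat \<Rightarrow> 'e \<Rightarrow> real"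
    using that orthonormal_coord[OF that(1)] orthonormal_form[OF that(1)]
    by (auto simp: power2_eq_square)
  have "real n = (\<Sum>i<n. B (u i) (u i))" using u by (simp add: orthonormal_def)
  also have "\<dots> = (\<Sum>i<n. \<Sum>j<m. (B (u i) (u' j))\<^sup>2)"
  proof (rule sum.cong[OF refl])
    fix i assume "i \<in> {..<n}"
    then have "u i \<in> range (lincomb m u')" using unit[of i n u] eq by auto
    then show "B (u i) (u i) = (\<Sum>j<m. (B (u i) (u' j))\<^sup>2)" using par[OF u'] by simp
  qed
  also have "\<dots> = (\<Sum>j<m. \<Sum>i<n. (B (u' j) (u i))\<^sup>2)"
    by (subst sum.swap) (simp add: sym)
  also have "\<dots> = (\<Sum>j<m. B (u' j) (u' j))"
  proof (rule sum.cong[OF refl])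
    fix i assume "i \<in> {..<m}"
    then have "u' i \<in> range (lincomb n u)" using unit[of i m u'] eq by auto
    then show "(\<Sum>j<n. (B (u' i) (u j))\<^sup>2) = B (u' i) (u' i)" using par[OF u] by simp
  qed
  also have "\<dots> = real m" using u' by (simp add: orthonormal_def)
  finally show ?thesis by simp
qed

lemma coordinates_eq: "coordinates n u F = {t \<in> extensional {..<n}. lincomb n u t \<in> F}"
  by (simp add: coordinates_def space_lebesgue_n)

lemma bij_betw_coordinates:
  assumes on: "orthonormal n u" and L: "L \<subseteq> range (lincomb n u)"
  shows "bij_betw (lincomb n u) (coordinates n u L) L"
proof (rule bij_betwI')
  fix t t' assume "t \<in> coordinates n u L" "t' \<in> coordinates n u L"
  then show "(lincomb n u t = lincomb n u t') = (t = t')"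
    using orthonormal_inj[OF on] by (auto simp: coordinates_eq)
next
  fix l assume "l \<in> L"
  then obtain t where "l = lincomb n u t" using L by auto
  then have "l = lincomb n u (restrict t {..<n})" by simp
  then show "\<exists>t\<in>coordinates n u L. l = lincomb n u t"
    using \<open>l \<in> L\<close> by (intro bexI[of _ "restrict t {..<n}"]) (auto simp: coordinates_eq)
qed (auto simp: coordinates_eq)

lemma fundamental_domain_tiles:
  assumes on: "orthonormal n u" and F: "fundamental_domain (range (lincomb n u)) L F"
    and L: "L \<subseteq> range (lincomb n u)" and meas: "coordinates n u F \<in> sets (lebesgue_n n)"
  shows "tiles n (coordinates n u L) (coordinates n u F)"
  unfolding tiles_def
proof (intro conjI meas ballI)
  fix t :: "nat \<Rightarrow> real" assume t: "t \<in> extensional {..<n}"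
  have "\<exists>!l. l \<in> L \<and> (\<lambda>e. lincomb n u t e - l e) \<in> F"
    using bspec[OF conjunct2[OF F[unfolded fundamental_domain_def]] rangeI[of "lincomb n u" t]] .
  then obtain l where l': "l \<in> L \<and> (\<lambda>e. lincomb n u t e - l e) \<in> F"
    and uniq: "\<forall>l'. l' \<in> L \<and> (\<lambda>e. lincomb n u t e - l' e) \<in> F \<longrightarrow> l' = l" by (rule ex1E)
  have l: "l \<in> L" "(\<lambda>e. lincomb n u t e - l e) \<in> F"
    by (rule conjunct1[OF l']) (rule conjunct2[OF l'])
  have img: "lincomb n u ` coordinates n u L = L"
    by (rule bij_betw_imp_surj_on[OF bij_betw_coordinates[OF on L]])
  have "l \<in> lincomb n u ` coordinates n u L"
    unfolding img by (rule l(1))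
  then obtain c where c: "l = lincomb n u c" "c \<in> coordinates n u L" by (rule imageE)
  show "\<exists>!c. c \<in> coordinates n u L \<and> shift n (\<lambda>i. - c i) t \<in> coordinates n u F"
  proof (rule ex1I[of _ c])
    show "c \<in> coordinates n u L \<and> shift n (\<lambda>i. - c i) t \<in> coordinates n u F"
      using c l by (simp add: coordinates_eq lincomb_shift)
    fix c' assume c': "c' \<in> coordinates n u L \<and> shift n (\<lambda>i. - c' i) t \<in> coordinates n u F"
    then have "lincomb n u c' = l"
      by (intro uniq[rule_format]) (simp add: coordinates_eq lincomb_shift)
    then have "lincomb n u c' = lincomb n u c" using c by simp
    then show "c' = c" using c c' by (intro orthonormal_inj[OF on]) (auto simp: coordinates_eq)
  qed
qed

lemma card_lattice_ball:
  assumes on: "orthonormal n u" and L: "L \<subseteq> range (lincomb n u)" and R: "R \<ge> 0"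
  shows "bij_betw (lincomb n u) {c \<in> coordinates n u L. eucl_norm n c \<le> R} {l \<in> L. B l l \<le> R\<^sup>2}"
proof -
  note bij = bij_betw_coordinates[OF on L]
  have nonneg: "eucl_norm n c \<ge> 0" for c by (simp add: eucl_norm_def)
  have iff: "B (lincomb n u c) (lincomb n u c) \<le> R\<^sup>2 \<longleftrightarrow> eucl_norm n c \<le> R" for c
    using orthonormal_norm[OF on] R nonneg by (simp add: power_mono_iff)
  have "lincomb n u ` {c \<in> coordinates n u L. eucl_norm n c \<le> R} = {l \<in> L. B l l \<le> R\<^sup>2}"
  proof (intro equalityI subsetI)
    fix l assume "l \<in> lincomb n u ` {c \<in> coordinates n u L. eucl_norm n c \<le> R}"
    then show "l \<in> {l \<in> L. B l l \<le> R\<^sup>2}" using iff by (auto simp: coordinates_eq)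
  next
    fix l assume l: "l \<in> {l \<in> L. B l l \<le> R\<^sup>2}"
    then obtain c where "c \<in> coordinates n u L" "l = lincomb n u c"
      using bij_betw_imp_surj_on[OF bij] by (metis (no_types, lifting) imageE mem_Collect_eq)
    then show "l \<in> lincomb n u ` {c \<in> coordinates n u L. eucl_norm n c \<le> R}" using l iff by auto
  qed
  then show ?thesis
    by (intro bij_betw_subset[OF bij]) auto
qed

definition gs_box :: "nat \<Rightarrow> (nat \<Rightarrow> 'e \<Rightarrow> real) \<Rightarrow> (nat \<Rightarrow> nat \<Rightarrow> real) \<Rightarrow> ('e \<Rightarrow> real) set" where
  "gs_box n u a = {lincomb n u y | y. \<forall>i<n. 0 \<le> y i \<and> y i < a i i}"

lemma gs_box_iff:
  assumes "orthonormal n u"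
  shows "lincomb n u y \<in> gs_box n u a \<longleftrightarrow> (\<forall>i<n. 0 \<le> y i \<and> y i < a i i)"
proof
  assume "lincomb n u y \<in> gs_box n u a"
  then obtain y' where "lincomb n u y = lincomb n u y'" "\<forall>i<n. 0 \<le> y' i \<and> y' i < a i i"
    by (auto simp: gs_box_def)
  then show "\<forall>i<n. 0 \<le> y i \<and> y i < a i i" using orthonormal_coord[OF assms] by metis
qed (auto simp: gs_box_def)

lemma gram_schmidt_lincomb:
  assumes "gram_schmidt n v u a"
  shows "lincomb n v k = lincomb n u (\<lambda>j. \<Sum>i<n. k i * (if j \<le> i then a i j else 0))"
proof
  fix e
  have "lincomb n v k e = (\<Sum>i<n. k i * (\<Sum>j<n. (if j \<le> i then a i j else 0) * u j e))"
    unfolding lincomb_def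
  proof (rule sum.cong[OF refl])
    fix i assume i: "i \<in> {..<n}"
    then have "v i e = (\<Sum>j<Suc i. a i j * u j e)"
      using assms by (auto simp: gram_schmidt_def lincomb_def)
    also have "\<dots> = (\<Sum>j<n. (if j \<le> i then a i j else 0) * u j e)"
      using i by (intro sum.mono_neutral_cong_left) auto
    finally show "k i * v i e = k i * (\<Sum>j<n. (if j \<le> i then a i j else 0) * u j e)" by simp
  qed
  also have "\<dots> = (\<Sum>j<n. \<Sum>i<n. k i * ((if j \<le> i then a i j else 0) * u j e))"
    unfolding sum_distrib_left by (rule sum.swap)
  finally show "lincomb n v k e = lincomb n u (\<lambda>j. \<Sum>i<n. k i * (if j \<le> i then a i j else 0)) e"
    by (simp add: lincomb_def sum_distrib_right mult.assoc)
qed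

text \<open>Since the basis is triangular in \<open>u\<close>, a rectangular box serves as a fundamental domain, and its volume
  can be read off without any change of variables for linear maps.\<close>

lemma gs_box_fundamental_domain:
  assumes gs: "gram_schmidt n v u a"
  shows "fundamental_domain (range (lincomb n u)) (int_comb n v) (gs_box n u a)"
  unfolding fundamental_domain_def
proof (intro conjI ballI)
  show "gs_box n u a \<subseteq> range (lincomb n u)" by (auto simp: gs_box_def)
  fix x assume "x \<in> range (lincomb n u)"
  then obtain y where y: "x = lincomb n u y" by blast
  have on: "orthonormal n u" using gs by (simp add: gram_schmidt_def)
  define a' where "a' i j = (if j \<le> i then a i j else 0)" for i j
  have a': "a' i i > 0" if "i < n" for i using gs that by (simp add: gram_schmidt_def a'_def)
  have tri: "a' i j = 0" if "i < j" for i j using that by (simp add: a'_def)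
  have mem: "(\<lambda>e. x e - lincomb n v k e) \<in> gs_box n u a \<longleftrightarrow>
      (\<forall>j<n. 0 \<le> y j - (\<Sum>i<n. k i * a' i j) \<and> y j - (\<Sum>i<n. k i * a' i j) < a' j j)" for k
  proof -
    have "(\<lambda>e. x e - lincomb n v k e) = lincomb n u (\<lambda>j. y j - (\<Sum>i<n. k i * a' i j))"
      using lincomb_linear[of n u "-1" "\<lambda>j. \<Sum>i<n. k i * a' i j" y]
      by (simp add: y gram_schmidt_lincomb[OF gs] a'_def)
    then show ?thesis using gs_box_iff[OF on] by (simp add: a'_def)
  qed
  obtain k where k: "\<forall>i<n. k i \<in> \<int>"
    "\<forall>j<n. 0 \<le> y j - (\<Sum>i<n. k i * a' i j) \<and> y j - (\<Sum>i<n. k i * a' i j) < a' j j"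
    using triangular_reduction[of n a' y] a' tri by blast
  show "\<exists>!l. l \<in> int_comb n v \<and> (\<lambda>e. x e - l e) \<in> gs_box n u a"
  proof (rule ex1I[of _ "lincomb n v k"])
    show "lincomb n v k \<in> int_comb n v \<and> (\<lambda>e. x e - lincomb n v k e) \<in> gs_box n u a"
      using k mem by (auto simp: int_comb_def)
    fix l assume l: "l \<in> int_comb n v \<and> (\<lambda>e. x e - l e) \<in> gs_box n u a"
    then obtain k' where k': "l = lincomb n v k'" "\<forall>i<n. k' i \<in> \<int>" by (auto simp: int_comb_def)
    have "\<forall>i<n. k' i - k i = 0"
    proof (rule triangular_unique[of n a'])
      fix j assume j: "j < n"
      have "(\<Sum>i<n. (k' i - k i) * a' i j) = (\<Sum>i<n. k' i * a' i j) - (\<Sum>i<n. k i * a' i j)"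
        by (simp add: left_diff_distrib sum_subtractf)
      moreover have "0 \<le> y j - (\<Sum>i<n. k i * a' i j)" "y j - (\<Sum>i<n. k i * a' i j) < a' j j"
        using k(2) j by auto
      moreover have "0 \<le> y j - (\<Sum>i<n. k' i * a' i j)" "y j - (\<Sum>i<n. k' i * a' i j) < a' j j"
        using l mem[of k'] j unfolding k'(1) by auto
      ultimately show "\<bar>\<Sum>i<n. (k' i - k i) * a' i j\<bar> < a' j j"
        by (simp add: abs_less_iff)
    qed (use a' tri k k' in auto)
    then show "l = lincomb n v k" unfolding k' by (intro lincomb_cong) auto
  qed
qed

lemma coordinates_gs_box:
  assumes on: "orthonormal n u" and on': "orthonormal n u'"
    and eq: "range (lincomb n u') = range (lincomb n u)"
  shows "coordinates n u' (gs_box n u a) =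
      {t \<in> extensional {..<n}. \<forall>j<n. 0 \<le> (\<Sum>i<n. t i * B (u' i) (u j)) \<and>
         (\<Sum>i<n. t i * B (u' i) (u j)) < a j j}"
    and "coordinates n u' (gs_box n u a) \<subseteq> eucl_ball n (1 + eucl_norm n (\<lambda>j. a j j))"
proof -
  have expand: "lincomb n u' t = lincomb n u (\<lambda>j. \<Sum>i<n. t i * B (u' i) (u j))" for t
  proof -
    obtain y where y: "lincomb n u' t = lincomb n u y" using eq by blast
    have "y j = (\<Sum>i<n. t i * B (u' i) (u j))" if "j < n" for j
      using orthonormal_coord[OF on that, of y] form_lincomb[of n u' t] by (simp flip: y)
    then show ?thesis unfolding y by (intro lincomb_cong) auto
  qed
  show 1: "coordinates n u' (gs_box n u a) =
      {t \<in> extensional {..<n}. \<forall>j<n. 0 \<le> (\<Sum>i<n. t i * B (u' i) (u j)) \<and>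
         (\<Sum>i<n. t i * B (u' i) (u j)) < a j j}"
    unfolding coordinates_eq by (subst expand) (simp add: gs_box_iff[OF on])
  show "coordinates n u' (gs_box n u a) \<subseteq> eucl_ball n (1 + eucl_norm n (\<lambda>j. a j j))"
  proof
    fix t assume "t \<in> coordinates n u' (gs_box n u a)"
    then have t: "t \<in> extensional {..<n}"
      "\<forall>j<n. 0 \<le> (\<Sum>i<n. t i * B (u' i) (u j)) \<and> (\<Sum>i<n. t i * B (u' i) (u j)) < a j j"
      unfolding 1 by auto
    have "(eucl_norm n t)\<^sup>2 = (eucl_norm n (\<lambda>j. \<Sum>i<n. t i * B (u' i) (u j)))\<^sup>2"
      using orthonormal_norm[OF on'] orthonormal_norm[OF on] expand by metis
    then have "eucl_norm n t = eucl_norm n (\<lambda>j. \<Sum>i<n. t i * B (u' i) (u j))"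
      by (simp add: eucl_norm_def)
    also have "\<dots> \<le> eucl_norm n (\<lambda>j. a j j)"
      unfolding eucl_norm_def by (rule L2_set_mono) (use t in \<open>auto intro: less_imp_le\<close>)
    finally show "t \<in> eucl_ball n (1 + eucl_norm n (\<lambda>j. a j j))" using t by (simp add: eucl_ball_def)
  qed
qed

lemma coordinates_gs_box_sets:
  assumes "orthonormal n u" "orthonormal n u'" "range (lincomb n u') = range (lincomb n u)"
  shows "coordinates n u' (gs_box n u a) \<in> sets (lebesgue_n n)"
proof -
  have "{t \<in> space (lebesgue_n n). \<forall>j\<in>{..<n}. 0 \<le> (\<Sum>i<n. t i * B (u' i) (u j)) \<and>
         (\<Sum>i<n. t i * B (u' i) (u j)) < a j j} \<in> sets (lebesgue_n n)"
    by measurable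
  then show ?thesis
    by (simp only: coordinates_gs_box(1)[OF assms] space_lebesgue_n Ball_def lessThan_iff)
qed

lemma measure_gs_box:
  assumes gs: "gram_schmidt n v u a"
  shows "measure (lebesgue_n n) (coordinates n u (gs_box n u a)) = (\<Prod>i<n. a i i)"
proof -
  have on: "orthonormal n u" and a: "\<And>i. i < n \<Longrightarrow> 0 < a i i" using gs by (auto simp: gram_schmidt_def)
  have "coordinates n u (gs_box n u a) = Pi\<^sub>E {..<n} (\<lambda>i. {0..<a i i})"
    unfolding coordinates_eq gs_box_iff[OF on] by (auto simp: PiE_def)
  moreover have "emeasure (lebesgue_n n) (Pi\<^sub>E {..<n} (\<lambda>i. {0..<a i i})) = (\<Prod>i<n. emeasure lborel {0..<a i i})"
    by (intro lborel_n.emeasure_PiM) auto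
  moreover have "\<dots> = (\<Prod>i<n. ennreal (a i i))"
    using a by (intro prod.cong refl) (simp add: less_imp_le)
  moreover have "\<dots> = ennreal (\<Prod>i<n. a i i)"
    using a by (intro prod_ennreal) (simp add: less_imp_le)
  moreover have "0 \<le> (\<Prod>i<n. a i i)" using a by (intro prod_nonneg) (simp add: less_imp_le)
  ultimately show ?thesis by (simp add: measure_def)
qed

lemma finite_lattice_ball:
  assumes gs: "gram_schmidt n v u a" and R: "R \<ge> 0"
  shows "finite {l \<in> int_comb n v. B l l \<le> R\<^sup>2}"
proof -
  let ?L = "int_comb n v" and ?P = "coordinates n u (gs_box n u a)" and ?d = "1 + eucl_norm n (\<lambda>j. a j j)"
  have on: "orthonormal n u" and a: "\<And>i. i < n \<Longrightarrow> 0 < a i i" using gs by (auto simp: gram_schmidt_def)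
  have L: "?L \<subseteq> range (lincomb n u)" using int_comb_subset[of n v] gram_schmidt_range[OF gs] by simp
  have D: "measure (lebesgue_n n) ?P > 0"
    unfolding measure_gs_box[OF gs] using a by (intro prod_pos) auto
  let ?S = "{c \<in> coordinates n u ?L. eucl_norm n c \<le> R}"
  have tiles: "tiles n (coordinates n u ?L) ?P"
    by (intro fundamental_domain_tiles on gs_box_fundamental_domain gs L coordinates_gs_box_sets refl)
  have "card G \<le> nat \<lfloor>ball_vol n (R + ?d) / measure (lebesgue_n n) ?P\<rfloor>" if "finite G" "G \<subseteq> ?S" for G
  proof -
    have "real (card G) * measure (lebesgue_n n) ?P \<le> ball_vol n (R + ?d)"
      by (rule lattice_points_le[OF tiles _ coordinates_gs_box(2)[OF on on refl]])
         (use that in \<open>auto simp: coordinates_eq\<close>)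
    then show ?thesis using D by (simp add: le_nat_floor field_simps)
  qed
  then have "finite ?S" by (meson finite_if_finite_subsets_card_bdd)
  then show ?thesis using bij_betw_finite[OF card_lattice_ball[OF on L R]] by simp
qed

text \<open>Lebesgue measure in two orthonormal coordinate systems gives the same volume. Instead of invariance under
  rotations this uses that a ball is described by the same inequality in both systems: the lattice points in a
  large ball, multiplied by the volume of the box in either system, approximate the volume of that ball.\<close>

lemma measure_gs_box_indep:
  assumes gs: "gram_schmidt n v u a" and on': "orthonormal n u'"
    and eq: "range (lincomb n u') = range (lincomb n u)"
  shows "measure (lebesgue_n n) (coordinates n u' (gs_box n u a)) = (\<Prod>i<n. a i i)"
proof -
  let ?L = "int_comb n v" and ?F = "gs_box n u a" and ?d = "1 + eucl_norm n (\<lambda>j. a j j)"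
  have on: "orthonormal n u" using gs by (simp add: gram_schmidt_def)
  have d: "?d > 0" by (simp add: eucl_norm_def add_pos_nonneg)
  define N where "N R = real (card {l \<in> ?L. B l l \<le> R\<^sup>2})" for R
  have main: "N R * measure (lebesgue_n n) (coordinates n w ?F) \<le> ball_vol n (R + ?d)"
      "ball_vol n (R - ?d) \<le> N R * measure (lebesgue_n n) (coordinates n w ?F)"
    if w: "orthonormal n w" "range (lincomb n w) = range (lincomb n u)" and R: "R \<ge> ?d" for w R
  proof -
    let ?P = "coordinates n w ?F"
    have L: "?L \<subseteq> range (lincomb n w)" using int_comb_subset[of n v] gram_schmidt_range[OF gs] w(2) by simp
    have R0: "R \<ge> 0" using R d by linarith
    let ?S = "{c \<in> coordinates n w ?L. eucl_norm n c \<le> R}"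
    have tiles: "tiles n (coordinates n w ?L) ?P"
      by (intro fundamental_domain_tiles w L coordinates_gs_box_sets on)
         (use gs_box_fundamental_domain[OF gs] w in auto)
    note bij = card_lattice_ball[OF w(1) L R0]
    have fin: "finite ?S" using bij_betw_finite[OF bij] finite_lattice_ball[OF gs R0] by simp
    have card: "N R = real (card ?S)" using bij_betw_same_card[OF bij] by (simp add: N_def)
    show "N R * measure (lebesgue_n n) ?P \<le> ball_vol n (R + ?d)" unfolding card
      by (rule lattice_points_le[OF tiles _ coordinates_gs_box(2)[OF on w]])
         (use fin in \<open>auto simp: coordinates_eq\<close>)
    show "ball_vol n (R - ?d) \<le> N R * measure (lebesgue_n n) ?P" unfolding card
      by (rule lattice_points_ge[OF tiles _ coordinates_gs_box(2)[OF on w]])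
         (use fin in \<open>auto simp: coordinates_eq\<close>)
  qed
  have N: "N R \<ge> 0" for R by (simp add: N_def)
  have "measure (lebesgue_n n) (coordinates n u' ?F) = measure (lebesgue_n n) (coordinates n u ?F)"
    (is "?D' = ?D")
  proof (rule antisym)
    show "?D' \<le> ?D"
      by (rule growth_comparison[where N = N and d = ?d and n = n])
         (rule main[OF on refl] main[OF on' eq] N d measure_nonneg | assumption)+
    show "?D \<le> ?D'"
      by (rule growth_comparison[where N = N and d = ?d and n = n])
         (rule main[OF on refl] main[OF on' eq] N d measure_nonneg | assumption)+
  qed
  then show ?thesis by (simp add: measure_gs_box[OF gs])
qed

text \<open>Two choices enter the definition of the determinant: the fundamental domain, which does not matter by the
  tiling argument, and the orthonormal basis, which does not matter by the count of lattice points.\<close>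

theorem lattice_det_gram_schmidt:
  assumes gs: "gram_schmidt n v u a"
  shows "lattice_det n (range (lincomb n v)) B (int_comb n v) = (\<Prod>i<n. (a i i)\<^sup>2)"
  unfolding lattice_det_def
proof (rule the_equality)
  let ?W = "range (lincomb n v)" and ?L = "int_comb n v" and ?F = "gs_box n u a"
  have on: "orthonormal n u" using gs by (simp add: gram_schmidt_def)
  have W: "?W = range (lincomb n u)" using gram_schmidt_range[OF gs] by simp
  show "\<exists>u F. orthonormal_basis n ?W B u \<and> fundamental_domain ?W ?L F \<and>
      coordinates n u F \<in> sets (lebesgue_n n) \<and>
      (\<Prod>i<n. (a i i)\<^sup>2) = (measure (lebesgue_n n) (coordinates n u F))\<^sup>2"
    using on gs_box_fundamental_domain[OF gs] coordinates_gs_box_sets[OF on on refl, of a]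
      measure_gs_box[OF gs]
    by (intro exI[of _ u] exI[of _ ?F]) (simp add: orthonormal_basis_iff W prod_power_distrib)
  fix d assume "\<exists>u F. orthonormal_basis n ?W B u \<and> fundamental_domain ?W ?L F \<and>
      coordinates n u F \<in> sets (lebesgue_n n) \<and> d = (measure (lebesgue_n n) (coordinates n u F))\<^sup>2"
  then obtain u' F where on': "orthonormal n u'" and eq: "range (lincomb n u') = range (lincomb n u)"
    and F: "fundamental_domain (range (lincomb n u')) ?L F" "coordinates n u' F \<in> sets (lebesgue_n n)"
    and d: "d = (measure (lebesgue_n n) (coordinates n u' F))\<^sup>2"
    by (auto simp: orthonormal_basis_iff W)
  let ?C = "coordinates n u' ?L"
  have L: "?L \<subseteq> range (lincomb n u')" using int_comb_subset[of n v] W eq by simp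
  note bij = bij_betw_coordinates[OF on' L]
  have "emeasure (lebesgue_n n) (coordinates n u' F) = emeasure (lebesgue_n n) (coordinates n u' ?F)"
  proof (rule tiles_emeasure_eq[of ?C])
    show "countable ?C"
      using countable_image_inj_on[of "lincomb n u'" ?C] bij countable_int_comb
      by (simp add: bij_betw_def)
    show "?C \<subseteq> extensional {..<n}" by (auto simp: coordinates_eq)
    show "(\<lambda>i\<in>{..<n}. - c i) \<in> ?C" if "c \<in> ?C" for c
      using that int_comb_uminus by (auto simp: coordinates_eq lincomb_uminus)
    show "tiles n ?C (coordinates n u' F)"
      by (rule fundamental_domain_tiles) fact+
    show "tiles n ?C (coordinates n u' ?F)"
      by (intro fundamental_domain_tiles on' L coordinates_gs_box_sets on eq)
         (use gs_box_fundamental_domain[OF gs] eq in auto)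
  qed
  then have "measure (lebesgue_n n) (coordinates n u' F) = (\<Prod>i<n. a i i)"
    using measure_gs_box_indep[OF gs on' eq] by (simp add: measure_def)
  then show "d = (\<Prod>i<n. (a i i)\<^sup>2)" by (simp add: d prod_power_distrib)
qed

text \<open>The minimum exists because a ball contains only finitely many lattice points.\<close>

lemma lattice_norm_attained:
  assumes gs: "gram_schmidt n v u a" and n: "n \<ge> 1"
  shows "\<exists>l\<in>int_comb n v. l \<noteq> (\<lambda>_. 0) \<and> lattice_norm B (int_comb n v) = B l l"
    and "l \<in> int_comb n v \<Longrightarrow> l \<noteq> (\<lambda>_. 0) \<Longrightarrow> lattice_norm B (int_comb n v) \<le> B l l"
proof -
  let ?L = "int_comb n v"
  have "v 0 = lincomb n v (\<lambda>j. of_bool (j = 0))"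
    using n by (auto simp: lincomb_def fun_eq_iff)
  then have v0: "v 0 \<in> ?L" by (auto simp: int_comb_def)
  have "(a 0 0)\<^sup>2 \<le> B (v 0) (v 0)" "a 0 0 > 0"
    using gram_schmidt_coset[OF gs, of 0] gs n by (auto simp: gram_schmidt_def)
  then have v00: "B (v 0) (v 0) > 0" by (meson less_le_trans zero_less_power)
  then have v0_nz: "v 0 \<noteq> (\<lambda>_. 0)" by auto
  define R where "R = sqrt (B (v 0) (v 0))"
  have R: "R \<ge> 0" "R\<^sup>2 = B (v 0) (v 0)" using v00 by (auto simp: R_def)
  define S where "S = {l \<in> ?L. l \<noteq> (\<lambda>_. 0) \<and> B l l \<le> R\<^sup>2}"
  have S: "finite S" "v 0 \<in> S"
    using finite_subset[OF _ finite_lattice_ball[OF gs R(1)], of S] v0 v0_nz R by (auto simp: S_def)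
  define m where "m = Min ((\<lambda>l. B l l) ` S)"
  have "m \<in> (\<lambda>l. B l l) ` S" unfolding m_def using S by (intro Min_in) auto
  then obtain l0 where l0: "l0 \<in> S" "m = B l0 l0" by blast
  have le: "m \<le> B l l" if "l \<in> ?L" "l \<noteq> (\<lambda>_. 0)" for l
  proof (cases "B l l \<le> R\<^sup>2")
    case True
    then show ?thesis using that S unfolding m_def by (intro Min_le) (auto simp: S_def)
  next
    case False
    moreover have "m \<le> B (v 0) (v 0)" using S unfolding m_def by (intro Min_le) auto
    ultimately show ?thesis using R by linarith
  qed
  have norm: "lattice_norm B ?L = m"
    unfolding lattice_norm_def
  proof (rule Least_equality)
    show "\<exists>l\<in>?L. l \<noteq> (\<lambda>_. 0) \<and> m = B l l" using l0 by (auto simp: S_def)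
  qed (use le in blast)
  show "\<exists>l\<in>?L. l \<noteq> (\<lambda>_. 0) \<and> lattice_norm B ?L = B l l"
    using l0 norm by (auto simp: S_def)
  show "l \<in> ?L \<Longrightarrow> l \<noteq> (\<lambda>_. 0) \<Longrightarrow> lattice_norm B ?L \<le> B l l" using le norm by simp
qed

end

section \<open>Chains and spanning trees\<close>

lemma symmetric_form_weight_form: "symmetric_form (weight_form E w)"
proof
  show "weight_form E w x y = weight_form E w y x" for x y
    by (simp add: weight_form_def mult_ac)
  show "weight_form E w (\<lambda>e. r * x e + y e) z = r * weight_form E w x z + weight_form E w y z" for r x y z
    by (simp add: weight_form_def algebra_simps sum.distrib sum_distrib_left)
qed

definition edge_chain :: "'b \<Rightarrow> 'b \<Rightarrow> real" where
  "edge_chain e = (\<lambda>e'. of_bool (e' = e))"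

definition inc :: "('a set \<Rightarrow> 'a \<times> 'a) \<Rightarrow> 'a set \<Rightarrow> 'a \<Rightarrow> real" where
  "inc ori e v = of_bool (snd (ori e) = v) - of_bool (fst (ori e) = v)"

lemma boundary_inc: "boundary E ori c v = (\<Sum>e\<in>E. c e * inc ori e v)"
  by (simp add: boundary_def inc_def)

lemma boundary_linear:
  "boundary E ori (\<lambda>e. r * c e + d e) v = r * boundary E ori c v + boundary E ori d v"
  by (simp add: boundary_inc algebra_simps sum.distrib sum_distrib_left)

lemma boundary_add: "boundary E ori (\<lambda>e. c e + d e) v = boundary E ori c v + boundary E ori d v"
  using boundary_linear[of E ori 1 c d v] by simp

lemma boundary_diff: "boundary E ori (\<lambda>e. c e - d e) v = boundary E ori c v - boundary E ori d v"
  using boundary_linear[of E ori "-1" d c v] by simp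

lemma boundary_zero [simp]: "boundary E ori (\<lambda>_. 0) v = 0"
  by (simp add: boundary_inc)

lemma boundary_edge_chain:
  assumes "finite E" "e \<in> E" shows "boundary E ori (edge_chain e) v = inc ori e v"
  using assms by (simp add: boundary_inc edge_chain_def of_bool_def if_distrib[of "\<lambda>x. x * _"] cong: if_cong)

lemma boundary_restrict:
  assumes "finite E" "E' \<subseteq> E" "\<And>e. e \<in> E - E' \<Longrightarrow> c e = 0"
  shows "boundary E ori c v = boundary E' ori c v"
  unfolding boundary_inc using assms by (intro sum.mono_neutral_right) auto

lemma inc_edge:
  assumes "{fst (ori e), snd (ori e)} = {a, b}" "a \<noteq> b"
  obtains \<sigma> where "\<sigma> = 1 \<or> \<sigma> = -1" "\<And>v. inc ori e v = \<sigma> * (of_bool (v = a) - of_bool (v = b))"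
proof -
  have "(fst (ori e) = a \<and> snd (ori e) = b) \<or> (fst (ori e) = b \<and> snd (ori e) = a)"
    using assms by (auto simp: doubleton_eq_iff)
  then consider "fst (ori e) = a" "snd (ori e) = b" | "fst (ori e) = b" "snd (ori e) = a" by blast
  then show ?thesis
  proof cases
    case 1
    then show ?thesis by (intro that[of "-1"]) (auto simp: inc_def)
  next
    case 2
    then show ?thesis by (intro that[of 1]) (auto simp: inc_def)
  qed
qed

lemma H1_real_linear:
  assumes "c \<in> H1_real V E ori" "d \<in> H1_real V E ori"
  shows "(\<lambda>e. r * c e + d e) \<in> H1_real V E ori"
  using assms by (auto simp: H1_real_def chains_def boundary_linear)

lemma H1_real_zero: "(\<lambda>_. 0) \<in> H1_real V E ori"
  by (auto simp: H1_real_def chains_def)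

lemma H1_int_iff: "c \<in> H1_int V E ori \<longleftrightarrow> c \<in> H1_real V E ori \<and> (\<forall>e. c e \<in> \<int>)"
  by (auto simp: H1_int_def H1_real_def chains_def)

lemma H1_real_lincomb:
  "(\<And>i. i < n \<Longrightarrow> z i \<in> H1_real V E ori) \<Longrightarrow> lincomb n z t \<in> H1_real V E ori"
  by (induction n) (auto simp: lincomb_Suc H1_real_zero intro!: H1_real_linear)

lemma H1_int_lincomb:
  "(\<And>i. i < n \<Longrightarrow> z i \<in> H1_int V E ori) \<Longrightarrow> (\<And>i. i < n \<Longrightarrow> t i \<in> \<int>) \<Longrightarrow> lincomb n z t \<in> H1_int V E ori"
  unfolding H1_int_iff using H1_real_lincomb[of n z V E ori t]
  by (auto simp: lincomb_def intro!: Ints_sum Ints_mult)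

lemma sum_lessThan_add:
  "(\<Sum>i<b + l. g i) = (\<Sum>i<b. g i) + (\<Sum>i<(l::nat). g (b + i) :: real)"
  by (induction l) auto

lemma prod_lessThan_add:
  "(\<Prod>i<b + l. g i) = (\<Prod>i<b. g i) * (\<Prod>i<(l::nat). g (b + i) :: real)"
  by (induction l) auto

text \<open>A spanning tree is encoded by an order of the vertices in which each vertex \<open>x k\<close> with \<open>k \<ge> 1\<close> is joined
  by the tree edge \<open>f k\<close> to an earlier one. The last vertex is then always a leaf, so that statements about the
  tree become triangular systems.\<close>

locale ordered_tree =
  fixes V :: "'a set" and E :: "'a set set" and ori :: "'a set \<Rightarrow> 'a \<times> 'a"
    and n :: nat and x :: "nat \<Rightarrow> 'a" and f :: "nat \<Rightarrow> 'a set"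
  assumes fin_E: "finite E" and ends: "\<And>e. e \<in> E \<Longrightarrow> e \<subseteq> V \<and> card e = 2"
    and ori: "orientation E ori"
    and n_pos: "n \<ge> 1" and x_bij: "bij_betw x {..<n} V"
    and tree: "\<And>k. 1 \<le> k \<Longrightarrow> k < n \<Longrightarrow> f k \<in> E \<and> (\<exists>j<k. f k = {x k, x j})"
begin

definition "T = f ` {1..<n}"

lemma x_inj: "i < n \<Longrightarrow> j < n \<Longrightarrow> x i = x j \<longleftrightarrow> i = j"
  using x_bij by (auto simp: bij_betw_def inj_on_def)

lemma T_sub: "T \<subseteq> E" using tree by (auto simp: T_def)

lemma endpoints: "e \<in> E \<Longrightarrow> {fst (ori e), snd (ori e)} = e"
  using ori unfolding orientation_def by blast

lemma ends_distinct: "e \<in> E \<Longrightarrow> fst (ori e) \<noteq> snd (ori e)"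
proof
  assume e: "e \<in> E" and "fst (ori e) = snd (ori e)"
  then have "card {fst (ori e), snd (ori e)} = 1" by simp
  then show False using endpoints[OF e] ends[OF e] by simp
qed

lemma inc_endpoints: assumes "e \<in> E" "inc ori e v \<noteq> 0" shows "v \<in> e"
proof -
  have "v \<in> {fst (ori e), snd (ori e)}" using assms(2) by (auto simp: inc_def)
  then show ?thesis unfolding endpoints[OF assms(1)] .
qed

lemma inc_abs: assumes "e \<in> E" "v \<in> e" shows "inc ori e v = 1 \<or> inc ori e v = -1"
proof -
  have "v \<in> {fst (ori e), snd (ori e)}" unfolding endpoints[OF assms(1)] by fact
  then show ?thesis using ends_distinct[OF assms(1)] by (auto simp: inc_def)
qed

lemma tree_inc:
  assumes "1 \<le> k" "k < n"
  obtains j \<sigma> where "j < k" "\<sigma> = 1 \<or> \<sigma> = -1"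
    "\<And>v. inc ori (f k) v = \<sigma> * (of_bool (v = x k) - of_bool (v = x j))"
proof -
  obtain j where j: "j < k" "f k = {x k, x j}" "f k \<in> E" using tree[OF assms] by blast
  have "x k \<noteq> x j" using x_inj[of k j] j assms by auto
  moreover have "{fst (ori (f k)), snd (ori (f k))} = {x k, x j}"
    using endpoints[of "f k"] j by simp
  ultimately show ?thesis using that j(1) by (metis inc_edge)
qed

lemma inc_earlier: assumes "1 \<le> j" "j < k" "k < n" shows "inc ori (f j) (x k) = 0"
proof -
  obtain i \<sigma> where i: "i < j" "\<And>v. inc ori (f j) v = \<sigma> * (of_bool (v = x j) - of_bool (v = x i))"
    using tree_inc[of j] assms by (metis less_trans)
  then show ?thesis using x_inj[of k j] x_inj[of k i] assms by simp
qed

lemma inc_own: assumes "1 \<le> k" "k < n" shows "inc ori (f k) (x k) = 1 \<or> inc ori (f k) (x k) = -1"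
  using tree[OF assms] by (intro inc_abs) auto

lemma f_inj: "inj_on f {1..<n}"
proof (rule linorder_inj_onI')
  fix i j assume ij: "i \<in> {1..<n}" "j \<in> {1..<n}" "i < j"
  then show "f i \<noteq> f j" using inc_earlier[of i j] inc_own[of j] by auto
qed

lemma card_T: "card T = n - 1"
  unfolding T_def using card_image[OF f_inj] by simp

text \<open>At the vertex \<open>x k\<close> of the last tree edge \<open>f k\<close> that occurs in the cycle no other tree edge of the cycle
  ends, so that the boundary there is the coefficient of \<open>f k\<close> up to sign.\<close>

lemma tree_acyclic:
  assumes c: "c \<in> H1_real V E ori" and supp: "\<And>e. e \<notin> T \<Longrightarrow> c e = 0"
  shows "c = (\<lambda>_. 0)"
proof (rule ccontr)
  assume "c \<noteq> (\<lambda>_. 0)"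
  then obtain e where "c e \<noteq> 0" by blast
  then have "e \<in> T" "c e \<noteq> 0" using supp[of e] by blast+
  then obtain k where "k \<in> {1..<n}" "c (f k) \<noteq> 0" unfolding T_def by blast
  then have ne: "{k \<in> {1..<n}. c (f k) \<noteq> 0} \<noteq> {}" by auto
  define k where "k = Max {k \<in> {1..<n}. c (f k) \<noteq> 0}"
  have k: "1 \<le> k" "k < n" "c (f k) \<noteq> 0" using Max_in[OF _ ne] by (auto simp: k_def)
  have later: "c (f j) = 0" if "k < j" "j < n" for j
  proof (rule ccontr)
    assume "c (f j) \<noteq> 0"
    then have "j \<le> k" unfolding k_def using that k by (intro Max_ge) auto
    then show False using that by simp
  qed
  have "x k \<in> V" using x_bij k by (auto simp: bij_betw_def)
  then have "0 = boundary E ori c (x k)" using c by (simp add: H1_real_def)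
  also have "\<dots> = boundary T ori c (x k)"
    using fin_E T_sub supp by (intro boundary_restrict) auto
  also have "\<dots> = (\<Sum>j\<in>{1..<n}. c (f j) * inc ori (f j) (x k))"
    unfolding boundary_inc T_def using f_inj by (simp add: sum.reindex)
  also have "\<dots> = (\<Sum>j\<in>{k}. c (f j) * inc ori (f j) (x k))"
  proof (rule sum.mono_neutral_right)
    show "\<forall>j\<in>{1..<n} - {k}. c (f j) * inc ori (f j) (x k) = 0"
    proof
      fix j assume "j \<in> {1..<n} - {k}"
      then show "c (f j) * inc ori (f j) (x k) = 0"
        using later[of j] inc_earlier[of j k] k by (cases "j < k") auto
    qed
  qed (use k in auto)
  finally show False using inc_own[OF k(1,2)] k by auto
qed

lemma tree_path:
  "k < n \<Longrightarrow> \<exists>p. (\<forall>e. p e \<in> \<int>) \<and> (\<forall>e. e \<notin> T \<longrightarrow> p e = 0) \<and>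
     (\<forall>v. boundary E ori p v = of_bool (v = x k) - of_bool (v = x 0))"
proof (induction k rule: less_induct)
  case (less k)
  show ?case
  proof (cases "k = 0")
    case True
    then show ?thesis by (intro exI[of _ "\<lambda>_. 0"]) simp
  next
    case False
    then have k: "1 \<le> k" "k < n" using less.prems by auto
    obtain j \<sigma> where j: "j < k" "\<sigma> = 1 \<or> \<sigma> = -1"
      "\<And>v. inc ori (f k) v = \<sigma> * (of_bool (v = x k) - of_bool (v = x j))"
      using tree_inc[OF k] by blast
    obtain p where p: "\<forall>e. p e \<in> \<int>" "\<forall>e. e \<notin> T \<longrightarrow> p e = 0"
      "\<forall>v. boundary E ori p v = of_bool (v = x j) - of_bool (v = x 0)"
      using less.IH[of j] j k by auto
    have fk: "f k \<in> E" "f k \<in> T" using tree[OF k] k by (auto simp: T_def)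
    let ?p = "\<lambda>e. \<sigma> * edge_chain (f k) e + p e"
    have \<sigma>: "\<sigma> * \<sigma> = 1" "\<sigma> \<in> \<int>" using j(2) by auto
    have "boundary E ori ?p v = of_bool (v = x k) - of_bool (v = x 0)" for v
      unfolding boundary_linear boundary_edge_chain[OF fin_E fk(1)] j(3) p(3)[rule_format]
      using \<sigma> by (simp flip: mult.assoc)
    moreover have "?p e \<in> \<int>" for e using p(1) \<sigma> by (auto simp: edge_chain_def)
    moreover have "?p e = 0" if "e \<notin> T" for e using p(2) that fk by (auto simp: edge_chain_def)
    ultimately show ?thesis by (intro exI[of _ ?p]) blast
  qed
qed

definition root_path :: "'a \<Rightarrow> 'a set \<Rightarrow> real" where
  "root_path v = (SOME p. (\<forall>e. p e \<in> \<int>) \<and> (\<forall>e. e \<notin> T \<longrightarrow> p e = 0) \<and>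
     (\<forall>u. boundary E ori p u = of_bool (u = v) - of_bool (u = x 0)))"

lemma root_path:
  assumes "v \<in> V"
  shows "root_path v e \<in> \<int>" "e \<notin> T \<Longrightarrow> root_path v e = 0"
    "boundary E ori (root_path v) u = of_bool (u = v) - of_bool (u = x 0)"
proof -
  obtain k where k: "k < n" "v = x k" using assms x_bij by (auto simp: bij_betw_def)
  have *: "(\<forall>e. root_path v e \<in> \<int>) \<and> (\<forall>e. e \<notin> T \<longrightarrow> root_path v e = 0) \<and>
     (\<forall>u. boundary E ori (root_path v) u = of_bool (u = v) - of_bool (u = x 0))"
    unfolding root_path_def k(2) by (rule someI_ex[OF tree_path[OF k(1)]])
  from * show "root_path v e \<in> \<int>" by blast
  from * show "e \<notin> T \<Longrightarrow> root_path v e = 0" by blast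
  from * show "boundary E ori (root_path v) u = of_bool (u = v) - of_bool (u = x 0)" by blast
qed

definition "b = card (E - T)"

definition chord :: "nat \<Rightarrow> 'a set" where "chord = (SOME chord. bij_betw chord {..<b} (E - T))"

lemma chord_bij: "bij_betw chord {..<b} (E - T)"
proof -
  have "finite (E - T)" using fin_E by simp
  then have "\<exists>chord. bij_betw chord {..<b} (E - T)"
    unfolding b_def using ex_bij_betw_nat_finite[of "E - T"] by (simp add: lessThan_atLeast0)
  then show ?thesis unfolding chord_def by (rule someI_ex)
qed

lemma chord: "i < b \<Longrightarrow> chord i \<in> E" "i < b \<Longrightarrow> chord i \<notin> T" "i < b \<Longrightarrow> j < b \<Longrightarrow> chord i = chord j \<longleftrightarrow> i = j"
  using chord_bij by (auto simp: bij_betw_def inj_on_def)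

lemma chord_surj: "e \<in> E \<Longrightarrow> e \<notin> T \<Longrightarrow> \<exists>i<b. e = chord i"
  using chord_bij by (auto simp: bij_betw_def)

text \<open>The fundamental cycle of a non-tree edge. These cycles form a basis of the integral homology, because a cycle
  is determined by its coefficients outside the tree.\<close>

definition fund_cycle :: "nat \<Rightarrow> 'a set \<Rightarrow> real" where
  "fund_cycle i = (\<lambda>e. edge_chain (chord i) e + (root_path (fst (ori (chord i))) e - root_path (snd (ori (chord i))) e))"

lemma ori_ends: "e \<in> E \<Longrightarrow> fst (ori e) \<in> V \<and> snd (ori e) \<in> V"
  using endpoints[of e] ends[of e] by blast

lemma fund_cycle_H1: assumes "i < b" shows "fund_cycle i \<in> H1_int V E ori"
proof -
  note V = ori_ends[OF chord(1)[OF assms]]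
  have "fund_cycle i e \<in> \<int>" for e
    unfolding fund_cycle_def using root_path(1) V by (auto simp: edge_chain_def)
  moreover have "fund_cycle i e = 0" if "e \<notin> E" for e
  proof -
    have "e \<notin> T" "e \<noteq> chord i" using that T_sub chord(1)[OF assms] by blast+
    then show ?thesis using V by (simp add: fund_cycle_def edge_chain_def root_path(2))
  qed
  moreover have "boundary E ori (fund_cycle i) v = 0" for v
    unfolding fund_cycle_def boundary_add boundary_diff boundary_edge_chain[OF fin_E chord(1)[OF assms]]
    using root_path(3) V by (auto simp: inc_def)
  ultimately show ?thesis by (auto simp: H1_int_iff H1_real_def chains_def)
qed

lemma fund_cycle_chord: assumes "i < b" "j < b" shows "fund_cycle i (chord j) = of_bool (i = j)"
  using ori_ends[OF chord(1)[OF assms(1)]] chord(2)[OF assms(2)] chord(3)[OF assms(2,1)]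
  by (simp add: fund_cycle_def edge_chain_def root_path(2) eq_commute[of j i])

lemma lincomb_fund_cycle: assumes "j < b" shows "lincomb b fund_cycle t (chord j) = t j"
proof -
  have "lincomb b fund_cycle t (chord j) = (\<Sum>i<b. if i = j then t i else 0)"
    unfolding lincomb_def using fund_cycle_chord assms by (intro sum.cong) auto
  then show ?thesis using assms by simp
qed

lemma cycle_expansion:
  assumes "c \<in> H1_real V E ori" shows "c = lincomb b fund_cycle (\<lambda>i. c (chord i))"
proof -
  let ?d = "\<lambda>e. - 1 * lincomb b fund_cycle (\<lambda>i. c (chord i)) e + c e"
  have "lincomb b fund_cycle (\<lambda>i. c (chord i)) \<in> H1_real V E ori"
    using fund_cycle_H1 H1_int_iff by (intro H1_real_lincomb) blast
  then have d: "?d \<in> H1_real V E ori" using assms by (intro H1_real_linear)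
  have "?d e = 0" if eT: "e \<notin> T" for e
  proof (cases "e \<in> E")
    case True
    then obtain j where "j < b" "e = chord j" using eT chord_surj by blast
    then show ?thesis using lincomb_fund_cycle by simp
  next
    case False
    then show ?thesis using d by (simp add: H1_real_def chains_def)
  qed
  then have d0: "?d = (\<lambda>_. 0)" by (rule tree_acyclic[OF d])
  show ?thesis
  proof
    fix e
    show "c e = lincomb b fund_cycle (\<lambda>i. c (chord i)) e" using fun_cong[OF d0, of e] by linarith
  qed
qed

lemma H1_real_eq: "H1_real V E ori = range (lincomb b fund_cycle)"
proof (intro equalityI subsetI)
  fix c assume "c \<in> H1_real V E ori"
  then show "c \<in> range (lincomb b fund_cycle)" by (subst cycle_expansion) auto
next
  fix c assume "c \<in> range (lincomb b fund_cycle)"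
  then obtain t where c: "c = lincomb b fund_cycle t" by (rule rangeE)
  show "c \<in> H1_real V E ori" unfolding c
    using fund_cycle_H1 H1_int_iff by (intro H1_real_lincomb) blast
qed

lemma H1_int_eq: "H1_int V E ori = int_comb b fund_cycle"
proof (intro equalityI subsetI)
  fix c assume c: "c \<in> H1_int V E ori"
  then have "c = lincomb b fund_cycle (\<lambda>i. c (chord i))" using H1_int_iff cycle_expansion by blast
  then show "c \<in> int_comb b fund_cycle" using c unfolding int_comb_def H1_int_iff by blast
next
  fix c assume "c \<in> int_comb b fund_cycle"
  then obtain t where c: "c = lincomb b fund_cycle t" "\<forall>i<b. t i \<in> \<int>" unfolding int_comb_def by blast
  show "c \<in> H1_int V E ori" unfolding c(1) using c(2) fund_cycle_H1 by (intro H1_int_lincomb) auto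
qed

lemma betti1_eq: "betti1 V E = int b"
proof -
  have "card V = n" using bij_betw_same_card[OF x_bij] by simp
  moreover have "b = card E - (n - 1)" unfolding b_def using T_sub fin_E card_T
    by (simp add: card_Diff_subset finite_subset)
  moreover have "n - 1 \<le> card E" using card_mono[OF fin_E T_sub] card_T by simp
  ultimately show ?thesis using n_pos by (simp add: betti1_def)
qed

end

text \<open>The tree grows along an edge leaving the set of vertices reached so far; connectedness provides one.\<close>

lemma graph_ordered_tree:
  assumes G: "graph V E" and ori: "orientation E ori"
  obtains x f where "ordered_tree V E ori (card V) x f"
proof -
  have fV: "finite V" "V \<noteq> {}" and ends: "\<And>e. e \<in> E \<Longrightarrow> e \<subseteq> V \<and> card e = 2"
    and conn: "\<And>u v. u \<in> V \<Longrightarrow> v \<in> V \<Longrightarrow> (u, v) \<in> {(x, y). {x, y} \<in> E}\<^sup>*"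
    using G by (auto simp: graph_def)
  have fE: "finite E"
    using ends fV by (intro finite_subset[of E "Pow V"]) auto
  have n1: "card V \<ge> 1" using fV by (simp add: Suc_leI card_gt_0_iff)
  have grow: "\<exists>x f. inj_on x {..<m} \<and> x ` {..<m} \<subseteq> V \<and>
      (\<forall>k. 1 \<le> k \<and> k < m \<longrightarrow> f k \<in> E \<and> (\<exists>j<k. f k = {x k, x j}))"
    if "1 \<le> m" "m \<le> card V" for m
    using that
  proof (induction m rule: dec_induct)
    case base
    obtain r where "r \<in> V" using fV by blast
    then show ?case by (intro exI[of _ "\<lambda>_. r"]) (auto simp: lessThan_Suc)
  next
    case (step m)
    have "m \<le> card V" using step by simp
    then obtain x f where xf: "inj_on x {..<m}" "x ` {..<m} \<subseteq> V"
      "\<And>k. 1 \<le> k \<Longrightarrow> k < m \<Longrightarrow> f k \<in> E \<and> (\<exists>j<k. f k = {x k, x j})"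
      using step.IH by blast
    let ?S = "x ` {..<m}"
    have "card ?S < card V" using card_image[OF xf(1)] step by simp
    then obtain y where y: "y \<in> V" "y \<notin> ?S"
      using xf(2) by (metis less_irrefl subsetI subset_antisym)
    have "x 0 \<in> ?S" using step by auto
    have "\<exists>a b. a \<in> ?S \<and> b \<notin> ?S \<and> {a, b} \<in> E"
    proof (rule ccontr)
      assume no: "\<nexists>a b. a \<in> ?S \<and> b \<notin> ?S \<and> {a, b} \<in> E"
      have "(x 0, y) \<in> {(x, y). {x, y} \<in> E}\<^sup>*" using conn \<open>x 0 \<in> ?S\<close> xf(2) y by blast
      then have "y \<in> ?S"
        by (induction rule: rtrancl_induct) (use \<open>x 0 \<in> ?S\<close> no in blast)+
      then show False using y by simp
    qed
    then obtain a b where ab: "a \<in> ?S" "b \<notin> ?S" "{a, b} \<in> E" by blast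
    then obtain j where j: "j < m" "a = x j" by auto
    let ?x = "x(m := b)" and ?f = "f(m := {a, b})"
    have "inj_on ?x {..<Suc m}" using xf(1) ab by (auto simp: inj_on_def less_Suc_eq)
    moreover have "?x ` {..<Suc m} \<subseteq> V" using xf(2) ends[OF ab(3)] by (auto simp: less_Suc_eq)
    moreover have "?f k \<in> E \<and> (\<exists>j<k. ?f k = {?x k, ?x j})" if k: "1 \<le> k" "k < Suc m" for k
    proof (cases "k = m")
      case True
      then show ?thesis using ab j by (auto intro!: exI[of _ j])
    next
      case False
      then have "k < m" using k by simp
      then obtain i where "i < k" "f k = {x k, x i}" "f k \<in> E" using xf(3)[OF k(1)] by blast
      then show ?thesis using \<open>k < m\<close> by (auto intro!: exI[of _ i])
    qed
    ultimately show ?case by blast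
  qed
  obtain x f where xf: "inj_on x {..<card V}" "x ` {..<card V} \<subseteq> V"
      "\<And>k. 1 \<le> k \<Longrightarrow> k < card V \<Longrightarrow> f k \<in> E \<and> (\<exists>j<k. f k = {x k, x j})"
    using grow[OF n1 order_refl] by blast
  have "x ` {..<card V} = V"
    using card_subset_eq[OF fV(1) xf(2)] card_image[OF xf(1)] by simp
  then have "ordered_tree V E ori (card V) x f"
    using fE ends ori n1 xf by (unfold_locales) (auto simp: bij_betw_def)
  then show ?thesis by (rule that)
qed

section \<open>Degrees bound the determinant of the cycle lattice\<close>

lemma boundary_lincomb: "boundary E ori (lincomb n y t) v = (\<Sum>i<n. t i * boundary E ori (y i) v)"
  by (induction n) (simp_all add: lincomb_Suc boundary_linear)

definition int_chains :: "'a set set \<Rightarrow> ('a set \<Rightarrow> real) set" where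
  "int_chains E = {c \<in> chains E. \<forall>e. c e \<in> \<int>}"

lemma lattice_det_int_chains:
  assumes "finite E"
  shows "lattice_det (card E) (chains E) (weight_form E (\<lambda>_. 1)) (int_chains E) = 1"
proof -
  interpret symmetric_form "weight_form E (\<lambda>_. 1)" by (rule symmetric_form_weight_form)
  let ?m = "card E"
  obtain g where g: "bij_betw g {..<?m} E"
    using ex_bij_betw_nat_finite[OF assms] by (auto simp: lessThan_atLeast0)
  then have gE: "g i \<in> E" if "i < ?m" for i using that by (auto simp: bij_betw_def)
  have ginj: "g i = g j \<longleftrightarrow> i = j" if "i < ?m" "j < ?m" for i j
    using that g by (auto simp: bij_betw_def inj_on_def)
  define s where "s i = edge_chain (g i)" for i
  define a where "a = (\<lambda>i j :: nat. of_bool (i = j) :: real)"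
  have val: "lincomb ?m s t (g j) = t j" if "j < ?m" for t j
  proof -
    have "lincomb ?m s t (g j) = (\<Sum>i<?m. if i = j then t i else 0)"
      unfolding lincomb_def s_def edge_chain_def using ginj that by (intro sum.cong) auto
    then show ?thesis using that by simp
  qed
  have out: "lincomb ?m s t e = 0" if "e \<notin> E" for t e
    unfolding lincomb_def
  proof (rule sum.neutral, rule ballI)
    fix i assume "i \<in> {..<?m}"
    then have "e \<noteq> g i" using gE[of i] that by (metis lessThan_iff)
    then show "t i * s i e = 0" by (simp add: s_def edge_chain_def)
  qed
  have expand: "c = lincomb ?m s (\<lambda>i. c (g i))" if "c \<in> chains E" for c
  proof
    fix e
    show "c e = lincomb ?m s (\<lambda>i. c (g i)) e"
    proof (cases "e \<in> E")
      case True
      then have "e \<in> g ` {..<?m}" using bij_betw_imp_surj_on[OF g] by simp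
      then obtain j where "j < ?m" "e = g j" by blast
      then show ?thesis using val by simp
    next
      case False
      then show ?thesis using that out by (simp add: chains_def)
    qed
  qed
  have rng: "range (lincomb ?m s) = chains E"
  proof (intro equalityI subsetI)
    fix c assume "c \<in> range (lincomb ?m s)"
    then show "c \<in> chains E" using out unfolding chains_def by blast
  next
    fix c assume "c \<in> chains E"
    then show "c \<in> range (lincomb ?m s)" by (subst expand) auto
  qed
  have int: "int_comb ?m s = int_chains E"
  proof (intro equalityI subsetI)
    fix c assume "c \<in> int_comb ?m s"
    then obtain t where c: "c = lincomb ?m s t" "\<forall>i<?m. t i \<in> \<int>" unfolding int_comb_def by blast
    have "lincomb ?m s t e \<in> \<int>" for e
      unfolding lincomb_def using c(2) by (intro Ints_sum Ints_mult) (auto simp: s_def edge_chain_def)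
    then show "c \<in> int_chains E" unfolding c(1) using rng by (auto simp: int_chains_def)
  next
    fix c assume c: "c \<in> int_chains E"
    then have "c = lincomb ?m s (\<lambda>i. c (g i))" by (intro expand) (simp add: int_chains_def)
    then show "c \<in> int_comb ?m s" using c unfolding int_comb_def int_chains_def by blast
  qed
  have "gram_schmidt ?m s s a"
    unfolding gram_schmidt_def
  proof (intro conjI allI impI)
    show "orthonormal ?m s"
      unfolding orthonormal_def weight_form_def s_def edge_chain_def
    proof (intro allI impI)
      fix i j assume ij: "i < ?m" "j < ?m"
      have "(\<Sum>e\<in>E. 1 * of_bool (e = g i) * of_bool (e = g j) :: real) = (\<Sum>e\<in>E. if e = g i then of_bool (i = j) else 0)"
        using ginj[OF ij] by (intro sum.cong) auto
      also have "\<dots> = of_bool (i = j)" using gE[OF ij(1)] assms by simp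
      finally show "(\<Sum>e\<in>E. 1 * of_bool (e = g i) * of_bool (e = g j)) = (if i = j then 1 else 0 :: real)"
        by (simp add: of_bool_def)
    qed
    fix i assume "i < ?m"
    show "0 < a i i" by (simp add: a_def)
    show "s i = lincomb (Suc i) s (a i)" by (auto simp: lincomb_def a_def)
    show "\<exists>t. (\<lambda>e. a i i * s i e) = (\<lambda>e. s i e + lincomb i s t e)"
      by (rule exI[of _ "\<lambda>_. 0"]) (simp add: a_def)
  qed
  from lattice_det_gram_schmidt[OF this] show ?thesis by (simp add: rng int a_def)
qed

context ordered_tree
begin

text \<open>A basis of the lattice of all integral chains that starts with a basis of the cycles.\<close>

definition chain_basis :: "nat \<Rightarrow> 'a set \<Rightarrow> real" where
  "chain_basis i = (if i < b then fund_cycle i else edge_chain (f (i - b + 1)))"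

lemma lincomb_chain_basis: "i \<le> b \<Longrightarrow> lincomb i chain_basis t = lincomb i fund_cycle t"
  by (rule lincomb_cong) (auto simp: chain_basis_def)

text \<open>Cauchy-Schwarz against the star of the vertex \<open>v\<close>, the cochain whose value on \<open>c\<close> is the coefficient of
  \<open>v\<close> in the boundary and whose squared length is the degree of \<open>v\<close>.\<close>

lemma star_bound:
  assumes "\<bar>boundary E ori c v\<bar> = 1"
  shows "1 \<le> weight_form E (\<lambda>_. 1) c c * real (card {e \<in> E. v \<in> e})"
proof -
  have "1 = (boundary E ori c v)\<^sup>2" using assms by (simp add: power2_eq_1_iff abs_if split: if_splits)
  also have "\<dots> \<le> (\<Sum>e\<in>E. (c e)\<^sup>2) * (\<Sum>e\<in>E. (inc ori e v)\<^sup>2)"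
    unfolding boundary_inc by (rule Cauchy_Schwarz_ineq_sum)
  also have "(\<Sum>e\<in>E. (inc ori e v)\<^sup>2) = (\<Sum>e\<in>E. of_bool (v \<in> e))"
  proof (rule sum.cong[OF refl])
    fix e assume "e \<in> E"
    then show "(inc ori e v)\<^sup>2 = of_bool (v \<in> e)"
      using inc_abs[of e v] inc_endpoints[of e v] by (cases "v \<in> e") auto
  qed
  also have "\<dots> = real (card {e \<in> E. v \<in> e})"
    using fin_E by (simp add: of_bool_def sum.If_cases Int_def)
  finally show ?thesis by (simp add: weight_form_def power2_eq_square)
qed

text \<open>Cycles and earlier tree edges have boundary zero at the vertex that the next tree edge adds.\<close>

lemma boundary_chain_basis:
  assumes "l < n - 1"
  shows "\<bar>boundary E ori (coset_vec chain_basis (b + l) t) (x (l + 1))\<bar> = 1"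
proof -
  have l: "1 \<le> l + 1" "l + 1 < n" using assms by auto
  have xV: "x (l + 1) \<in> V" using x_bij l by (auto simp: bij_betw_def)
  have fE: "f k \<in> E" if "1 \<le> k" "k < n" for k using tree[OF that] by blast
  have "boundary E ori (chain_basis i) (x (l + 1)) = 0" if "i < b + l" for i
  proof (cases "i < b")
    case True
    then show ?thesis using fund_cycle_H1[OF True] xV by (simp add: chain_basis_def H1_int_def H1_real_def)
  next
    case False
    then have k: "1 \<le> i - b + 1" "i - b + 1 < l + 1" using that by auto
    then show ?thesis using False l inc_earlier[OF k l(2)]
      by (simp add: chain_basis_def boundary_edge_chain[OF fin_E fE])
  qed
  then have "boundary E ori (lincomb (b + l) chain_basis t) (x (l + 1)) = 0"
    unfolding boundary_lincomb by (intro sum.neutral) auto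
  moreover have "boundary E ori (chain_basis (b + l)) (x (l + 1)) = inc ori (f (l + 1)) (x (l + 1))"
    using boundary_edge_chain[OF fin_E fE[OF l]] by (simp add: chain_basis_def)
  ultimately show ?thesis using inc_own[OF l] by (auto simp: boundary_add)
qed

lemma card_E: "card E = b + (n - 1)"
proof -
  have "card (E - T) = card E - card T"
    using T_sub fin_E by (simp add: card_Diff_subset finite_subset)
  moreover have "card T \<le> card E" by (rule card_mono[OF fin_E T_sub])
  ultimately show ?thesis by (simp add: b_def card_T)
qed

lemma chain_expansion:
  assumes c: "c \<in> chains E"
  shows "c = lincomb (b + (n - 1)) chain_basis
    (\<lambda>i. if i < b then c (chord i) else c (f (i - b + 1)) - lincomb b fund_cycle (\<lambda>i. c (chord i)) (f (i - b + 1)))"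
    (is "c = lincomb _ chain_basis ?t")
proof
  fix e
  let ?d = "\<lambda>e. c e - lincomb b fund_cycle (\<lambda>i. c (chord i)) e"
  have zsupp: "lincomb b fund_cycle (\<lambda>i. c (chord i)) e = 0" if "e \<notin> E"
  proof -
    have "fund_cycle i e = 0" if "i < b" for i
      using fund_cycle_H1[OF that] \<open>e \<notin> E\<close> by (simp add: H1_int_def H1_real_def chains_def)
    then show ?thesis by (simp add: lincomb_def)
  qed
  have "lincomb (b + (n - 1)) chain_basis ?t e = (\<Sum>i<b. c (chord i) * fund_cycle i e) + (\<Sum>l<n - 1. ?d (f (l + 1)) * edge_chain (f (l + 1)) e)"
    unfolding lincomb_def sum_lessThan_add by (simp add: chain_basis_def lincomb_def)
  also have "(\<Sum>i<b. c (chord i) * fund_cycle i e) = lincomb b fund_cycle (\<lambda>i. c (chord i)) e" by (simp add: lincomb_def)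
  also have "(\<Sum>l<n - 1. ?d (f (l + 1)) * edge_chain (f (l + 1)) e) = ?d e"
  proof (cases "e \<in> T")
    case True
    then obtain k where k: "1 \<le> k" "k < n" "e = f k" by (auto simp: T_def)
    have "(\<Sum>l<n - 1. ?d (f (l + 1)) * edge_chain (f (l + 1)) e) = (\<Sum>l<n - 1. if l = k - 1 then ?d e else 0)"
    proof (rule sum.cong[OF refl])
      fix l assume l: "l \<in> {..<n - 1}"
      have "f k = f (l + 1) \<longleftrightarrow> l = k - 1"
        using inj_on_eq_iff[OF f_inj, of k "l + 1"] l k by auto
      then show "?d (f (l + 1)) * edge_chain (f (l + 1)) e = (if l = k - 1 then ?d e else 0)"
        using k by (auto simp: edge_chain_def)
    qed
    also have "\<dots> = ?d e" using k by auto
    finally show ?thesis .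
  next
    case False
    have "?d e = 0"
    proof (cases "e \<in> E")
      case True
      then obtain j where "j < b" "e = chord j" using False chord_surj by blast
      then show ?thesis using lincomb_fund_cycle by simp
    next
      case False
      then show ?thesis using c zsupp by (simp add: chains_def)
    qed
    moreover have "(\<Sum>l<n - 1. ?d (f (l + 1)) * edge_chain (f (l + 1)) e) = 0"
    proof (rule sum.neutral, rule ballI)
      fix l assume "l \<in> {..<n - 1}"
      then have "f (l + 1) \<in> T" by (auto simp: T_def)
      then have "e \<noteq> f (l + 1)" using False by metis
      then show "?d (f (l + 1)) * edge_chain (f (l + 1)) e = 0" by (simp add: edge_chain_def)
    qed
    ultimately show ?thesis by simp
  qed
  finally show "c e = lincomb (b + (n - 1)) chain_basis ?t e" by simp
qed

lemma chain_basis_int: assumes "i < b + (n - 1)" shows "chain_basis i \<in> int_chains E"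
proof (cases "i < b")
  case True
  then show ?thesis using fund_cycle_H1[OF True]
    by (auto simp: chain_basis_def int_chains_def H1_int_iff H1_real_def)
next
  case False
  then have "1 \<le> i - b + 1" "i - b + 1 < n" using assms by auto
  then have "f (i - b + 1) \<in> E" using tree by blast
  then have "edge_chain (f (i - b + 1)) e = 0" if "e \<notin> E" for e using that by (metis edge_chain_def of_bool_eq(1))
  then show ?thesis using False by (simp add: chain_basis_def int_chains_def chains_def) (simp add: edge_chain_def)
qed

lemma range_chain_basis: "range (lincomb (b + (n - 1)) chain_basis) = chains E"
proof (intro equalityI subsetI)
  fix c assume "c \<in> range (lincomb (b + (n - 1)) chain_basis)"
  then obtain t where c: "c = lincomb (b + (n - 1)) chain_basis t" by (rule rangeE)
  show "c \<in> chains E" unfolding c chains_def lincomb_def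
    using chain_basis_int by (simp add: int_chains_def chains_def)
next
  fix c assume "c \<in> chains E"
  then show "c \<in> range (lincomb (b + (n - 1)) chain_basis)" by (subst chain_expansion) auto
qed

lemma int_comb_chain_basis: "int_comb (b + (n - 1)) chain_basis = int_chains E"
proof (intro equalityI subsetI)
  fix c assume "c \<in> int_comb (b + (n - 1)) chain_basis"
  then obtain t where c: "c = lincomb (b + (n - 1)) chain_basis t" "\<forall>i<b + (n - 1). t i \<in> \<int>"
    unfolding int_comb_def by blast
  have "c \<in> chains E" using c(1) range_chain_basis by blast
  moreover have "lincomb (b + (n - 1)) chain_basis t e \<in> \<int>" for e
    unfolding lincomb_def using c(2) chain_basis_int by (intro Ints_sum Ints_mult) (auto simp: int_chains_def)
  ultimately show "c \<in> int_chains E" unfolding int_chains_def c(1) by blast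
next
  fix c assume c: "c \<in> int_chains E"
  let ?t = "\<lambda>i. if i < b then c (chord i) else c (f (i - b + 1)) - lincomb b fund_cycle (\<lambda>i. c (chord i)) (f (i - b + 1))"
  have "c = lincomb (b + (n - 1)) chain_basis ?t"
    using c by (intro chain_expansion) (simp add: int_chains_def)
  moreover have "lincomb b fund_cycle (\<lambda>i. c (chord i)) e \<in> \<int>" for e
    unfolding lincomb_def using c fund_cycle_H1 by (intro Ints_sum Ints_mult) (auto simp: int_chains_def H1_int_iff)
  then have "\<forall>i<b + (n - 1). ?t i \<in> \<int>" using c by (auto simp: int_chains_def)
  ultimately show "c \<in> int_comb (b + (n - 1)) chain_basis" unfolding int_comb_def by blast
qed

text \<open>The lattice of all integral chains has determinant 1. In the basis of fundamental cycles followed by tree edges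
  this determinant is the one of the cycle lattice times the squared Gram-Schmidt lengths of the tree edges, each
  of which is at least \<open>1 / D\<close>.\<close>

lemma lattice_det_le_degree:
  assumes valence: "\<And>v. v \<in> V \<Longrightarrow> card {e \<in> E. v \<in> e} \<le> D" and D: "D \<ge> 1"
  shows "lattice_det b (H1_real V E ori) (weight_form E (\<lambda>_. 1)) (H1_int V E ori) \<le> real D ^ (n - 1)"
    and "0 < lattice_det b (H1_real V E ori) (weight_form E (\<lambda>_. 1)) (H1_int V E ori)"
proof -
  let ?B = "weight_form E (\<lambda>_. 1)"
  interpret symmetric_form ?B by (rule symmetric_form_weight_form)
  have tree_bound: "1 / real D \<le> ?B (coset_vec chain_basis (b + l) t) (coset_vec chain_basis (b + l) t)"
    if l: "l < n - 1" for l t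
  proof -
    let ?c = "\<lambda>e. chain_basis (b + l) e + lincomb (b + l) chain_basis t e"
    have xV: "x (l + 1) \<in> V" using x_bij l by (auto simp: bij_betw_def)
    have nonneg: "0 \<le> ?B ?c ?c" by (simp add: weight_form_def sum_nonneg)
    have "1 \<le> ?B ?c ?c * real (card {e \<in> E. x (l + 1) \<in> e})"
      by (rule star_bound[OF boundary_chain_basis[OF l]])
    also have "\<dots> \<le> ?B ?c ?c * real D" using valence[OF xV] nonneg by (intro mult_left_mono) auto
    finally show ?thesis using D by (simp add: field_simps)
  qed
  have pos: "0 < ?B (coset_vec chain_basis i t) (coset_vec chain_basis i t)"
    if i: "i < b + (n - 1)" for i t
  proof (cases "i < b")
    case True
    let ?c = "\<lambda>e. chain_basis i e + lincomb i chain_basis t e"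
    have "lincomb i fund_cycle t (chord i) = 0"
      unfolding lincomb_def using True fund_cycle_chord by (intro sum.neutral) auto
    then have "?c (chord i) = 1" using True fund_cycle_chord[of i i] lincomb_chain_basis[of i t] by (simp add: chain_basis_def)
    then have "0 < ?c (chord i) * ?c (chord i)" by simp
    also have "\<dots> \<le> (\<Sum>e\<in>E. ?c e * ?c e)"
      by (rule member_le_sum) (use fin_E chord(1)[OF True] in auto)
    finally show ?thesis by (simp add: weight_form_def)
  next
    case False
    then have l: "i = b + (i - b)" "i - b < n - 1" using i by auto
    have "0 < 1 / real D" using D by simp
    also have "\<dots> \<le> ?B (coset_vec chain_basis i t) (coset_vec chain_basis i t)"
      using tree_bound[OF l(2), of t] by (simp flip: l(1))
    finally show ?thesis .
  qed
  obtain u a where gs: "gram_schmidt (b + (n - 1)) chain_basis u a"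
    using gram_schmidt_exists[of "b + (n - 1)" chain_basis] pos by blast
  have gsb: "gram_schmidt b chain_basis u a" using gram_schmidt_mono[OF gs] by simp
  have apos: "0 < a i i" if "i < b + (n - 1)" for i using gs that by (simp add: gram_schmidt_def)
  have zy: "lincomb b chain_basis = lincomb b fund_cycle" using lincomb_chain_basis by blast
  have "lattice_det b (range (lincomb b chain_basis)) ?B (int_comb b chain_basis) = (\<Prod>i<b. (a i i)\<^sup>2)"
    by (rule lattice_det_gram_schmidt[OF gsb])
  then have det: "lattice_det b (H1_real V E ori) ?B (H1_int V E ori) = (\<Prod>i<b. (a i i)\<^sup>2)"
    unfolding H1_real_eq H1_int_eq int_comb_def zy .
  show pos': "0 < lattice_det b (H1_real V E ori) ?B (H1_int V E ori)"
    unfolding det by (intro prod_pos ballI zero_less_power apos) simp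
  have "1 = (\<Prod>i<b + (n - 1). (a i i)\<^sup>2)"
    using lattice_det_gram_schmidt[OF gs] lattice_det_int_chains[OF fin_E]
    unfolding range_chain_basis int_comb_chain_basis card_E by simp
  also have "\<dots> = lattice_det b (H1_real V E ori) ?B (H1_int V E ori) * (\<Prod>l<n - 1. (a (b + l) (b + l))\<^sup>2)"
    unfolding det by (rule prod_lessThan_add)
  also have "\<dots> \<ge> lattice_det b (H1_real V E ori) ?B (H1_int V E ori) * (\<Prod>l<n - 1. 1 / real D)"
  proof (intro mult_left_mono prod_mono conjI)
    fix l assume "l \<in> {..<n - 1}"
    then have l: "l < n - 1" "b + l < b + (n - 1)" by auto
    obtain t where "(a (b + l) (b + l))\<^sup>2 = ?B (coset_vec chain_basis (b + l) t) (coset_vec chain_basis (b + l) t)"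
      using gram_schmidt_coset_attained[OF gs l(2)] by blast
    then show "1 / real D \<le> (a (b + l) (b + l))\<^sup>2" using tree_bound[OF l(1), of t] by simp
  qed (use pos' in auto)
  finally show "lattice_det b (H1_real V E ori) ?B (H1_int V E ori) \<le> real D ^ (n - 1)"
    using D by (simp add: field_simps power_divide)
qed

end

section \<open>Multigraphs and short cycles\<close>

text \<open>From here on up to the bound for the Hermite invariant, edges are mere labels and \<open>ori\<close> is an arbitrary map
  to pairs of vertices. Loops and multiple edges, which arise when a vertex of valence two is smoothed, are thus
  covered by the same notions of chain and cycle.\<close>

definition endpoints_in :: "'a set \<Rightarrow> 'a set set \<Rightarrow> ('a set \<Rightarrow> 'a \<times> 'a) \<Rightarrow> bool" where
  "endpoints_in V E ori \<longleftrightarrow> finite V \<and> finite E \<and> (\<forall>e\<in>E. fst (ori e) \<in> V \<and> snd (ori e) \<in> V)"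

lemma sum_boundary:
  assumes "finite S"
  shows "(\<Sum>v\<in>S. boundary E ori c v) = (\<Sum>e\<in>E. c e * (of_bool (snd (ori e) \<in> S) - of_bool (fst (ori e) \<in> S)))"
proof -
  have *: "(\<Sum>v\<in>S. of_bool (a = v) :: real) = of_bool (a \<in> S)" for a
    using assms by (simp add: of_bool_def)
  have "(\<Sum>v\<in>S. boundary E ori c v) = (\<Sum>e\<in>E. \<Sum>v\<in>S. c e * inc ori e v)"
    unfolding boundary_inc by (rule sum.swap)
  also have "\<dots> = (\<Sum>e\<in>E. c e * (\<Sum>v\<in>S. inc ori e v))"
    by (simp add: sum_distrib_left)
  finally show ?thesis by (simp only: inc_def sum_subtractf *)
qed

lemma H1_real_mono:
  assumes "finite E" "E' \<subseteq> E" "c \<in> H1_real V E' ori" shows "c \<in> H1_real V E ori"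
proof -
  have z: "c e = 0" if "e \<notin> E'" for e using assms(3) that by (simp add: H1_real_def chains_def)
  have "boundary E ori c v = boundary E' ori c v" for v
    using assms(1,2) z by (intro boundary_restrict) blast+
  then have "boundary E ori c v = 0" if "v \<in> V" for v
    using assms(3) that by (simp add: H1_real_def)
  moreover have "c e = 0" if "e \<notin> E" for e using z assms(2) that by blast
  ultimately show ?thesis unfolding H1_real_def chains_def by blast
qed

lemma H1_real_remove:
  assumes "finite E" "c \<in> H1_real V E ori" "c e = 0" shows "c \<in> H1_real V (E - {e}) ori"
proof -
  have z: "c e' = 0" if "e' \<notin> E - {e}" for e'
    using assms(2,3) that by (cases "e' = e") (simp_all add: H1_real_def chains_def)
  have "boundary E ori c v = boundary (E - {e}) ori c v" for v
    using assms(1) z by (intro boundary_restrict) blast+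
  then have "boundary (E - {e}) ori c v = 0" if "v \<in> V" for v
    using assms(2) that by (simp add: H1_real_def)
  then show ?thesis using z unfolding H1_real_def chains_def by blast
qed

lemma weight_form_remove:
  assumes "finite E" "c e = 0" shows "weight_form (E - {e}) w c c = weight_form E w c c"
  unfolding weight_form_def using assms by (intro sum.mono_neutral_left) auto

lemma H1_intI:
  assumes "\<And>e. c e \<in> \<int>" "\<And>e. e \<notin> E \<Longrightarrow> c e = 0" "\<And>v. boundary E ori c v = 0"
  shows "c \<in> H1_int V E ori"
  using assms by (simp add: H1_int_iff H1_real_def chains_def)

text \<open>Let \<open>S\<close> be the set of vertices reached from the initial vertex of \<open>e\<close> without using \<open>e\<close>. Either it contains
  the terminal vertex and a path closes up to a cycle, or \<open>e\<close> is the only edge leaving \<open>S\<close> and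
  the flow of a cycle out of \<open>S\<close>, which is zero, is its coefficient at \<open>e\<close>.\<close>

lemma cycle_through_or_bridge:
  assumes fin: "endpoints_in V E ori" and e: "e \<in> E"
  shows "(\<exists>z\<in>H1_int V E ori. z e = 1) \<or> (\<forall>c\<in>H1_real V E ori. c e = 0)"
proof -
  have fE: "finite E" and fV: "finite V" and ends: "\<And>e. e \<in> E \<Longrightarrow> fst (ori e) \<in> V \<and> snd (ori e) \<in> V"
    using fin by (auto simp: endpoints_in_def)
  define r where "r = fst (ori e)"
  define path where "path v p \<longleftrightarrow> (\<forall>e'. p e' \<in> \<int>) \<and> (\<forall>e'. e' \<notin> E - {e} \<longrightarrow> p e' = 0) \<and>
    (\<forall>u. boundary E ori p u = of_bool (u = v) - of_bool (u = r))" for v p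
  define S where "S = {v \<in> V. \<exists>p. path v p}"
  have path_r: "path r (\<lambda>_. 0)" by (simp add: path_def)
  then have rS: "r \<in> S" using ends[OF e] by (auto simp: S_def r_def)
  have ext: "path v' (\<lambda>e''. \<sigma> * edge_chain e' e'' + p e'')"
    if "path v p" "e' \<in> E" "e' \<noteq> e" "\<sigma> = 1 \<or> \<sigma> = -1"
      "\<And>u. \<sigma> * inc ori e' u = of_bool (u = v') - of_bool (u = v)" for v v' p e' \<sigma>
    unfolding path_def
  proof (intro conjI allI impI)
    fix e'' show "\<sigma> * edge_chain e' e'' + p e'' \<in> \<int>"
      using that(1,4) by (auto simp: path_def edge_chain_def)
    show "\<sigma> * edge_chain e' e'' + p e'' = 0" if "e'' \<notin> E - {e}"
    proof -
      have "e'' \<noteq> e'" using that \<open>e' \<in> E\<close> \<open>e' \<noteq> e\<close> by blast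
      then show ?thesis using that \<open>path v p\<close> by (simp add: path_def edge_chain_def)
    qed
  next
    fix u show "boundary E ori (\<lambda>e''. \<sigma> * edge_chain e' e'' + p e'') u = of_bool (u = v') - of_bool (u = r)"
      unfolding boundary_linear boundary_edge_chain[OF fE that(2)] that(5) using that(1) by (simp add: path_def)
  qed
  have closed: "fst (ori e') \<in> S \<longleftrightarrow> snd (ori e') \<in> S" if e': "e' \<in> E" "e' \<noteq> e" for e'
  proof
    assume "fst (ori e') \<in> S"
    then obtain p where "path (fst (ori e')) p" by (auto simp: S_def)
    then have "path (snd (ori e')) (\<lambda>e''. 1 * edge_chain e' e'' + p e'')"
      using e' by (intro ext) (auto simp: inc_def)
    then show "snd (ori e') \<in> S" using ends[OF e'(1)] unfolding S_def by blast
  next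
    assume "snd (ori e') \<in> S"
    then obtain p where "path (snd (ori e')) p" by (auto simp: S_def)
    then have "path (fst (ori e')) (\<lambda>e''. - 1 * edge_chain e' e'' + p e'')"
      using e' by (intro ext) (auto simp: inc_def)
    then show "fst (ori e') \<in> S" using ends[OF e'(1)] unfolding S_def by blast
  qed
  show ?thesis
  proof (cases "snd (ori e) \<in> S")
    case True
    then obtain p where p: "path (snd (ori e)) p" by (auto simp: S_def)
    let ?z = "\<lambda>e'. edge_chain e e' - p e'"
    have pe: "p e = 0" using p by (simp add: path_def)
    have "boundary E ori ?z u = 0" for u
      unfolding boundary_diff boundary_edge_chain[OF fE e] using p by (auto simp: path_def inc_def r_def)
    moreover have "?z e' \<in> \<int>" for e' using p by (simp add: path_def edge_chain_def)
    moreover have "?z e' = 0" if "e' \<notin> E" for e'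
    proof -
      have "e' \<noteq> e" using that e by blast
      then show ?thesis using p that by (simp add: path_def edge_chain_def)
    qed
    ultimately have "?z \<in> H1_int V E ori" by (intro H1_intI)
    moreover have "?z e = 1" using pe by (simp add: edge_chain_def)
    ultimately show ?thesis by (intro disjI1 bexI[of _ ?z])
  next
    case False
    have "c e = 0" if c: "c \<in> H1_real V E ori" for c
    proof -
      have "finite S" "S \<subseteq> V" using fV by (auto simp: S_def)
      have "0 = (\<Sum>v\<in>S. boundary E ori c v)"
        using c \<open>S \<subseteq> V\<close> by (intro sum.neutral[symmetric]) (auto simp: H1_real_def)
      also have "\<dots> = (\<Sum>e'\<in>E. c e' * (of_bool (snd (ori e') \<in> S) - of_bool (fst (ori e') \<in> S)))"
        by (rule sum_boundary) fact
      also have "\<dots> = (\<Sum>e'\<in>E. if e' = e then - c e else 0)"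
        using closed False rS by (intro sum.cong) (auto simp: r_def)
      finally show ?thesis using fE e by simp
    qed
    then show ?thesis by blast
  qed
qed

definition valence :: "'a set set \<Rightarrow> ('a set \<Rightarrow> 'a \<times> 'a) \<Rightarrow> 'a \<Rightarrow> nat" where
  "valence E ori v = (\<Sum>e\<in>E. of_bool (fst (ori e) = v) + of_bool (snd (ori e) = v))"

text \<open>For a connected graph without vertices of valence below two this is \<open>2 (b - 1)\<close>. It bounds the number of vertices of
  valence at least three, it is unchanged when vertices of valence two are smoothed, and it does not increase when
  edges are deleted.\<close>

definition excess :: "'a set \<Rightarrow> 'a set set \<Rightarrow> ('a set \<Rightarrow> 'a \<times> 'a) \<Rightarrow> nat" where
  "excess V E ori = (\<Sum>v\<in>V. valence E ori v - 2)"

lemma valence_mono: "finite E \<Longrightarrow> E' \<subseteq> E \<Longrightarrow> valence E' ori v \<le> valence E ori v"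
  unfolding valence_def by (rule sum_mono2) auto

lemma excess_mono: "(\<And>v. valence E' ori' v \<le> valence E ori v) \<Longrightarrow> excess V E' ori' \<le> excess V E ori"
  unfolding excess_def by (intro sum_mono diff_le_mono) auto

definition sqnorm :: "'b set \<Rightarrow> ('b \<Rightarrow> real) \<Rightarrow> real" where
  "sqnorm E c = (\<Sum>e\<in>E. (c e)\<^sup>2)"

lemma sqnorm_diff: "sqnorm E (\<lambda>e. c e - d e) \<le> 2 * sqnorm E c + 2 * sqnorm E d"
proof -
  have "(c e - d e)\<^sup>2 \<le> 2 * (c e)\<^sup>2 + 2 * (d e)\<^sup>2" for e
    using sum_power2_ge_zero[of "c e + d e" 0] by (simp add: power2_eq_square algebra_simps)
  then show ?thesis unfolding sqnorm_def sum_distrib_left sum.distrib[symmetric]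
    by (intro sum_mono)
qed

lemma sqnorm_extend:
  assumes "finite E" "e \<in> E" "p e = 0" "\<sigma> = 1 \<or> \<sigma> = -1"
  shows "sqnorm E (\<lambda>e'. \<sigma> * edge_chain e e' + p e') = 1 + sqnorm E p"
proof -
  have "(\<sigma> * edge_chain e e' + p e')\<^sup>2 = (if e' = e then 1 else 0) + (p e')\<^sup>2" for e'
    using assms(3,4) by (auto simp: edge_chain_def)
  then show ?thesis using assms(1,2) by (simp add: sqnorm_def sum.distrib)
qed

text \<open>The set \<open>S\<close> plays the role of a ball of radius \<open>k\<close> around \<open>r\<close>, the edges \<open>T\<close> form a spanning tree of it, and \<open>p v\<close> is the chain of the
  tree path from \<open>r\<close> to \<open>v\<close>.\<close>

definition grown where
  "grown V E ori r k S T p \<longleftrightarrow> S \<subseteq> {v \<in> V. 3 \<le> valence E ori v} \<and> T \<subseteq> E \<and> card S = card T + 1 \<and>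
     2 ^ k \<le> card S \<and> (\<forall>e\<in>T. fst (ori e) \<in> S \<and> snd (ori e) \<in> S) \<and>
     (\<forall>v\<in>S. (\<forall>e. p v e \<in> \<int>) \<and> (\<forall>e. e \<notin> T \<longrightarrow> p v e = 0) \<and>
        (\<forall>u. boundary E ori (p v) u = of_bool (u = v) - of_bool (u = r)) \<and> sqnorm E (p v) \<le> real k)"

text \<open>A tree with \<open>s\<close> vertices of valence at least three has at least \<open>s + 2\<close> edges leaving it. Either these lead to
  distinct new vertices and the tree doubles, or two of the paths now available, of squared norm at most \<open>k + 1\<close>,
  have the same end and differ by a cycle. The estimate of the norm of a difference costs a factor 2 against the
  length of the shortest cycle, which the constant 4 of the upper bound tolerates.\<close>

lemma grow_step:
  assumes fin: "endpoints_in V E ori" and deg3: "\<And>v. v \<in> V \<Longrightarrow> valence E ori v = 0 \<or> 3 \<le> valence E ori v"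
    and g: "grown V E ori r k S T p"
  shows "(\<exists>c\<in>H1_int V E ori. c \<noteq> (\<lambda>_. 0) \<and> sqnorm E c \<le> 4 * (real k + 1)) \<or>
    (\<exists>S T p. grown V E ori r (Suc k) S T p)"
proof -
  have fE: "finite E" and fV: "finite V" and ends: "\<And>e. e \<in> E \<Longrightarrow> fst (ori e) \<in> V \<and> snd (ori e) \<in> V"
    using fin by (auto simp: endpoints_in_def)
  have S3: "S \<subseteq> {v \<in> V. 3 \<le> valence E ori v}" and TE: "T \<subseteq> E" and cS: "card S = card T + 1"
    and k: "2 ^ k \<le> card S" and TS: "\<And>e. e \<in> T \<Longrightarrow> fst (ori e) \<in> S \<and> snd (ori e) \<in> S"
    using g unfolding grown_def by blast+
  have p: "p v e \<in> \<int>" "e \<notin> T \<Longrightarrow> p v e = 0"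
    "boundary E ori (p v) u = of_bool (u = v) - of_bool (u = r)" "sqnorm E (p v) \<le> real k"
    if "v \<in> S" for v e u using g that unfolding grown_def by blast+
  have fS: "finite S" using S3 fV by (auto intro: finite_subset)
  have fT: "finite T" using TE fE finite_subset by blast
  have pE: "p v e = 0" if "v \<in> S" "e \<notin> E" for v e using p(2) that TE by blast
  let ?short = "\<exists>c\<in>H1_int V E ori. c \<noteq> (\<lambda>_. 0) \<and> sqnorm E c \<le> 4 * (real k + 1)"
  define out where "out = {e \<in> E - T. fst (ori e) \<in> S \<or> snd (ori e) \<in> S}"
  define inner where "inner e = (if fst (ori e) \<in> S then fst (ori e) else snd (ori e))" for e
  define outer where "outer e = (if fst (ori e) \<in> S then snd (ori e) else fst (ori e))" for e
  define \<sigma> where "\<sigma> e = (if fst (ori e) \<in> S then 1 else -1 :: real)" for e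
  define q where "q e = (\<lambda>e'. \<sigma> e * edge_chain e e' + p (inner e) e')" for e
  have \<sigma>: "\<sigma> e = 1 \<or> \<sigma> e = -1" for e by (simp add: \<sigma>_def)
  have outE: "e \<in> E" "e \<notin> T" "inner e \<in> S" "outer e \<in> V" if "e \<in> out" for e
    using that ends[of e] by (auto simp: out_def inner_def outer_def)
  have q: "q e e' \<in> \<int>" "e' \<noteq> e \<Longrightarrow> e' \<notin> T \<Longrightarrow> q e e' = 0" "q e e = \<sigma> e"
      "boundary E ori (q e) u = of_bool (u = outer e) - of_bool (u = r)" "sqnorm E (q e) \<le> real k + 1"
    if e: "e \<in> out" for e e' u
  proof -
    note oe = outE[OF e]
    show "q e e' \<in> \<int>" using p(1)[OF oe(3)] by (simp add: q_def edge_chain_def \<sigma>_def)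
    show "e' \<noteq> e \<Longrightarrow> e' \<notin> T \<Longrightarrow> q e e' = 0" using p(2)[OF oe(3)] by (simp add: q_def edge_chain_def)
    show "q e e = \<sigma> e" using p(2)[OF oe(3) oe(2)] by (simp add: q_def edge_chain_def)
    show "boundary E ori (q e) u = of_bool (u = outer e) - of_bool (u = r)"
      unfolding q_def boundary_linear boundary_edge_chain[OF fE oe(1)] p(3)[OF oe(3)]
      by (auto simp: \<sigma>_def inner_def outer_def inc_def)
    show "sqnorm E (q e) \<le> real k + 1"
      unfolding q_def using sqnorm_extend[OF fE oe(1), of "p (inner e)" "\<sigma> e"] p(2)[OF oe(3) oe(2)]
        p(4)[OF oe(3)] \<sigma> by simp
  qed
  have q_out: "q e e' = 0" if "e \<in> out" "e' \<notin> E" for e e'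
  proof -
    have "e' \<noteq> e" "e' \<notin> T" using that TE outE(1)[OF that(1)] by blast+
    then show ?thesis by (rule q(2)[OF that(1)])
  qed
  show ?thesis
  proof (cases "\<exists>e\<in>out. outer e \<in> S")
    case True
    then obtain e where e: "e \<in> out" "outer e \<in> S" by blast
    let ?c = "\<lambda>e'. q e e' - p (outer e) e'"
    have "?c e' \<in> \<int>" for e' using q(1)[OF e(1)] p(1)[OF e(2)] by simp
    moreover have "?c e' = 0" if "e' \<notin> E" for e' using q_out[OF e(1) that] pE[OF e(2) that] by simp
    moreover have "boundary E ori ?c u = 0" for u
      unfolding boundary_diff q(4)[OF e(1)] p(3)[OF e(2)] by simp
    ultimately have "?c \<in> H1_int V E ori" by (intro H1_intI)
    moreover have "?c e \<noteq> 0" using q(3)[OF e(1)] p(2)[OF e(2) outE(2)[OF e(1)]] \<sigma>[of e] by auto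
    then have "?c \<noteq> (\<lambda>_. 0)" by metis
    moreover have "sqnorm E ?c \<le> 4 * (real k + 1)"
      using sqnorm_diff[of E "q e" "p (outer e)"] q(5)[OF e(1)] p(4)[OF e(2)] by simp
    ultimately show ?thesis by (intro disjI1 bexI[of _ ?c] conjI)
  next
    case outside: False
    show ?thesis
    proof (cases "inj_on outer out")
      case False
      then obtain e e' where e: "e \<in> out" "e' \<in> out" "e \<noteq> e'" "outer e = outer e'"
        unfolding inj_on_def by blast
      let ?c = "\<lambda>e''. q e e'' - q e' e''"
      have "?c e'' \<in> \<int>" for e'' using q(1) e by simp
      moreover have "?c e'' = 0" if "e'' \<notin> E" for e'' using q_out that e by simp
      moreover have "boundary E ori ?c u = 0" for u
        unfolding boundary_diff q(4)[OF e(1)] q(4)[OF e(2)] e(4) by simp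
      ultimately have "?c \<in> H1_int V E ori" by (intro H1_intI)
      moreover have "?c e \<noteq> 0" using q(3)[OF e(1)] q(2)[OF e(2) e(3) outE(2)[OF e(1)]] \<sigma>[of e] by auto
      then have "?c \<noteq> (\<lambda>_. 0)" by metis
      moreover have "sqnorm E ?c \<le> 4 * (real k + 1)"
        using sqnorm_diff[of E "q e" "q e'"] q(5)[OF e(1)] q(5)[OF e(2)] by simp
      ultimately show ?thesis by (intro disjI1 bexI[of _ ?c] conjI)
    next
      case inj: True
      have fout: "finite out" using fE by (simp add: out_def)
      define S' where "S' = S \<union> outer ` out"
      define T' where "T' = T \<union> out"
      define p' where "p' v = (if v \<in> S then p v else q (inv_into out outer v))" for v
      have disj: "S \<inter> outer ` out = {}" using outside by blast
      have disjT: "T \<inter> out = {}" unfolding out_def by blast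
      have cS': "card S' = card S + card out"
        unfolding S'_def using card_Un_disjoint[OF fS _ disj] fout card_image[OF inj] by simp
      have cT': "card T' = card T + card out"
        unfolding T'_def using card_Un_disjoint[OF fT fout disjT] .
      have "3 * card S \<le> (\<Sum>v\<in>S. valence E ori v)"
      proof -
        have "3 \<le> valence E ori v" if "v \<in> S" for v using S3 that by blast
        then show ?thesis using sum_bounded_below[of S 3 "valence E ori"] by (simp add: mult.commute)
      qed
      also have "\<dots> = (\<Sum>e\<in>E. \<Sum>v\<in>S. of_bool (fst (ori e) = v) + of_bool (snd (ori e) = v))"
        unfolding valence_def by (rule sum.swap)
      also have "\<dots> = (\<Sum>e\<in>E. of_bool (fst (ori e) \<in> S) + of_bool (snd (ori e) \<in> S))"
        using fS by (simp add: sum.distrib of_bool_def)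
      also have "\<dots> = (\<Sum>e\<in>E. 2 * of_bool (e \<in> T) + of_bool (e \<in> out))"
      proof (rule sum.cong[OF refl])
        fix e assume eE: "e \<in> E"
        show "of_bool (fst (ori e) \<in> S) + of_bool (snd (ori e) \<in> S) = (2 * of_bool (e \<in> T) + of_bool (e \<in> out) :: nat)"
        proof (cases "e \<in> T")
          case True
          then show ?thesis using TS[OF True] by (simp add: out_def)
        next
          case False
          have "\<not> (fst (ori e) \<in> S \<and> snd (ori e) \<in> S)"
            using outside eE False unfolding out_def outer_def by fastforce
          then show ?thesis using eE False by (auto simp: out_def)
        qed
      qed
      also have "\<dots> = 2 * card (E \<inter> T) + card (E \<inter> out)"
        using fE by (simp add: sum.distrib sum_distrib_left[symmetric] of_bool_def sum.If_cases Int_def)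
      also have "E \<inter> T = T" using TE by blast
      also have "E \<inter> out = out" unfolding out_def by blast
      finally have cout: "card S + 2 \<le> card out" using cS by simp
      have "grown V E ori r (Suc k) S' T' p'"
        unfolding grown_def
      proof (intro conjI ballI)
        have "3 \<le> valence E ori (outer e)" if "e \<in> out" for e
        proof -
          have "0 < (\<Sum>e\<in>E. of_bool (fst (ori e) = outer e') + of_bool (snd (ori e) = outer e') :: nat)" if "e' \<in> out" for e'
            using outE(1)[OF that] fE by (intro sum_pos2[of E e']) (auto simp: outer_def)
          then have "valence E ori (outer e) \<noteq> 0" using that by (simp add: valence_def)
          then show ?thesis using deg3[OF outE(4)[OF that]] by simp
        qed
        then show "S' \<subseteq> {v \<in> V. 3 \<le> valence E ori v}" using S3 outE(4) unfolding S'_def by blast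
        show "T' \<subseteq> E" using TE outE(1) unfolding T'_def by blast
        show "card S' = card T' + 1" using cS cS' cT' by simp
        show "2 ^ Suc k \<le> card S'" using k cS' cout by simp
      next
        fix e assume e: "e \<in> T'"
        show "fst (ori e) \<in> S'"
          using e TS[of e] unfolding T'_def S'_def out_def outer_def by auto
        show "snd (ori e) \<in> S'"
        proof (cases "e \<in> T \<or> snd (ori e) \<in> S")
          case True
          then show ?thesis using TS[of e] by (auto simp: S'_def)
        next
          case False
          then have eo: "e \<in> out" using e by (simp add: T'_def)
          then have "fst (ori e) \<in> S" using False by (simp add: out_def)
          then have "outer e = snd (ori e)" by (simp add: outer_def)
          then show ?thesis using eo unfolding S'_def by (metis UnI2 image_eqI)
        qed
      next
        fix v assume v: "v \<in> S'"
        show "\<forall>e. p' v e \<in> \<int>" "\<forall>e. e \<notin> T' \<longrightarrow> p' v e = 0"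
          "\<forall>u. boundary E ori (p' v) u = of_bool (u = v) - of_bool (u = r)" "sqnorm E (p' v) \<le> real (Suc k)"
        proof -
          have "(\<forall>e. p' v e \<in> \<int>) \<and> (\<forall>e. e \<notin> T' \<longrightarrow> p' v e = 0) \<and>
            (\<forall>u. boundary E ori (p' v) u = of_bool (u = v) - of_bool (u = r)) \<and> sqnorm E (p' v) \<le> real (Suc k)"
          proof (cases "v \<in> S")
            case True
            then show ?thesis using p[OF True] by (simp add: p'_def T'_def order_trans[of _ "real k"])
          next
            case False
            then have "v \<in> outer ` out" using v by (simp add: S'_def)
            then obtain e where e: "e \<in> out" "v = outer e" by blast
            then have p': "p' v = q e" using False inj by (simp add: p'_def inv_into_f_f)
            have "q e e' = 0" if "e' \<notin> T'" for e'
            proof -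
              have "e' \<noteq> e" "e' \<notin> T" using that e(1) unfolding T'_def by blast+
              then show ?thesis by (rule q(2)[OF e(1)])
            qed
            then show ?thesis unfolding p' using q(1,4,5)[OF e(1)] e(2) by simp
          qed
          then show "\<forall>e. p' v e \<in> \<int>" "\<forall>e. e \<notin> T' \<longrightarrow> p' v e = 0"
            "\<forall>u. boundary E ori (p' v) u = of_bool (u = v) - of_bool (u = r)" "sqnorm E (p' v) \<le> real (Suc k)"
            by blast+
        qed
      qed
      then show ?thesis by blast
    qed
  qed
qed

lemma short_cycle:
  assumes fin: "endpoints_in V E ori" and deg3: "\<And>v. v \<in> V \<Longrightarrow> valence E ori v = 0 \<or> 3 \<le> valence E ori v"
    and ne: "E \<noteq> {}" and L: "excess V E ori < 2 ^ L"
  shows "\<exists>c\<in>H1_int V E ori. c \<noteq> (\<lambda>_. 0) \<and> sqnorm E c \<le> 4 * real L"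
proof (rule ccontr)
  assume no: "\<not> ?thesis"
  have fE: "finite E" and fV: "finite V" and ends: "\<And>e. e \<in> E \<Longrightarrow> fst (ori e) \<in> V \<and> snd (ori e) \<in> V"
    using fin by (auto simp: endpoints_in_def)
  obtain e where e: "e \<in> E" using ne by blast
  define r where "r = fst (ori e)"
  have "0 < valence E ori r"
    unfolding valence_def using e fE by (intro sum_pos2[of E e]) (auto simp: r_def)
  then have r: "r \<in> V" "3 \<le> valence E ori r" using deg3[of r] ends[OF e] by (auto simp: r_def)
  \<comment> \<open>In the absence of a short cycle the tree doubles \<open>L\<close> times and outgrows the excess.\<close>
  have "\<exists>S T p. grown V E ori r k S T p" if "k \<le> L" for k
    using that
  proof (induction k)
    case 0
    have "grown V E ori r 0 {r} {} (\<lambda>_ _. 0)"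
      using r by (simp add: grown_def sqnorm_def)
    then show ?case by blast
  next
    case (Suc k)
    then obtain S T p where g: "grown V E ori r k S T p" by auto
    have "4 * (real k + 1) \<le> 4 * real L" using Suc.prems by simp
    then have "\<not> (\<exists>c\<in>H1_int V E ori. c \<noteq> (\<lambda>_. 0) \<and> sqnorm E c \<le> 4 * (real k + 1))"
      using no by (meson order_trans)
    then show ?case using grow_step[OF fin deg3 g] by blast
  qed
  then obtain S T p where g: "grown V E ori r L S T p" by blast
  have "2 ^ L \<le> card S" "S \<subseteq> {v \<in> V. 3 \<le> valence E ori v}" using g by (auto simp: grown_def)
  moreover have "card S \<le> excess V E ori"
  proof -
    have "card S \<le> (\<Sum>v\<in>S. valence E ori v - 2)"
      using sum_bounded_below[of S 1 "\<lambda>v. valence E ori v - 2"] \<open>S \<subseteq> _\<close> by force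
    also have "\<dots> \<le> excess V E ori"
      unfolding excess_def using \<open>S \<subseteq> _\<close> fV by (intro sum_mono2) auto
    finally show ?thesis .
  qed
  ultimately show False using L by linarith
qed

section \<open>Dismantling a weighted graph\<close>

text \<open>A basis of the integral cycles in which the squared distance of each vector from the span of the preceding ones
  is at least \<open>\<kappa>\<close>. The determinant of the lattice is then at least \<open>\<kappa> ^ r\<close>.\<close>

definition separated_basis where
  "separated_basis V E ori w \<kappa> \<longleftrightarrow> (\<exists>r v. (\<forall>i<r. v i \<in> H1_int V E ori) \<and>
     H1_real V E ori \<subseteq> range (lincomb r v) \<and> H1_int V E ori \<subseteq> int_comb r v \<and>
     (\<forall>i<r. \<forall>t. \<kappa> \<le> weight_form E w (coset_vec v i t) (coset_vec v i t)))"

lemma H1_int_real: "c \<in> H1_int V E ori \<Longrightarrow> c \<in> H1_real V E ori"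
  by (simp add: H1_int_iff)

lemma H1_outside: "c \<in> H1_real V E ori \<Longrightarrow> e \<notin> E \<Longrightarrow> c e = 0"
  by (simp add: H1_real_def chains_def)

lemma coset_cycle:
  assumes "\<And>i. i < r \<Longrightarrow> v i \<in> H1_int V E ori" "i < r"
  shows "(coset_vec v i t) \<in> H1_real V E ori"
proof -
  have "lincomb i v t \<in> H1_real V E ori"
    using assms by (intro H1_real_lincomb) (simp add: H1_int_iff)
  then show ?thesis
    using H1_real_linear[of "v i" V E ori "lincomb i v t" 1] assms by (simp add: H1_int_iff)
qed

lemma separated_basis_bridge:
  assumes fE: "finite E" and e: "\<And>c. c \<in> H1_real V E ori \<Longrightarrow> c e = 0"
    and sep: "separated_basis V (E - {e}) ori w \<kappa>"
  shows "separated_basis V E ori w \<kappa>"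
proof -
  have real: "H1_real V E ori = H1_real V (E - {e}) ori"
  proof (intro equalityI subsetI)
    fix c assume c: "c \<in> H1_real V E ori"
    show "c \<in> H1_real V (E - {e}) ori" by (rule H1_real_remove[OF fE c e[OF c]])
  next
    fix c assume "c \<in> H1_real V (E - {e}) ori"
    then show "c \<in> H1_real V E ori" by (rule H1_real_mono[OF fE Diff_subset])
  qed
  have int: "H1_int V E ori = H1_int V (E - {e}) ori"
    by (intro set_eqI) (simp add: H1_int_iff real)
  obtain r v where v: "\<And>i. i < r \<Longrightarrow> v i \<in> H1_int V (E - {e}) ori"
    "H1_real V (E - {e}) ori \<subseteq> range (lincomb r v)" "H1_int V (E - {e}) ori \<subseteq> int_comb r v"
    "\<And>i t. i < r \<Longrightarrow> \<kappa> \<le> weight_form (E - {e}) w (coset_vec v i t) (coset_vec v i t)"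
    using sep unfolding separated_basis_def by blast
  have "\<kappa> \<le> weight_form E w (coset_vec v i t) (coset_vec v i t)" if "i < r" for i t
  proof -
    have "v i e + lincomb i v t e = 0" using e[unfolded real, OF coset_cycle[where v = v and r = r, OF v(1) that]] .
    then show ?thesis using v(4)[OF that, of t] weight_form_remove[OF fE, of "\<lambda>e. v i e + lincomb i v t e" e w] by simp
  qed
  then show ?thesis unfolding separated_basis_def using v(1,2,3) real int by blast
qed

text \<open>The new basis vector has coefficient 1 at \<open>e\<close> and all earlier ones have coefficient 0, so its distance from
  their span is at least the weight of \<open>e\<close>.\<close>

lemma separated_basis_cycle:
  assumes fE: "finite E" and eE: "e \<in> E" and w: "\<And>e. e \<in> E \<Longrightarrow> 0 \<le> w e"
    and z: "z \<in> H1_int V E ori" "z e = 1" and heavy: "\<kappa> \<le> w e"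
    and sep: "separated_basis V (E - {e}) ori w \<kappa>"
  shows "separated_basis V E ori w \<kappa>"
proof -
  obtain r v where v: "\<And>i. i < r \<Longrightarrow> v i \<in> H1_int V (E - {e}) ori"
    "H1_real V (E - {e}) ori \<subseteq> range (lincomb r v)" "H1_int V (E - {e}) ori \<subseteq> int_comb r v"
    "\<And>i t. i < r \<Longrightarrow> \<kappa> \<le> weight_form (E - {e}) w (coset_vec v i t) (coset_vec v i t)"
    using sep unfolding separated_basis_def by blast
  let ?v = "v(r := z)"
  have expand: "\<exists>t. c = lincomb (Suc r) ?v t \<and> ((\<forall>e. c e \<in> \<int>) \<longrightarrow> (\<forall>i<Suc r. t i \<in> \<int>))"
    if c: "c \<in> H1_real V E ori" for c
  proof -
    let ?d = "\<lambda>e'. - c e * z e' + c e'"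
    have d: "?d \<in> H1_real V (E - {e}) ori"
      using H1_real_linear[OF H1_int_real[OF z(1)] c, of "- c e"] z(2)
      by (intro H1_real_remove fE) simp_all
    have zint: "z e' \<in> \<int>" for e' using z(1) by (simp add: H1_int_iff)
    obtain t where t: "?d = lincomb r v t" "(\<forall>e. c e \<in> \<int>) \<longrightarrow> (\<forall>i<r. t i \<in> \<int>)"
    proof (cases "\<forall>e. c e \<in> \<int>")
      case True
      then have "?d \<in> H1_int V (E - {e}) ori" using d zint by (simp add: H1_int_iff)
      then have "?d \<in> int_comb r v" using v(3) by blast
      then show ?thesis using that unfolding int_comb_def by blast
    next
      case False
      then show ?thesis using that v(2) d by blast
    qed
    have "c = lincomb (Suc r) ?v (t(r := c e))"
    proof
      fix e'
      show "c e' = lincomb (Suc r) ?v (t(r := c e)) e'"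
        using fun_cong[OF t(1), of e'] by (simp add: lincomb_Suc)
    qed
    moreover have "(\<forall>e. c e \<in> \<int>) \<longrightarrow> (\<forall>i<Suc r. (t(r := c e)) i \<in> \<int>)"
      using t(2) by (simp add: less_Suc_eq)
    ultimately show ?thesis by blast
  qed
  have "H1_real V E ori \<subseteq> range (lincomb (Suc r) ?v)" using expand by blast
  moreover have "H1_int V E ori \<subseteq> int_comb (Suc r) ?v"
  proof
    fix c assume "c \<in> H1_int V E ori"
    then have "c \<in> H1_real V E ori" "\<forall>e. c e \<in> \<int>" by (simp_all add: H1_int_iff)
    then show "c \<in> int_comb (Suc r) ?v" using expand[of c] unfolding int_comb_def by blast
  qed
  moreover have "?v i \<in> H1_int V E ori" if "i < Suc r" for i
  proof (cases "i = r")
    case True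
    then show ?thesis using z by simp
  next
    case False
    then have "v i \<in> H1_int V (E - {e}) ori" using that v(1) by simp
    then have "v i \<in> H1_int V E ori" unfolding H1_int_iff using H1_real_mono[OF fE Diff_subset] by blast
    then show ?thesis using False by simp
  qed
  moreover have "\<kappa> \<le> weight_form E w (\<lambda>e. ?v i e + lincomb i ?v t e) (\<lambda>e. ?v i e + lincomb i ?v t e)"
    if i: "i < Suc r" for i t
  proof (cases "i = r")
    case True
    have "v j e = 0" if "j < r" for j using H1_outside[OF H1_int_real[OF v(1)[OF that]]] by simp
    then have "lincomb r v t e = 0" by (simp add: lincomb_def)
    then have "w e = w e * (z e + lincomb r v t e) * (z e + lincomb r v t e)" using z(2) by simp
    also have "\<dots> \<le> weight_form E w (\<lambda>e. z e + lincomb r v t e) (\<lambda>e. z e + lincomb r v t e)"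
      unfolding weight_form_def
      by (rule member_le_sum[OF eE]) (use w fE in \<open>simp_all add: mult.assoc\<close>)
    finally show ?thesis using heavy True by simp
  next
    case False
    then have ir: "i < r" using i by simp
    have eq: "lincomb i ?v t = lincomb i v t" using ir by (intro lincomb_cong) auto
    have "v i e + lincomb i v t e = 0" using H1_outside[OF coset_cycle[where v = v and r = r, OF v(1) ir]] by simp
    then show ?thesis
      using v(4)[OF ir, of t] weight_form_remove[OF fE, of "\<lambda>e. v i e + lincomb i v t e" e w] ir
      by (simp add: eq)
  qed
  ultimately show ?thesis unfolding separated_basis_def
    by (intro exI[of _ "Suc r"] exI[of _ ?v]) blast
qed

lemma separated_basis_heavy_edge:
  assumes fin: "endpoints_in V E ori" and eE: "e \<in> E" and w: "\<And>e. e \<in> E \<Longrightarrow> 0 \<le> w e"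
    and heavy: "\<kappa> \<le> w e" and sep: "separated_basis V (E - {e}) ori w \<kappa>"
  shows "separated_basis V E ori w \<kappa>"
proof -
  have fE: "finite E" using fin by (simp add: endpoints_in_def)
  from cycle_through_or_bridge[OF fin eE] show ?thesis
  proof
    assume "\<exists>z\<in>H1_int V E ori. z e = 1"
    then show ?thesis using separated_basis_cycle[OF fE eE w _ _ heavy sep] by blast
  next
    assume "\<forall>c\<in>H1_real V E ori. c e = 0"
    then show ?thesis using separated_basis_bridge[OF fE _ sep] by blast
  qed
qed

text \<open>The edges \<open>e\<close> and \<open>f\<close> are in series: \<open>f\<close> is contracted, the end of \<open>e\<close> at the common vertex moves to the
  other end of \<open>f\<close>, and the sign \<open>\<epsilon>\<close> compares the two orientations.\<close>

lemma merge_boundary: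
  assumes fE: "finite E" and eE: "e \<in> E" "f \<in> E" "e \<noteq> f"
    and c: "c f = 0"
    and inc: "\<And>v. inc ori e v - inc ori' e v + \<epsilon> * inc ori f v = 0"
    and same: "\<And>e'. e' \<noteq> e \<Longrightarrow> ori' e' = ori e'"
  shows "boundary E ori (c(f := \<epsilon> * c e)) v = boundary (E - {f}) ori' c v"
proof -
  have "boundary E ori (c(f := \<epsilon> * c e)) v = \<epsilon> * c e * inc ori f v + (\<Sum>e'\<in>E - {f}. c e' * inc ori e' v)"
    unfolding boundary_inc using fE eE by (subst sum.remove[of E f]) (auto intro!: sum.cong)
  also have "(\<Sum>e'\<in>E - {f}. c e' * inc ori e' v) = c e * inc ori e v + (\<Sum>e'\<in>E - {f} - {e}. c e' * inc ori e' v)"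
    using fE eE by (intro sum.remove) simp_all
  also have "(\<Sum>e'\<in>E - {f} - {e}. c e' * inc ori e' v) = (\<Sum>e'\<in>E - {f} - {e}. c e' * inc ori' e' v)"
    using same by (intro sum.cong) (simp_all add: inc_def)
  also have "\<epsilon> * c e * inc ori f v + (c e * inc ori e v + (\<Sum>e'\<in>E - {f} - {e}. c e' * inc ori' e' v))
     = c e * (inc ori e v - inc ori' e v + \<epsilon> * inc ori f v) + (c e * inc ori' e v + (\<Sum>e'\<in>E - {f} - {e}. c e' * inc ori' e' v))"
    by (simp add: algebra_simps)
  also have "\<dots> = c e * inc ori' e v + (\<Sum>e'\<in>E - {f} - {e}. c e' * inc ori' e' v)" by (simp add: inc)
  also have "\<dots> = boundary (E - {f}) ori' c v"
    unfolding boundary_inc using fE eE by (intro sum.remove[symmetric]) simp_all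
  finally show ?thesis .
qed

lemma merge_cycle:
  assumes fE: "finite E" and eE: "e \<in> E" "f \<in> E" "e \<noteq> f"
    and inc: "\<And>v. inc ori e v - inc ori' e v + \<epsilon> * inc ori f v = 0"
    and same: "\<And>e'. e' \<noteq> e \<Longrightarrow> ori' e' = ori e'"
    and c: "c \<in> H1_real V (E - {f}) ori'"
  shows "c(f := \<epsilon> * c e) \<in> H1_real V E ori"
proof -
  have "c f = 0" using H1_outside[OF c] by simp
  then have "boundary E ori (c(f := \<epsilon> * c e)) v = boundary (E - {f}) ori' c v" for v
    by (rule merge_boundary[where e = e and c = c, OF fE eE _ inc same])
  then have "boundary E ori (c(f := \<epsilon> * c e)) v = 0" if "v \<in> V" for v
    using c that by (simp add: H1_real_def)
  moreover have "(c(f := \<epsilon> * c e)) e' = 0" if "e' \<notin> E" for e'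
  proof -
    have "e' \<noteq> f" "e' \<notin> E - {f}" using that eE by blast+
    then show ?thesis using H1_outside[OF c] by simp
  qed
  ultimately show ?thesis unfolding H1_real_def chains_def by blast
qed

lemma merge_weight_form:
  assumes fE: "finite E" and eE: "e \<in> E" "f \<in> E" "e \<noteq> f" and \<epsilon>: "\<epsilon> = 1 \<or> \<epsilon> = -1"
  shows "weight_form E w (c(f := \<epsilon> * c e)) (c(f := \<epsilon> * c e)) =
    weight_form (E - {f}) (w(e := w e + w f)) c c"
proof -
  let ?\<phi> = "\<lambda>c. c(f := \<epsilon> * c e)" and ?E = "E - {f}" and ?w = "w(e := w e + w f)"
  have "weight_form E w (?\<phi> c) (?\<phi> c) = w f * (\<epsilon> * c e) * (\<epsilon> * c e) + (\<Sum>e'\<in>?E. w e' * c e' * c e')"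
    unfolding weight_form_def using fE eE by (subst sum.remove[of E f]) (auto intro!: sum.cong)
  also have "(\<Sum>e'\<in>?E. w e' * c e' * c e') = w e * c e * c e + (\<Sum>e'\<in>?E - {e}. w e' * c e' * c e')"
    using fE eE by (intro sum.remove) simp_all
  also have "(\<Sum>e'\<in>?E - {e}. w e' * c e' * c e') = (\<Sum>e'\<in>?E - {e}. ?w e' * c e' * c e')"
    by (intro sum.cong) simp_all
  also have "w f * (\<epsilon> * c e) * (\<epsilon> * c e) + (w e * c e * c e + (\<Sum>e'\<in>?E - {e}. ?w e' * c e' * c e'))
      = ?w e * c e * c e + (\<Sum>e'\<in>?E - {e}. ?w e' * c e' * c e')"
    using \<epsilon> by (auto simp: algebra_simps)
  also have "\<dots> = weight_form ?E ?w c c"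
    unfolding weight_form_def using fE eE by (intro sum.remove[symmetric]) simp_all
  finally show ?thesis .
qed

lemma separated_basis_merge:
  assumes fE: "finite E" and eE: "e \<in> E" "f \<in> E" "e \<noteq> f" and \<epsilon>: "\<epsilon> = 1 \<or> \<epsilon> = -1"
    and inc: "\<And>v. inc ori e v - inc ori' e v + \<epsilon> * inc ori f v = 0"
    and same: "\<And>e'. e' \<noteq> e \<Longrightarrow> ori' e' = ori e'"
    and cyc: "\<And>c. c \<in> H1_real V E ori \<Longrightarrow> c f = \<epsilon> * c e"
    and sep: "separated_basis V (E - {f}) ori' (w(e := w e + w f)) \<kappa>"
  shows "separated_basis V E ori w \<kappa>"
proof -
  let ?\<phi> = "\<lambda>c. c(f := \<epsilon> * c e)" and ?E = "E - {f}" and ?w = "w(e := w e + w f)"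
  have bd: "boundary E ori (?\<phi> c) v = boundary ?E ori' c v" if "c f = 0" for c v
    by (rule merge_boundary[where e = e and c = c, OF fE eE that inc same])
  have up_int: "?\<phi> c \<in> H1_int V E ori" if c: "c \<in> H1_int V ?E ori'" for c
    using merge_cycle[OF fE eE inc same H1_int_real[OF c]] c \<epsilon> by (auto simp: H1_int_iff)
  have down: "\<exists>c'. c = ?\<phi> c' \<and> c' \<in> H1_real V ?E ori' \<and> ((\<forall>e. c e \<in> \<int>) \<longrightarrow> (\<forall>e. c' e \<in> \<int>))"
    if c: "c \<in> H1_real V E ori" for c
  proof -
    let ?c = "c(f := 0)"
    have eq: "c = ?\<phi> ?c" using cyc[OF c] eE by (intro ext) simp
    have "boundary ?E ori' ?c v = 0" if "v \<in> V" for v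
      using bd[of ?c v] c that unfolding eq[symmetric] by (simp add: H1_real_def)
    moreover have "?c e' = 0" if "e' \<notin> ?E" for e'
    proof (cases "e' = f")
      case False
      then have "e' \<notin> E" using that by blast
      then show ?thesis using H1_outside[OF c] by simp
    qed simp
    ultimately have "?c \<in> H1_real V ?E ori'" unfolding H1_real_def chains_def by blast
    then show ?thesis using eq by (intro exI[of _ ?c]) simp
  qed
  have wf: "weight_form E w (?\<phi> c) (?\<phi> c) = weight_form ?E ?w c c" for c
    by (rule merge_weight_form[OF fE eE \<epsilon>])
  have lin: "?\<phi> (lincomb r v t) = lincomb r (\<lambda>i. ?\<phi> (v i)) t" for r v t
    by (intro ext) (simp add: lincomb_def sum_distrib_left mult_ac)
  obtain r v where v: "\<And>i. i < r \<Longrightarrow> v i \<in> H1_int V ?E ori'"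
    "H1_real V ?E ori' \<subseteq> range (lincomb r v)" "H1_int V ?E ori' \<subseteq> int_comb r v"
    "\<And>i t. i < r \<Longrightarrow> \<kappa> \<le> weight_form ?E ?w (coset_vec v i t) (coset_vec v i t)"
    using sep unfolding separated_basis_def by blast
  let ?v = "\<lambda>i. ?\<phi> (v i)"
  have "?v i \<in> H1_int V E ori" if "i < r" for i using up_int[OF v(1)[OF that]] .
  moreover have "H1_real V E ori \<subseteq> range (lincomb r ?v)"
  proof
    fix c assume "c \<in> H1_real V E ori"
    then obtain c' where c': "c = ?\<phi> c'" "c' \<in> H1_real V ?E ori'" using down by blast
    then obtain t where "c' = lincomb r v t" using v(2) by blast
    then show "c \<in> range (lincomb r ?v)" using c'(1) lin by blast
  qed
  moreover have "H1_int V E ori \<subseteq> int_comb r ?v"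
  proof
    fix c assume "c \<in> H1_int V E ori"
    then have "c \<in> H1_real V E ori" "\<forall>e. c e \<in> \<int>" by (simp_all add: H1_int_iff)
    then obtain c' where c': "c = ?\<phi> c'" "c' \<in> H1_real V ?E ori'" "\<forall>e. c' e \<in> \<int>"
      using down[of c] by blast
    then have "c' \<in> int_comb r v" using v(3) unfolding H1_int_iff[symmetric] by (metis H1_int_iff subsetD)
    then obtain t where "c' = lincomb r v t" "\<forall>i<r. t i \<in> \<int>" unfolding int_comb_def by blast
    then show "c \<in> int_comb r ?v" using c'(1) lin unfolding int_comb_def by blast
  qed
  moreover have "\<kappa> \<le> weight_form E w (\<lambda>e. ?v i e + lincomb i ?v t e) (\<lambda>e. ?v i e + lincomb i ?v t e)"
    if i: "i < r" for i t
  proof -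
    let ?c = "\<lambda>e. v i e + lincomb i v t e"
    have "(\<lambda>e. ?v i e + lincomb i ?v t e) = ?\<phi> ?c"
      unfolding lin[symmetric] by (intro ext) (simp add: algebra_simps)
    then show ?thesis using wf[of ?c] v(4)[OF i, of t] by simp
  qed
  ultimately show "separated_basis V E ori w \<kappa>" unfolding separated_basis_def
    by (intro exI[of _ r] exI[of _ ?v]) blast
qed

lemma weight_form_edge_chain:
  assumes "finite E" "e \<in> E" shows "weight_form E w (edge_chain e) (edge_chain e) = w e"
proof -
  have "weight_form E w (edge_chain e) (edge_chain e) = (\<Sum>e'\<in>E. if e' = e then w e else 0)"
    unfolding weight_form_def by (intro sum.cong) (simp_all add: edge_chain_def)
  then show ?thesis using assms by simp
qed

lemma weight_form_le_max:
  assumes "finite E" "\<And>e. e \<in> E \<Longrightarrow> w e \<le> M"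
  shows "weight_form E w c c \<le> M * sqnorm E c"
proof -
  have "weight_form E w c c \<le> (\<Sum>e\<in>E. M * (c e)\<^sup>2)"
    unfolding weight_form_def
    by (intro sum_mono) (simp add: assms mult_right_mono power2_eq_square mult.assoc)
  then show ?thesis by (simp add: sqnorm_def sum_distrib_left)
qed

text \<open>Edges at vertices of valence one carry no cycles, and two edges in series act as one edge whose weight is the
  sum. If neither occurs, a loop weighs at least \<open>s\<close>, and in the absence of loops a short cycle exists, so that the
  heaviest edge weighs at least \<open>s / (4 L)\<close>; deleting such an edge lowers the rank by at most one.\<close>

theorem separated_basis_exists:
  assumes "endpoints_in V E ori" "\<And>e. e \<in> E \<Longrightarrow> 0 \<le> w e" "excess V E ori < 2 ^ L"
    and L: "1 \<le> L" and s: "0 < s"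
    and "\<And>c. c \<in> H1_int V E ori \<Longrightarrow> c \<noteq> (\<lambda>_. 0) \<Longrightarrow> s \<le> weight_form E w c c"
  shows "separated_basis V E ori w (s / (4 * real L))"
  using assms(1-3,6)
proof (induction "card E" arbitrary: E ori w rule: less_induct)
  case less
  note fin = less.prems(1) and w = less.prems(2) and ex = less.prems(3) and sys = less.prems(4)
  let ?\<kappa> = "s / (4 * real L)"
  have fE: "finite E" and fV: "finite V" and ends: "\<And>e. e \<in> E \<Longrightarrow> fst (ori e) \<in> V \<and> snd (ori e) \<in> V"
    using fin by (auto simp: endpoints_in_def)
  have \<kappa>: "?\<kappa> \<le> s" using s L by (simp add: field_simps)
  have remove: "separated_basis V (E - {e}) ori w ?\<kappa>" if e: "e \<in> E" for e
  proof (rule less.hyps)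
    show "card (E - {e}) < card E" using fE e by (rule card_Diff1_less)
    show "endpoints_in V (E - {e}) ori" using fin by (simp add: endpoints_in_def)
    show "0 \<le> w e'" if "e' \<in> E - {e}" for e' using that w by simp
    have "valence (E - {e}) ori v \<le> valence E ori v" for v using fE by (intro valence_mono) blast+
    then show "excess V (E - {e}) ori < 2 ^ L"
      using ex by (meson excess_mono le_less_trans)
    fix c assume c: "c \<in> H1_int V (E - {e}) ori" "c \<noteq> (\<lambda>_. 0)"
    then have "c \<in> H1_int V E ori"
      using H1_real_mono[OF fE Diff_subset] unfolding H1_int_iff by blast
    then have "s \<le> weight_form E w c c" using c(2) by (rule sys)
    moreover have "c e = 0" using H1_outside[OF H1_int_real[OF c(1)]] by simp
    ultimately show "s \<le> weight_form (E - {e}) w c c" using weight_form_remove[OF fE] by metis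
  qed
  have heavy: ?case if "e \<in> E" "?\<kappa> \<le> w e" for e
    by (rule separated_basis_heavy_edge[OF fin that(1) w that(2) remove[OF that(1)]])
  show ?case
  proof (cases "\<exists>e\<in>E. fst (ori e) = snd (ori e)")
    case True
    then obtain e where e: "e \<in> E" "fst (ori e) = snd (ori e)" by blast
    have "edge_chain e \<in> H1_int V E ori"
    proof (rule H1_intI)
      show "edge_chain e e' = 0" if "e' \<notin> E" for e'
      proof -
        have "e' \<noteq> e" using that e by blast
        then show ?thesis by (simp add: edge_chain_def)
      qed
      show "boundary E ori (edge_chain e) v = 0" for v
        unfolding boundary_edge_chain[OF fE e(1)] by (simp add: inc_def e(2))
    qed (simp add: edge_chain_def)
    moreover have "edge_chain e e \<noteq> 0" by (simp add: edge_chain_def)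
    then have "edge_chain e \<noteq> (\<lambda>_. 0)" by metis
    ultimately have "s \<le> w e" using sys weight_form_edge_chain[OF fE e(1)] by metis
    then show ?thesis using heavy[OF e(1)] \<kappa> by simp
  next
    case False
    then have noloop: "fst (ori e) \<noteq> snd (ori e)" if "e \<in> E" for e using that by blast
    define N where "N v = {e \<in> E. v = fst (ori e) \<or> v = snd (ori e)}" for v
    have deg_N: "valence E ori v = card (N v)" for v
    proof -
      have "valence E ori v = (\<Sum>e\<in>E. of_bool (e \<in> N v))"
        unfolding valence_def using noloop by (intro sum.cong) (auto simp: N_def)
      also have "\<dots> = card (E \<inter> N v)" using fE by (simp add: of_bool_def sum.If_cases)
      also have "E \<inter> N v = N v" by (auto simp: N_def)
      finally show ?thesis .
    qed
    have inc_N: "inc ori e v = 0" if "e \<in> E" "e \<notin> N v" for e v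
      using that by (auto simp: inc_def N_def)
    have N_inc: "\<exists>u \<sigma>. u \<noteq> v \<and> u \<in> V \<and> (\<sigma> = 1 \<or> \<sigma> = -1) \<and>
        (\<forall>v'. inc ori e v' = \<sigma> * (of_bool (v' = v) - of_bool (v' = u))) \<and>
        (\<forall>v'. of_bool (fst (ori e) = v') + of_bool (snd (ori e) = v') = (of_bool (v = v') + of_bool (u = v') :: nat))"
      if e: "e \<in> N v" for e v
    proof -
      define u where "u = (if fst (ori e) = v then snd (ori e) else fst (ori e))"
      have eE: "e \<in> E" using e by (simp add: N_def)
      have u: "{fst (ori e), snd (ori e)} = {v, u}" "v \<noteq> u" "u \<in> V"
        using e noloop[OF eE] ends[OF eE] by (auto simp: u_def N_def)
      obtain \<sigma> where "\<sigma> = 1 \<or> \<sigma> = -1" "\<And>v'. inc ori e v' = \<sigma> * (of_bool (v' = v) - of_bool (v' = u))"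
        using inc_edge[of ori e v u, OF u(1,2)] by blast
      moreover have "of_bool (fst (ori e) = v') + of_bool (snd (ori e) = v') = (of_bool (v = v') + of_bool (u = v') :: nat)" for v'
        using e by (auto simp: u_def N_def)
      ultimately show ?thesis using u by (intro exI[of _ u] exI[of _ \<sigma>]) simp
    qed
    consider (leaf) v e where "v \<in> V" "N v = {e}"
      | (series) v e f where "v \<in> V" "N v = {e, f}" "e \<noteq> f"
      | (empty) "E = {}"
      | (cubic) "E \<noteq> {}" "\<And>v. v \<in> V \<Longrightarrow> card (N v) = 0 \<or> 3 \<le> card (N v)"
    proof -
      have "card (N v) = 0 \<or> 3 \<le> card (N v) \<or> card (N v) = 1 \<or> card (N v) = 2" for v by linarith
      then show ?thesis using that by (metis card_1_singletonE card_2_iff)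
    qed
    then show ?thesis
    proof cases
      case leaf
      have eE: "e \<in> E" and eN: "e \<in> N v" using leaf(2) by (auto simp: N_def)
      obtain u \<sigma> where \<sigma>: "u \<noteq> v" "\<sigma> = 1 \<or> \<sigma> = -1" "\<forall>v'. inc ori e v' = \<sigma> * (of_bool (v' = v) - of_bool (v' = u))"
        using N_inc[OF eN] by blast
      have "c e = 0" if c: "c \<in> H1_real V E ori" for c
      proof -
        have "0 = boundary E ori c v" using c leaf(1) by (simp add: H1_real_def)
        also have "\<dots> = (\<Sum>e'\<in>{e}. c e' * inc ori e' v)"
          unfolding boundary_inc using fE eE inc_N leaf(2)
          by (intro sum.mono_neutral_right) auto
        finally show ?thesis using \<sigma> by auto
      qed
      then show ?thesis using separated_basis_bridge[OF fE _ remove[OF eE]] by blast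
    next
      case series
      have eE: "e \<in> E" "f \<in> E" and eN: "e \<in> N v" "f \<in> N v" using series(2) by (auto simp: N_def)
      obtain u \<sigma> where \<sigma>: "u \<noteq> v" "u \<in> V" "\<sigma> = 1 \<or> \<sigma> = -1"
        and ince: "\<And>v'. inc ori e v' = \<sigma> * (of_bool (v' = v) - of_bool (v' = u))"
        and dege: "\<And>v'. of_bool (fst (ori e) = v') + of_bool (snd (ori e) = v') = (of_bool (v = v') + of_bool (u = v') :: nat)"
        using N_inc[OF eN(1)] by blast
      obtain y \<tau> where \<tau>: "y \<noteq> v" "y \<in> V" "\<tau> = 1 \<or> \<tau> = -1"
        and incf: "\<And>v'. inc ori f v' = \<tau> * (of_bool (v' = v) - of_bool (v' = y))"
        and degf: "\<And>v'. of_bool (fst (ori f) = v') + of_bool (snd (ori f) = v') = (of_bool (v = v') + of_bool (y = v') :: nat)"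
        using N_inc[OF eN(2)] by blast
      \<comment> \<open>The edge \<open>f\<close> from \<open>v\<close> to \<open>y\<close> is contracted into \<open>e\<close>, which now joins \<open>u\<close> and \<open>y\<close>.\<close>
      define ori' where "ori' = ori(e := if \<sigma> = 1 then (u, y) else (y, u))"
      define \<epsilon> where "\<epsilon> = - \<sigma> * \<tau>"
      have \<epsilon>: "\<epsilon> = 1 \<or> \<epsilon> = -1" "\<epsilon> * \<tau> = - \<sigma>" using \<sigma>(3) \<tau>(3) by (auto simp: \<epsilon>_def)
      have ori'_same: "ori' e' = ori e'" if "e' \<noteq> e" for e' using that by (simp add: ori'_def)
      have inc'e: "inc ori' e v' = \<sigma> * (of_bool (v' = y) - of_bool (v' = u))" for v'
        using \<sigma>(3) by (auto simp: ori'_def inc_def)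
      have inc_eq: "inc ori e v' - inc ori' e v' + \<epsilon> * inc ori f v' = 0" for v'
        unfolding ince inc'e incf using \<epsilon>(2) by (simp add: algebra_simps flip: mult.assoc)
      have cyc: "c f = \<epsilon> * c e" if c: "c \<in> H1_real V E ori" for c
      proof -
        have "0 = boundary E ori c v" using c series(1) by (simp add: H1_real_def)
        also have "\<dots> = (\<Sum>e'\<in>{e, f}. c e' * inc ori e' v)"
          unfolding boundary_inc using fE eE inc_N series(2)
          by (intro sum.mono_neutral_right) auto
        also have "\<dots> = c e * \<sigma> + c f * \<tau>"
          using series(3) \<sigma>(1) \<tau>(1) by (simp add: ince incf)
        finally show ?thesis using \<sigma>(3) \<tau>(3) by (auto simp: \<epsilon>_def)
      qed
      have sep: "separated_basis V (E - {f}) ori' (w(e := w e + w f)) ?\<kappa>"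
      proof (rule less.hyps)
        show "card (E - {f}) < card E" using fE eE(2) by (rule card_Diff1_less)
        show "endpoints_in V (E - {f}) ori'"
          using fE fV ends \<sigma>(2) \<tau>(2) by (auto simp: endpoints_in_def ori'_def)
        show "0 \<le> (w(e := w e + w f)) e'" if "e' \<in> E - {f}" for e' using that w eE by simp
        have "valence (E - {f}) ori' v' \<le> valence E ori v'" for v'
        proof -
          let ?d = "\<lambda>ori e. of_bool (fst (ori e) = v') + of_bool (snd (ori e) = v') :: nat"
          have "valence (E - {f}) ori' v' = ?d ori' e + (\<Sum>e'\<in>E - {f} - {e}. ?d ori' e')"
            unfolding valence_def using fE eE series(3) by (intro sum.remove) simp_all
          also have "(\<Sum>e'\<in>E - {f} - {e}. ?d ori' e') = (\<Sum>e'\<in>E - {f} - {e}. ?d ori e')"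
            by (intro sum.cong) (simp_all add: ori'_same)
          also have "?d ori' e \<le> ?d ori e + ?d ori f"
            unfolding dege degf by (simp add: ori'_def)
          also have "?d ori e + ?d ori f + (\<Sum>e'\<in>E - {f} - {e}. ?d ori e') = ?d ori f + (\<Sum>e'\<in>E - {f}. ?d ori e')"
            using fE eE series(3) by (subst sum.remove[of "E - {f}" e]) simp_all
          also have "\<dots> = valence E ori v'"
            unfolding valence_def using fE eE by (intro sum.remove[symmetric])
          finally show ?thesis by simp
        qed
        then show "excess V (E - {f}) ori' < 2 ^ L"
          using ex by (meson excess_mono le_less_trans)
        fix c assume c: "c \<in> H1_int V (E - {f}) ori'" "c \<noteq> (\<lambda>_. 0)"
        let ?c = "c(f := \<epsilon> * c e)"
        have "?c \<in> H1_real V E ori"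
          by (rule merge_cycle[OF fE eE series(3) inc_eq ori'_same H1_int_real[OF c(1)]])
        then have "?c \<in> H1_int V E ori" using c(1) \<epsilon>(1) by (auto simp: H1_int_iff)
        moreover have "?c \<noteq> (\<lambda>_. 0)"
        proof
          assume z: "?c = (\<lambda>_. 0)"
          have "c e' = 0" for e'
          proof (cases "e' = f")
            case True
            then show ?thesis using H1_outside[OF H1_int_real[OF c(1)]] by simp
          next
            case False
            then show ?thesis using fun_cong[OF z, of e'] by simp
          qed
          then show False using c(2) by blast
        qed
        ultimately have "s \<le> weight_form E w ?c ?c" by (rule sys)
        then show "s \<le> weight_form (E - {f}) (w(e := w e + w f)) c c"
          using merge_weight_form[OF fE eE series(3) \<epsilon>(1)] by metis
      qed
      show ?thesis
        by (rule separated_basis_merge[where w = w and e = e and f = f and ori = ori,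
              OF fE eE series(3) \<epsilon>(1) inc_eq _ _ sep]) (rule ori'_same cyc, assumption)+
    next
      case empty
      have "H1_real V E ori \<subseteq> {\<lambda>_. 0}"
        unfolding H1_real_def chains_def empty by blast
      moreover from this have "H1_int V E ori \<subseteq> {\<lambda>_. 0}" using H1_int_real by blast
      moreover have "range (lincomb 0 v) = {\<lambda>_. 0}" "int_comb 0 v = {\<lambda>_. 0}" for v :: "nat \<Rightarrow> 'a set \<Rightarrow> real"
        by (simp_all add: int_comb_def)
      ultimately show ?thesis unfolding separated_basis_def
        by (intro exI[of _ 0] exI[of _ "\<lambda>_ _. 0"]) simp
    next
      case cubic
      have "valence E ori v = 0 \<or> 3 \<le> valence E ori v" if "v \<in> V" for v using cubic(2)[OF that] deg_N by simp
      then obtain c where c: "c \<in> H1_int V E ori" "c \<noteq> (\<lambda>_. 0)" "sqnorm E c \<le> 4 * real L"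
        using short_cycle[OF fin _ cubic(1) ex] by blast
      have "Max (w ` E) \<in> w ` E" using fE cubic(1) by (intro Max_in) auto
      then obtain e where e: "e \<in> E" "w e = Max (w ` E)" by (metis imageE)
      then have max: "w e' \<le> w e" if "e' \<in> E" for e' using that fE by simp
      have "s \<le> weight_form E w c c" by (rule sys[OF c(1,2)])
      also have "\<dots> \<le> w e * sqnorm E c" by (rule weight_form_le_max[OF fE max])
      also have "\<dots> \<le> w e * (4 * real L)" using c(3) w[OF e(1)] by (rule mult_left_mono)
      finally have "?\<kappa> \<le> w e" using L by (simp add: field_simps)
      then show ?thesis by (rule heavy[OF e(1)])
    qed
  qed
qed

lemma graph_excess:
  assumes G: "graph V E" and ori: "orientation E ori"
  shows "endpoints_in V E ori" and "int (excess V E ori) = 2 * (betti1 V E - 1)"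
proof -
  obtain x f where "ordered_tree V E ori (card V) x f" using graph_ordered_tree[OF G ori] .
  then interpret ordered_tree V E ori "card V" x f .
  have fV: "finite V" and deg2: "\<And>v. v \<in> V \<Longrightarrow> 2 \<le> card {e \<in> E. v \<in> e}"
    using G by (auto simp: graph_def)
  show "endpoints_in V E ori" using fin_E fV ori_ends by (simp add: endpoints_in_def)
  have valence: "valence E ori v = card {e \<in> E. v \<in> e}" for v
  proof -
    have "of_bool (fst (ori e) = v) + of_bool (snd (ori e) = v) = (of_bool (v \<in> e) :: nat)" if "e \<in> E" for e
    proof -
      have "v \<in> e \<longleftrightarrow> v \<in> {fst (ori e), snd (ori e)}" unfolding endpoints[OF that] ..
      then show ?thesis using ends_distinct[OF that] by auto
    qed
    then have "valence E ori v = (\<Sum>e\<in>E. of_bool (v \<in> e))" unfolding valence_def by (intro sum.cong) auto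
    then show ?thesis using fin_E by (simp add: of_bool_def sum.If_cases Int_def)
  qed
  have "(\<Sum>v\<in>V. valence E ori v) = (\<Sum>e\<in>E. \<Sum>v\<in>V. of_bool (fst (ori e) = v) + of_bool (snd (ori e) = v))"
    unfolding valence_def by (rule sum.swap)
  also have "\<dots> = (\<Sum>e\<in>E. 2)"
    using fV ori_ends by (intro sum.cong) (simp_all add: sum.distrib of_bool_def)
  finally have total: "(\<Sum>v\<in>V. valence E ori v) = 2 * card E" by simp
  have "excess V E ori + (\<Sum>v\<in>V. 2) = (\<Sum>v\<in>V. valence E ori v)"
    unfolding excess_def sum.distrib[symmetric]
    by (intro sum.cong refl le_add_diff_inverse2) (simp only: valence deg2)
  then have "int (excess V E ori) + 2 * int (card V) = 2 * int (card E)" using total by simp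
  then show "int (excess V E ori) = 2 * (betti1 V E - 1)" by (simp add: betti1_def)
qed

lemma (in ordered_tree) gram_schmidt_fund_cycle:
  assumes pos: "\<And>c. c \<in> H1_real V E ori \<Longrightarrow> c \<noteq> (\<lambda>_. 0) \<Longrightarrow> 0 < weight_form E w c c"
  shows "\<exists>u a. symmetric_form.gram_schmidt (weight_form E w) b fund_cycle u a"
proof -
  interpret symmetric_form "weight_form E w" by (rule symmetric_form_weight_form)
  show ?thesis
  proof (rule gram_schmidt_exists)
    fix i t assume i: "i < b"
    let ?c = "\<lambda>e. fund_cycle i e + lincomb i fund_cycle t e"
    have "lincomb i fund_cycle t (chord i) = 0"
      unfolding lincomb_def using i fund_cycle_chord by (intro sum.neutral) auto
    then have "?c (chord i) \<noteq> 0" using fund_cycle_chord[OF i i] by simp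
    then have "?c \<noteq> (\<lambda>_. 0)" by metis
    moreover have "?c \<in> H1_real V E ori" by (rule coset_cycle[OF fund_cycle_H1 i])
    ultimately show "0 < weight_form E w ?c ?c" by (intro pos)
  qed
qed

text \<open>With \<open>s\<close> the squared length of the shortest cycle, the determinant is at least \<open>(s / (4 L)) ^ b\<close>.\<close>

theorem jacobian_hermite_le:
  assumes wg: "weighted_graph V E w" and betti: "betti1 V E = int b" and b: "1 \<le> b"
    and ori: "orientation E ori" and L: "1 \<le> L" "2 * b \<le> 2 ^ L"
  shows "jacobian_hermite b V E w ori \<le> 4 * real L"
proof -
  let ?B = "weight_form E w"
  have G: "graph V E" and w: "\<And>e. e \<in> E \<Longrightarrow> 0 \<le> w e"
    and pos: "\<And>c. c \<in> H1_real V E ori \<Longrightarrow> c \<noteq> (\<lambda>_. 0) \<Longrightarrow> 0 < ?B c c"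
    using wg ori by (auto simp: weighted_graph_def)
  obtain x f where "ordered_tree V E ori (card V) x f" using graph_ordered_tree[OF G ori] .
  then interpret T: ordered_tree V E ori "card V" x f .
  interpret symmetric_form ?B by (rule symmetric_form_weight_form)
  have bT: "T.b = b" using betti T.betti1_eq by simp
  obtain u a where gs: "gram_schmidt b T.fund_cycle u a" using T.gram_schmidt_fund_cycle[OF pos] bT by auto
  have H: "H1_real V E ori = range (lincomb b T.fund_cycle)" "H1_int V E ori = int_comb b T.fund_cycle"
    using T.H1_real_eq T.H1_int_eq bT by simp_all
  define s where "s = lattice_norm ?B (H1_int V E ori)"
  obtain l where l: "l \<in> H1_int V E ori" "l \<noteq> (\<lambda>_. 0)" "s = ?B l l"
    using lattice_norm_attained(1)[OF gs b] unfolding H s_def by blast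
  have s: "0 < s" unfolding l(3) by (rule pos[OF H1_int_real[OF l(1)] l(2)])
  have min: "s \<le> ?B c c" if "c \<in> H1_int V E ori" "c \<noteq> (\<lambda>_. 0)" for c
    using lattice_norm_attained(2)[OF gs b] that unfolding H s_def by blast
  define \<kappa> where "\<kappa> = s / (4 * real L)"
  have \<kappa>: "0 < \<kappa>" using s L by (simp add: \<kappa>_def)
  have "excess V E ori < 2 * b"
  proof -
    have "int (excess V E ori) = 2 * (int b - 1)" using graph_excess(2)[OF G ori] betti by simp
    then have "int (excess V E ori) < int (2 * b)" by simp
    then show ?thesis by (simp only: of_nat_less_iff)
  qed
  then have "excess V E ori < 2 ^ L" using L(2) by linarith
  from separated_basis_exists[OF graph_excess(1)[OF G ori] w this L(1) s min]
  have "separated_basis V E ori w \<kappa>" by (simp add: \<kappa>_def)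
  then obtain r v where v: "\<And>i. i < r \<Longrightarrow> v i \<in> H1_int V E ori"
    "H1_real V E ori \<subseteq> range (lincomb r v)" "H1_int V E ori \<subseteq> int_comb r v"
    "\<And>i t. i < r \<Longrightarrow> \<kappa> \<le> ?B (coset_vec v i t) (coset_vec v i t)"
    unfolding separated_basis_def by blast
  have real: "range (lincomb r v) = H1_real V E ori"
  proof (intro equalityI v(2) subsetI)
    fix c assume "c \<in> range (lincomb r v)"
    then obtain t where c: "c = lincomb r v t" by (rule rangeE)
    show "c \<in> H1_real V E ori" unfolding c by (intro H1_real_lincomb H1_int_real v(1))
  qed
  have int: "int_comb r v = H1_int V E ori"
  proof (intro equalityI v(3) subsetI)
    fix c assume "c \<in> int_comb r v"
    then obtain t where c: "c = lincomb r v t" "\<forall>i<r. t i \<in> \<int>" unfolding int_comb_def by blast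
    show "c \<in> H1_int V E ori" unfolding c(1) using c(2) by (intro H1_int_lincomb v(1)) auto
  qed
  have "\<exists>u a. gram_schmidt r v u a"
    by (rule gram_schmidt_exists) (use v(4) \<kappa> less_le_trans in blast)
  then obtain u' a' where gs': "gram_schmidt r v u' a'" by blast
  have "r = b"
  proof (rule orthonormal_basis_size)
    show "orthonormal r u'" "orthonormal b u" using gs gs' by (auto simp: gram_schmidt_def)
    show "range (lincomb r u') = range (lincomb b u)"
      unfolding gram_schmidt_range[OF gs] gram_schmidt_range[OF gs'] real H ..
  qed
  define d where "d = lattice_det b (H1_real V E ori) ?B (H1_int V E ori)"
  have "d = (\<Prod>i<b. (a' i i)\<^sup>2)"
    using lattice_det_gram_schmidt[OF gs'] unfolding d_def real[symmetric] int[symmetric] \<open>r = b\<close> .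
  moreover have "\<kappa> \<le> (a' i i)\<^sup>2" if "i < b" for i
    using gram_schmidt_coset_attained[OF gs', of i] v(4)[of i] that \<open>r = b\<close> by metis
  then have "(\<Prod>i<b. \<kappa>) \<le> (\<Prod>i<b. (a' i i)\<^sup>2)"
    using \<kappa> by (intro prod_mono) auto
  ultimately have d: "\<kappa> ^ b \<le> d" by simp
  have "\<kappa> = (\<kappa> ^ b) powr (1 / real b)"
    using \<kappa> b by (simp add: powr_realpow[symmetric] powr_powr)
  also have "\<dots> \<le> d powr (1 / real b)" using d \<kappa> by (intro powr_mono2) auto
  finally have "\<kappa> \<le> d powr (1 / real b)" .
  then have "s / d powr (1 / real b) \<le> s / \<kappa>"     using s \<kappa> by (intro frac_le) auto
  also have "s / \<kappa> = 4 * real L" using s L by (simp add: \<kappa>_def)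
  finally show ?thesis
    by (simp add: jacobian_hermite_def hermite_invariant_def s_def d_def)
qed

section \<open>Graphs of large girth\<close>

text \<open>Girth is measured by the supports of real cycles, which is what the Hermite invariant needs.\<close>

definition girth_at_least :: "nat \<Rightarrow> 'a set \<Rightarrow> 'a set set \<Rightarrow> bool" where
  "girth_at_least g V E \<longleftrightarrow> (\<forall>ori. orientation E ori \<longrightarrow>
     (\<forall>c\<in>H1_real V E ori. c \<noteq> (\<lambda>_. 0) \<longrightarrow> g \<le> card {e \<in> E. c e \<noteq> 0}))"

primrec graph_ball :: "'a set set \<Rightarrow> 'a \<Rightarrow> nat \<Rightarrow> 'a set" where
  "graph_ball E u 0 = {u}"
| "graph_ball E u (Suc k) = graph_ball E u k \<union> {y. \<exists>x\<in>graph_ball E u k. {x, y} \<in> E}"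

lemma graph_ball_mono: "j \<le> k \<Longrightarrow> graph_ball E u j \<subseteq> graph_ball E u k"
  by (rule lift_Suc_mono_le[of "graph_ball E u"]) auto

lemma graph_ball_subset:
  assumes "\<And>e. e \<in> E \<Longrightarrow> e \<subseteq> V" "u \<in> V" shows "graph_ball E u k \<subseteq> V"
proof (induction k)
  case (Suc k)
  have "y \<in> V" if "{x, y} \<in> E" for x y using assms(1)[OF that] by blast
  then show ?case using Suc by auto
qed (use assms in simp)

lemma graph_ball_edge: "{x, y} \<in> E \<Longrightarrow> x \<in> graph_ball E u k \<Longrightarrow> y \<in> graph_ball E u (Suc k)"
  by auto

text \<open>A cycle through the new edge carries a flow between its ends \<open>u\<close> and \<open>v\<close>, which has to leave each of the
  balls of radius \<open>0, \<dots>, g - 2\<close> around \<open>u\<close> in the old graph. No edge leaves two of these balls, so at least \<open>g - 1\<close> old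
  edges are in the support.\<close>

lemma girth_insert:
  assumes fV: "finite V" and fE: "finite E" and ends: "\<And>e. e \<in> E \<Longrightarrow> e \<subseteq> V"
    and g: "girth_at_least g V E" "2 \<le> g" and uv: "u \<in> V" "v \<in> V" "{u, v} \<notin> E"
    and far: "v \<notin> graph_ball E u (g - 2)"
  shows "girth_at_least g V (insert {u, v} E)"
  unfolding girth_at_least_def
proof (intro allI impI ballI)
  fix ori c assume ori: "orientation (insert {u, v} E) ori"
    and c: "c \<in> H1_real V (insert {u, v} E) ori" "c \<noteq> (\<lambda>_. 0)"
  let ?e = "{u, v}"
  have oriE: "orientation E ori" using ori by (simp add: orientation_def)
  have endp: "{fst (ori e), snd (ori e)} = e" if "e \<in> insert ?e E" for e
    by (rule sym[OF bspec[OF ori[unfolded orientation_def] that]])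
  show "g \<le> card {e \<in> insert ?e E. c e \<noteq> 0}"
  proof (cases "c ?e = 0")
    case True
    have "insert ?e E - {?e} = E" using uv(3) by blast
    then have "c \<in> H1_real V E ori"
      using H1_real_remove[OF _ c(1) True] fE by simp
    then have "g \<le> card {e \<in> E. c e \<noteq> 0}" using g(1) oriE c(2) by (simp add: girth_at_least_def)
    also have "\<dots> \<le> card {e \<in> insert ?e E. c e \<noteq> 0}" using fE by (intro card_mono) auto
    finally show ?thesis .
  next
    case False
    have cross: "\<exists>e\<in>E. c e \<noteq> 0 \<and> (fst (ori e) \<in> graph_ball E u k) \<noteq> (snd (ori e) \<in> graph_ball E u k)" if k: "k \<le> g - 2" for k
    proof (rule ccontr)
      let ?S = "graph_ball E u k"
      assume no: "\<not> ?thesis"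
      have SV: "?S \<subseteq> V" using ends uv(1) by (rule graph_ball_subset)
      then have fS: "finite ?S" using fV finite_subset by blast
      have uS: "u \<in> ?S" using graph_ball_mono[of 0 k E u] by simp
      have vS: "v \<notin> ?S" using far graph_ball_mono[OF k, of E u] by blast
      have "0 = (\<Sum>x\<in>?S. boundary (insert ?e E) ori c x)"
        using c(1) SV by (intro sum.neutral[symmetric]) (auto simp: H1_real_def)
      also have "\<dots> = (\<Sum>e\<in>insert ?e E. c e * (of_bool (snd (ori e) \<in> ?S) - of_bool (fst (ori e) \<in> ?S)))"
        by (rule sum_boundary[OF fS])
      also have "\<dots> = c ?e * (of_bool (snd (ori ?e) \<in> ?S) - of_bool (fst (ori ?e) \<in> ?S)) +
          (\<Sum>e\<in>E. c e * (of_bool (snd (ori e) \<in> ?S) - of_bool (fst (ori e) \<in> ?S)))"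
        using fE uv(3) by (rule sum.insert)
      also have "(\<Sum>e\<in>E. c e * (of_bool (snd (ori e) \<in> ?S) - of_bool (fst (ori e) \<in> ?S))) = 0"
        using no by (intro sum.neutral) auto
      finally have "(of_bool (snd (ori ?e) \<in> ?S) :: real) = of_bool (fst (ori ?e) \<in> ?S)"
        using False by simp
      then have "snd (ori ?e) \<in> ?S \<longleftrightarrow> fst (ori ?e) \<in> ?S" by (simp add: of_bool_eq_iff)
      moreover have "{fst (ori ?e), snd (ori ?e)} = {u, v}" using endp[of ?e] by simp
      ultimately show False using uS vS by (auto simp: doubleton_eq_iff)
    qed
    \<comment> \<open>\<open>\<phi> k\<close> is an edge of the support that leaves the ball of radius \<open>k\<close>.\<close>
    then obtain \<phi> where \<phi>: "\<And>k. k \<le> g - 2 \<Longrightarrow> \<phi> k \<in> E \<and> c (\<phi> k) \<noteq> 0 \<and>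
        (fst (ori (\<phi> k)) \<in> graph_ball E u k) \<noteq> (snd (ori (\<phi> k)) \<in> graph_ball E u k)" by metis
    have inside: "fst (ori (\<phi> j)) \<in> graph_ball E u k \<and> snd (ori (\<phi> j)) \<in> graph_ball E u k" if "j < k" "j \<le> g - 2" for j k
    proof -
      have e: "{fst (ori (\<phi> j)), snd (ori (\<phi> j))} \<in> E" "{snd (ori (\<phi> j)), fst (ori (\<phi> j))} \<in> E"
        using \<phi>[OF that(2)] endp[of "\<phi> j"] by (simp_all add: insert_commute)
      have "fst (ori (\<phi> j)) \<in> graph_ball E u (Suc j) \<and> snd (ori (\<phi> j)) \<in> graph_ball E u (Suc j)"
        using \<phi>[OF that(2)] graph_ball_edge[OF e(1), of u j] graph_ball_edge[OF e(2), of u j]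
          graph_ball_mono[OF le_SucI[OF order_refl], of E u j] by blast
      then show ?thesis using graph_ball_mono[of "Suc j" k E u] that(1) by auto
    qed
    have "inj_on \<phi> {..g - 2}"
    proof (rule linorder_inj_onI')
      fix j k assume "j \<in> {..g - 2}" "k \<in> {..g - 2}" "j < k"
      then show "\<phi> j \<noteq> \<phi> k" using inside[of j k] \<phi>[of k] by auto
    qed
    then have "g - 1 = card (\<phi> ` {..g - 2})" using g(2) by (simp add: card_image)
    also have "\<dots> \<le> card {e \<in> E. c e \<noteq> 0}"
      using \<phi> fE by (intro card_mono) auto
    finally have "g \<le> card (insert ?e {e \<in> E. c e \<noteq> 0})" using fE uv(3) by simp
    also have "\<dots> \<le> card {e \<in> insert ?e E. c e \<noteq> 0}"
      using False fE by (intro card_mono) auto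
    finally show ?thesis .
  qed
qed

text \<open>Each vertex of a sphere has a neighbour in the smaller ball, hence at most two neighbours in the next sphere.\<close>

lemma card_graph_ball:
  assumes fV: "finite V" and ends: "\<And>e. e \<in> E \<Longrightarrow> e \<subseteq> V" and u: "u \<in> V"
    and valence: "\<And>v. card {y. {v, y} \<in> E} \<le> 3"
  shows "card (graph_ball E u k) \<le> 3 * 2 ^ k"
proof -
  have sub: "graph_ball E u k \<subseteq> V" for k using ends u by (rule graph_ball_subset)
  have fin: "finite (graph_ball E u k)" for k using sub fV finite_subset by blast
  have nb: "finite {y. {x, y} \<in> E}" for x
  proof (rule finite_subset[OF _ fV])
    show "{y. {x, y} \<in> E} \<subseteq> V" using ends by blast
  qed
  define s where "s k = graph_ball E u (Suc k) - graph_ball E u k" for k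
  have s: "card (s k) \<le> 3 * 2 ^ k" for k
  proof (induction k)
    case 0
    have "s 0 \<subseteq> {y. {u, y} \<in> E}" by (auto simp: s_def)
    then have "card (s 0) \<le> card {y. {u, y} \<in> E}" by (intro card_mono nb)
    then show ?case using valence[of u] by simp
  next
    case (Suc k)
    have "s (Suc k) \<subseteq> (\<Union>x\<in>s k. {y. {x, y} \<in> E} - graph_ball E u k)"
    proof
      fix y assume y: "y \<in> s (Suc k)"
      then obtain x where x: "x \<in> graph_ball E u (Suc k)" "{x, y} \<in> E"
        by (auto simp: s_def simp del: graph_ball.simps) (auto simp: graph_ball.simps(2)[of E u "Suc k"] simp del: graph_ball.simps)
      have yk: "y \<notin> graph_ball E u (Suc k)" using y by (simp add: s_def del: graph_ball.simps)
      have "x \<notin> graph_ball E u k" using graph_ball_edge[OF x(2)] yk by blast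
      then have "x \<in> s k" using x(1) by (simp add: s_def del: graph_ball.simps)
      moreover have "y \<notin> graph_ball E u k" using yk graph_ball_mono[of k "Suc k" E u] by (meson le_SucI order_refl subsetD)
      ultimately show "y \<in> (\<Union>x\<in>s k. {y. {x, y} \<in> E} - graph_ball E u k)" using x(2) by blast
    qed
    then have "card (s (Suc k)) \<le> card (\<Union>x\<in>s k. {y. {x, y} \<in> E} - graph_ball E u k)"
      using fin nb by (intro card_mono finite_UN_I) (auto simp: s_def simp del: graph_ball.simps)
    also have "\<dots> \<le> (\<Sum>x\<in>s k. card ({y. {x, y} \<in> E} - graph_ball E u k))"
      using fin by (intro card_UN_le) (simp add: s_def del: graph_ball.simps)
    also have "\<dots> \<le> (\<Sum>x\<in>s k. 2)"
    proof (rule sum_mono)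
      fix x assume x: "x \<in> s k"
      then obtain p where p: "p \<in> graph_ball E u k" "{p, x} \<in> E" by (auto simp: s_def)
      have "{y. {x, y} \<in> E} - graph_ball E u k \<subseteq> {y. {x, y} \<in> E} - {p}" using p by blast
      then have "card ({y. {x, y} \<in> E} - graph_ball E u k) \<le> card ({y. {x, y} \<in> E} - {p})"
        using nb by (intro card_mono) auto
      also have "\<dots> = card {y. {x, y} \<in> E} - 1"
        using p(2) nb by (simp add: insert_commute)
      finally show "card ({y. {x, y} \<in> E} - graph_ball E u k) \<le> 2" using valence[of x] by simp
    qed
    finally show ?case using Suc by simp
  qed
  have "card (graph_ball E u k) + 2 \<le> 3 * 2 ^ k" for k
  proof (induction k)
    case (Suc k)
    have "graph_ball E u (Suc k) = graph_ball E u k \<union> s k" by (auto simp: s_def)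
    then have "card (graph_ball E u (Suc k)) \<le> card (graph_ball E u k) + card (s k)" by (metis card_Un_le)
    then show ?case using Suc s[of k] by simp
  qed simp
  then show ?thesis using add_leD1 by blast
qed

definition path_edges :: "nat \<Rightarrow> nat set set" where
  "path_edges n = (\<lambda>k. {k, k - 1}) ` {1..<n}"

lemma path_edges_ordered_tree:
  assumes "1 \<le> n" "orientation (path_edges n) ori"
  shows "ordered_tree {..<n} (path_edges n) ori n (\<lambda>k. k) (\<lambda>k. {k, k - 1})"
proof
  show "\<And>e. e \<in> path_edges n \<Longrightarrow> e \<subseteq> {..<n} \<and> card e = 2"
    by (auto simp: path_edges_def)
  show "\<And>k. 1 \<le> k \<Longrightarrow> k < n \<Longrightarrow> {k, k - 1} \<in> path_edges n \<and> (\<exists>j<k. {k, k - 1} = {k, j})"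
    by (auto simp: path_edges_def intro!: exI[of _ "_ - 1"])
qed (use assms in \<open>auto simp: path_edges_def bij_betw_def\<close>)

lemma path_girth: assumes "1 \<le> n" shows "girth_at_least g {..<n} (path_edges n)"
  unfolding girth_at_least_def
proof (intro allI impI ballI)
  fix ori c assume ori: "orientation (path_edges n) ori"
    and c: "c \<in> H1_real {..<n} (path_edges n) ori" "c \<noteq> (\<lambda>_. 0)"
  interpret ordered_tree "{..<n}" "path_edges n" ori n "\<lambda>k. k" "\<lambda>k. {k, k - 1}"
    by (rule path_edges_ordered_tree[OF assms ori])
  have "T = path_edges n" unfolding T_def path_edges_def ..
  then have "c = (\<lambda>_. 0)" using tree_acyclic[OF c(1)] H1_outside[OF c(1)] by simp
  then show "g \<le> card {e \<in> path_edges n. c e \<noteq> 0}" using c(2) by simp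
qed

lemma finite_path_edges: "finite (path_edges n)"
  by (simp add: path_edges_def)

lemma card_path_edges: "card (path_edges n) = n - 1"
proof -
  have "inj_on (\<lambda>k::nat. {k, k - 1}) {1..<n}"
  proof (rule inj_onI)
    fix i j :: nat assume "i \<in> {1..<n}" "j \<in> {1..<n}" "{i, i - 1} = {j, j - 1}"
    then show "i = j" by (auto simp: doubleton_eq_iff)
  qed
  then show ?thesis unfolding path_edges_def by (simp add: card_image)
qed

lemma path_degree: "card {e \<in> path_edges n. v \<in> e} \<le> 2"
proof -
  have "{e \<in> path_edges n. v \<in> e} \<subseteq> {{v, v - 1}, {v + 1, v}}"
  proof
    fix e assume "e \<in> {e \<in> path_edges n. v \<in> e}"
    then obtain k where k: "e = {k, k - 1}" "1 \<le> k" "v = k \<or> v = k - 1" by (auto simp: path_edges_def)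
    from k(3) show "e \<in> {{v, v - 1}, {v + 1, v}}"
    proof
      assume "v = k - 1"
      then have "k = v + 1" using k(2) by simp
      then show ?thesis using k(1) by simp
    qed (simp add: k(1))
  qed
  then have "card {e \<in> path_edges n. v \<in> e} \<le> card {{v, v - 1}, {v + 1, v}}"
    by (intro card_mono) simp_all
  also have "\<dots> \<le> 2" by (simp add: card_insert_if)
  finally show ?thesis .
qed

lemma degree_insert:
  assumes "finite E"
  shows "card {e \<in> insert e0 E. v \<in> e} \<le> card {e \<in> E. v \<in> e} + of_bool (v \<in> e0)"
proof (cases "v \<in> e0")
  case True
  have "{e \<in> insert e0 E. v \<in> e} \<subseteq> insert e0 {e \<in> E. v \<in> e}" by blast
  then have "card {e \<in> insert e0 E. v \<in> e} \<le> card (insert e0 {e \<in> E. v \<in> e})"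
    using assms by (intro card_mono) simp_all
  also have "\<dots> \<le> card {e \<in> E. v \<in> e} + 1" using assms by (simp add: card_insert_if)
  finally show ?thesis using True by simp
next
  case False
  then have "{e \<in> insert e0 E. v \<in> e} = {e \<in> E. v \<in> e}" by blast
  then show ?thesis by simp
qed

lemma graph_ball_path: "graph_ball (path_edges n) 0 k \<subseteq> {..k}"
proof (induction k)
  case (Suc k)
  have "y \<le> Suc x" if "{x, y} \<in> path_edges n" for x y
    using that by (auto simp: path_edges_def doubleton_eq_iff)
  then show ?case using Suc by fastforce
qed simp

text \<open>Start with a Hamiltonian cycle and add chords with pairwise disjoint ends, which keeps all degrees at most 3.
  As long as \<open>j < b\<close> chords are present, the \<open>2 j\<close> vertices already used and a ball of radius \<open>g - 2\<close> do not exhaust the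
  vertices, and a chord to a remaining vertex does not create a short cycle. The closing edge of the cycle counts as
  the first chord.\<close>

lemma high_girth_edges:
  assumes g: "3 \<le> g" and n: "2 * b + 3 * 2 ^ g \<le> n" and b: "1 \<le> b"
  shows "\<exists>E. finite E \<and> (\<forall>e\<in>E. e \<subseteq> {..<n} \<and> card e = 2) \<and> path_edges n \<subseteq> E \<and> {0, n - 1} \<in> E \<and>
    card E = n - 1 + b \<and> girth_at_least g {..<n} E \<and> (\<forall>v. card {e \<in> E. v \<in> e} \<le> 3)"
proof -
  have gn: "g < n" "3 \<le> n" using n less_exp[of g] g by linarith+
  have "\<exists>E X. finite E \<and> (\<forall>e\<in>E. e \<subseteq> {..<n} \<and> card e = 2) \<and> path_edges n \<subseteq> E \<and> {0, n - 1} \<in> E \<and>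
    card E = n - 1 + j \<and> girth_at_least g {..<n} E \<and> finite X \<and> card X \<le> 2 * j \<and>
    (\<forall>v. card {e \<in> E. v \<in> e} \<le> 2 + of_bool (v \<in> X))" if "1 \<le> j" "j \<le> b" for j
    using that
  proof (induction j rule: dec_induct)
    case base
    let ?e = "{0, n - 1}" and ?P = "path_edges n"
    have new: "?e \<notin> ?P" using gn by (auto simp: path_edges_def doubleton_eq_iff)
    have ends: "\<And>e. e \<in> ?P \<Longrightarrow> e \<subseteq> {..<n} \<and> card e = 2" by (auto simp: path_edges_def)
    have "n - 1 \<notin> graph_ball ?P 0 (g - 2)" using graph_ball_path[of n "g - 2"] gn g by auto
    then have girth: "girth_at_least g {..<n} (insert ?e ?P)"
      using gn g ends new by (intro girth_insert finite_path_edges path_girth) auto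
    have "card {e \<in> insert ?e ?P. v \<in> e} \<le> 2 + of_bool (v \<in> ?e)" for v
      using degree_insert[OF finite_path_edges, of ?e n v] path_degree[of n v] by linarith
    moreover have "card ?e \<le> 2 * 1" by (simp add: card_insert_if)
    moreover have "card (insert ?e ?P) = n - 1 + 1" using new by (simp add: finite_path_edges card_path_edges)
    moreover have "\<forall>e\<in>insert ?e ?P. e \<subseteq> {..<n} \<and> card e = 2" using ends gn by auto
    moreover have "finite (insert ?e ?P)" "finite ?e" "?P \<subseteq> insert ?e ?P" "?e \<in> insert ?e ?P"
      using finite_path_edges by blast+
    ultimately show ?case using girth
      by (intro exI[of _ "insert ?e ?P"] exI[of _ ?e] conjI allI)
  next
    case (step j)
    have "j \<le> b" using step by simp
    from step.IH[OF this] obtain E X where "finite E \<and> (\<forall>e\<in>E. e \<subseteq> {..<n} \<and> card e = 2) \<and> path_edges n \<subseteq> E \<and>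
      {0, n - 1} \<in> E \<and> card E = n - 1 + j \<and> girth_at_least g {..<n} E \<and> finite X \<and> card X \<le> 2 * j \<and>
      (\<forall>v. card {e \<in> E. v \<in> e} \<le> 2 + of_bool (v \<in> X))" by (elim exE)
    then have E: "finite E" "\<And>e. e \<in> E \<Longrightarrow> e \<subseteq> {..<n} \<and> card e = 2" "path_edges n \<subseteq> E" "{0, n - 1} \<in> E"
      "card E = n - 1 + j" "girth_at_least g {..<n} E" "finite X" "card X \<le> 2 * j"
      "\<And>v. card {e \<in> E. v \<in> e} \<le> 2 + of_bool (v \<in> X)" by (elim conjE; blast)+
    have deg3: "card {y. {v, y} \<in> E} \<le> 3" for v
    proof -
      have "card {y. {v, y} \<in> E} \<le> card {e \<in> E. v \<in> e}"
        by (rule card_inj_on_le[where f = "\<lambda>y. {v, y}"])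
           (use E(1) in \<open>auto simp: inj_on_def doubleton_eq_iff\<close>)
      also have "\<dots> \<le> 2 + of_bool (v \<in> X)" by (rule E(9))
      finally show ?thesis by (cases "v \<in> X") simp_all
    qed
    have "card X < card {..<n}" using E(8) n step by simp
    then obtain u where u: "u < n" "u \<notin> X"
      using E(7) by (metis card_mono lessThan_iff not_less subsetI)
    let ?B = "graph_ball E u (g - 2)"
    have Bsub: "?B \<subseteq> {..<n}" using E(2) u by (intro graph_ball_subset) auto
    have "card ?B \<le> 3 * 2 ^ (g - 2)" using E(2) u deg3 by (intro card_graph_ball[of "{..<n}"]) auto
    also have "\<dots> \<le> 3 * 2 ^ g" by simp
    finally have "card (X \<union> ?B) < card {..<n}"
      using card_Un_le[of X ?B] E(8) n step by simp
    then obtain v where v: "v < n" "v \<notin> X" "v \<notin> ?B"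
      using E(7) finite_subset[OF Bsub] by (metis UnI1 UnI2 card_mono finite_UnI finite_lessThan lessThan_iff not_less subsetI)
    let ?e = "{u, v}"
    have uB: "u \<in> ?B" using graph_ball_mono[of 0 "g - 2" E u] by simp
    then have uv: "u \<noteq> v" using v by blast
    have new: "?e \<notin> E"
    proof
      assume "?e \<in> E"
      then have "v \<in> graph_ball E u 1" by simp
      moreover have "graph_ball E u 1 \<subseteq> ?B" using g by (intro graph_ball_mono) simp
      ultimately show False using v(3) by blast
    qed
    have girth: "girth_at_least g {..<n} (insert ?e E)"
      using E(1,2,6) u v new g by (intro girth_insert) auto
    have "card {e \<in> insert ?e E. x \<in> e} \<le> 2 + of_bool (x \<in> X \<union> ?e)" for x
    proof -
      have "card {e \<in> insert ?e E. x \<in> e} \<le> 2 + of_bool (x \<in> X) + of_bool (x \<in> ?e)"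
        using degree_insert[OF E(1), of ?e x] E(9)[of x] by linarith
      then show ?thesis using u v by (cases "x \<in> ?e") auto
    qed
    moreover have "card (X \<union> ?e) \<le> 2 * Suc j" using card_Un_le[of X ?e] E(8) uv by simp
    moreover have "card (insert ?e E) = n - 1 + Suc j" using new E(1,5) by simp
    moreover have "\<forall>e\<in>insert ?e E. e \<subseteq> {..<n} \<and> card e = 2" using E(2) u v uv by auto
    ultimately show ?case using girth E(1,3,4,7)
      by (intro exI[of _ "insert ?e E"] exI[of _ "X \<union> ?e"]) auto
  qed
  from this[OF b order_refl] obtain E X where E: "finite E" "\<forall>e\<in>E. e \<subseteq> {..<n} \<and> card e = 2" "path_edges n \<subseteq> E"
    "{0, n - 1} \<in> E" "card E = n - 1 + b" "girth_at_least g {..<n} E"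
    "\<forall>v. card {e \<in> E. v \<in> e} \<le> 2 + of_bool (v \<in> X)" by blast
  have "card {e \<in> E. v \<in> e} \<le> 3" for v
    using E(7)[rule_format, of v] by (cases "v \<in> X") simp_all
  then show ?thesis using E by blast
qed

lemma graph_from_cycle:
  assumes n: "3 \<le> n" and E: "finite E" "\<And>e. e \<in> E \<Longrightarrow> e \<subseteq> {..<n} \<and> card e = 2"
    and cyc: "path_edges n \<subseteq> E" "{0, n - 1} \<in> E"
  shows "graph {..<n} E"
  unfolding graph_def
proof (intro conjI ballI)
  show "finite {..<n}" by simp
  have "0 \<in> {..<n}" using n by simp
  then show "{..<n} \<noteq> {}" by blast
  show "e \<subseteq> {..<n}" "card e = 2" if "e \<in> E" for e using E(2)[OF that] by auto
  let ?R = "{(x, y). {x, y} \<in> E}"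
  have step: "{k, k - 1} \<in> E" if "1 \<le> k" "k < n" for k
    using cyc(1) that by (auto simp: path_edges_def)
  have "sym ?R" by (auto simp: sym_def insert_commute)
  then have symR: "sym (?R\<^sup>*)" by (rule sym_rtrancl)
  have reach: "(0, k) \<in> ?R\<^sup>*" if "k < n" for k
    using that
  proof (induction k)
    case (Suc k)
    have "(k, Suc k) \<in> ?R" using step[of "Suc k"] Suc by (simp add: insert_commute)
    then show ?case using Suc by (meson Suc_lessD rtrancl.rtrancl_into_rtrancl)
  qed simp
  show "(u, v) \<in> ?R\<^sup>*" if "u \<in> {..<n}" "v \<in> {..<n}" for u v
    using reach[of u] reach[of v] that symR by (meson lessThan_iff rtrancl_trans symE)
  show "2 \<le> card {e \<in> E. v \<in> e}" if "v \<in> {..<n}" for v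
  proof -
    have two: "2 \<le> card {e \<in> E. v \<in> e}" if "{v, x} \<in> E" "{v, y} \<in> E" "x \<noteq> y" for x y
    proof -
      have "{v, x} \<noteq> {v, y}" using that(3) by (auto simp: doubleton_eq_iff)
      then have "2 = card {{v, x}, {v, y}}" by simp
      also have "\<dots> \<le> card {e \<in> E. v \<in> e}" using that E(1) by (intro card_mono) auto
      finally show ?thesis .
    qed
    consider "v = 0" | "v = n - 1" | "1 \<le> v" "v + 1 < n" using \<open>v \<in> {..<n}\<close> by fastforce
    then show ?thesis
    proof cases
      case 1
      then show ?thesis using two[of 1 "n - 1"] step[of 1] cyc(2) n by (simp add: insert_commute)
    next
      case 2
      then show ?thesis using two[of "n - 2" 0] step[of "n - 1"] cyc(2) n
        by (simp add: insert_commute numeral_2_eq_2)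
    next
      case 3
      then show ?thesis using two[of "v - 1" "v + 1"] step[of v] step[of "v + 1"] by (simp add: insert_commute)
    qed
  qed
qed

text \<open>All weights are 1. The shortest cycle has length at least \<open>g\<close>, and the determinant is at most
  \<open>3 ^ (n - 1)\<close> for \<open>n = 2 b + 3 * 2 ^ g\<close> vertices.\<close>

theorem rho_ge:
  assumes g: "3 \<le> g" and b: "1 \<le> b"
  shows "ereal (real g / 3 powr (real (2 * b + 3 * 2 ^ g) / real b)) \<le> rho b"
proof -
  define n where "n = 2 * b + 3 * (2::nat) ^ g"
  have n3: "3 \<le> n" using less_exp[of g] g unfolding n_def by linarith
  obtain E where E: "finite E" "\<And>e. e \<in> E \<Longrightarrow> e \<subseteq> {..<n} \<and> card e = 2" "path_edges n \<subseteq> E" "{0, n - 1} \<in> E"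
    "card E = n - 1 + b" "girth_at_least g {..<n} E" "\<And>v. card {e \<in> E. v \<in> e} \<le> 3"
    using high_girth_edges[OF g _ b, of n] by (auto simp: n_def)
  let ?V = "{..<n}" and ?w = "\<lambda>_ :: nat set. 1 :: real"
  let ?B = "weight_form E ?w"
  have G: "graph ?V E" by (rule graph_from_cycle[OF n3 E(1-4)])
  define ori where "ori e = (Min e, Max e)" for e :: "nat set"
  have ori: "orientation E ori"
    unfolding orientation_def
  proof
    fix e assume "e \<in> E"
    then have "card e = 2" using E(2) by blast
    then obtain x y where "e = {x, y}" by (meson card_2_iff)
    then show "e = {fst (ori e), snd (ori e)}" by (auto simp: ori_def min_def max_def)
  qed
  have betti: "betti1 ?V E = int b" using E(5) n3 by (simp add: betti1_def)
  have pos: "0 < ?B c c" if c: "c \<in> H1_real ?V E ori" "c \<noteq> (\<lambda>_. 0)" for c ori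
  proof -
    obtain e where "c e \<noteq> 0" using c(2) by blast
    moreover from this have "e \<in> E" using H1_outside[OF c(1)] by blast
    ultimately show ?thesis unfolding weight_form_def using E(1)
      by (intro sum_pos2[of E e]) (simp_all flip: power2_eq_square)
  qed
  have wg: "weighted_graph ?V E ?w"
    unfolding weighted_graph_def using G pos by auto
  obtain x f where "ordered_tree ?V E ori (card ?V) x f" using graph_ordered_tree[OF G ori] .
  then interpret T: ordered_tree ?V E ori "card ?V" x f .
  interpret symmetric_form ?B by (rule symmetric_form_weight_form)
  have bT: "T.b = b" using betti T.betti1_eq by simp
  obtain u a where gs: "gram_schmidt b T.fund_cycle u a" using T.gram_schmidt_fund_cycle[OF pos[where ori = ori]] bT by auto
  have H: "H1_int ?V E ori = int_comb b T.fund_cycle" using T.H1_int_eq bT by simp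
  obtain l where l: "l \<in> H1_int ?V E ori" "l \<noteq> (\<lambda>_. 0)" "lattice_norm ?B (H1_int ?V E ori) = ?B l l"
    using lattice_norm_attained(1)[OF gs b] unfolding H by blast
  have "real g \<le> real (card {e \<in> E. l e \<noteq> 0})"
    using E(6) ori H1_int_real[OF l(1)] l(2) by (simp add: girth_at_least_def)
  also have "\<dots> = (\<Sum>e\<in>E. of_bool (l e \<noteq> 0))" using E(1) by (simp add: of_bool_def sum.If_cases Int_def)
  also have "\<dots> \<le> (\<Sum>e\<in>E. 1 * l e * l e)"
  proof (rule sum_mono)
    fix e
    have "l e \<in> \<int>" using l(1) by (simp add: H1_int_iff)
    then have "1 \<le> (l e)\<^sup>2" if "l e \<noteq> 0"
      using that by (metis Ints_nonzero_abs_ge1 abs_square_le_1 one_le_power power2_abs)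
    then show "of_bool (l e \<noteq> 0) \<le> 1 * l e * l e" by (simp add: power2_eq_square)
  qed
  finally have norm: "real g \<le> lattice_norm ?B (H1_int ?V E ori)" unfolding l(3) weight_form_def .
  define d where "d = lattice_det b (H1_real ?V E ori) ?B (H1_int ?V E ori)"
  have "d \<le> real 3 ^ (card ?V - 1)" "0 < d"
    using T.lattice_det_le_degree[of 3] E(7) unfolding d_def bT by auto
  moreover have "real 3 ^ (card ?V - 1) \<le> 3 ^ n"
    using power_increasing[of "n - 1" n "3::real"] by simp
  ultimately have d: "d \<le> 3 ^ n" "0 < d" by linarith+
  have "d powr (1 / real b) \<le> (3 ^ n) powr (1 / real b)" using d by (intro powr_mono2) auto
  also have "\<dots> = 3 powr (real n / real b)" by (simp add: powr_realpow[symmetric] powr_powr)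
  finally have "real g / 3 powr (real n / real b) \<le> lattice_norm ?B (H1_int ?V E ori) / d powr (1 / real b)"
    using norm d by (intro frac_le) auto
  also have "\<dots> = jacobian_hermite b ?V E ?w ori"
    by (simp add: jacobian_hermite_def hermite_invariant_def d_def)
  finally have "ereal (real g / 3 powr (real n / real b)) \<le> ereal (jacobian_hermite b ?V E ?w ori)" by simp
  also have "\<dots> \<le> rho b"
    unfolding rho_def by (rule Sup_upper) (use wg betti ori in blast)
  finally show ?thesis by (simp add: n_def)
qed

section \<open>Asymptotics\<close>

lemma rho_le:
  assumes b: "1 \<le> b"
  shows "rho b \<le> ereal (4 * (log 2 (real b) + 2))"
proof -
  \<comment> \<open>The least exponent with \<open>2 b \<le> 2 ^ L\<close>.\<close>
  define L where "L = nat \<lceil>log 2 (real (2 * b))\<rceil>"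
  have log2b: "log 2 (real (2 * b)) = log 2 (real b) + 1" using b by (simp add: log_mult)
  have log_nonneg: "0 \<le> log 2 (real b)" using b by simp
  have L_ge: "log 2 (real (2 * b)) \<le> real L" unfolding L_def by linarith
  have L_le: "real L \<le> log 2 (real b) + 2" unfolding L_def using log2b log_nonneg by linarith
  have L1: "1 \<le> L" using L_ge log2b log_nonneg by linarith
  have "real (2 * b) \<le> 2 powr real L" using L_ge b by (simp add: log_le_iff)
  then have "real (2 * b) \<le> real (2 ^ L)" by (simp add: powr_realpow)
  then have L2: "2 * b \<le> 2 ^ L" by (simp only: of_nat_le_iff)
  show ?thesis
    unfolding rho_def
  proof (rule Sup_least)
    fix x assume "x \<in> {ereal (jacobian_hermite b V E w ori) | (V :: nat set) E w ori.
       weighted_graph V E w \<and> betti1 V E = int b \<and> orientation E ori}"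
    then obtain V :: "nat set" and E w ori where x: "x = ereal (jacobian_hermite b V E w ori)"
      "weighted_graph V E w" "betti1 V E = int b" "orientation E ori" by blast
    have "jacobian_hermite b V E w ori \<le> 4 * real L"
      using jacobian_hermite_le[OF x(2,3) b x(4) L1 L2] .
    then show "x \<le> ereal (4 * (log 2 (real b) + 2))" using L_le by (simp add: x(1))
  qed
qed

text \<open>For \<open>g\<close> close to \<open>(2 / 3) log\<^sub>2 b\<close> the number of vertices is \<open>2 b + o(b)\<close>, so that the preceding bound is
  asymptotically \<open>(2 / 27) log\<^sub>2 b\<close>, and \<open>1 / (6 e) \<le> 1 / 15 < 2 / 27\<close>.\<close>

lemma eventually_rho_ge:
  "eventually (\<lambda>b. ereal (1 / (6 * exp 1) * log 2 (real b)) \<le> rho b) sequentially"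
proof -
  have "((\<lambda>b::nat. 3 powr (3 * real b powr (2 / 3) / real b)) \<longlongrightarrow> (1 :: real)) at_top" by real_asymp
  then have "eventually (\<lambda>b::nat. 3 powr (3 * real b powr (2 / 3) / real b) < (27 / 26 :: real)) at_top"
    by (rule order_tendstoD) simp
  moreover have "eventually (\<lambda>b::nat. 24 \<le> log 2 (real b)) at_top" by real_asymp
  moreover have "eventually (\<lambda>b::nat. 1 \<le> b) at_top" by (rule eventually_ge_at_top)
  ultimately show ?thesis
  proof eventually_elim
    case (elim b)
    define l where "l = log 2 (real b)"
    define g where "g = nat \<lfloor>2 / 3 * l\<rfloor>"
    have l: "24 \<le> l" using elim by (simp add: l_def)
    have g: "2 / 3 * l - 1 \<le> real g" "real g \<le> 2 / 3 * l" unfolding g_def using l by linarith+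
    have g3: "3 \<le> g" using g(1) l by linarith
    have "(2::real) ^ g = 2 powr real g" by (simp add: powr_realpow)
    also have "\<dots> \<le> 2 powr (l * (2 / 3))" using g(2) by simp
    also have "\<dots> = (2 powr l) powr (2 / 3)" by (simp only: powr_powr)
    also have "2 powr l = real b" using elim by (simp add: l_def)
    finally have "real (2 * b + 3 * 2 ^ g) / real b \<le> 2 + 3 * real b powr (2 / 3) / real b"
      using elim by (simp add: field_simps)
    then have "3 powr (real (2 * b + 3 * 2 ^ g) / real b) \<le> 3 powr (2 + 3 * real b powr (2 / 3) / real b)"
      by simp
    also have "\<dots> = 9 * 3 powr (3 * real b powr (2 / 3) / real b)" by (simp add: powr_add)
    also have "\<dots> \<le> 9 * (27 / 26)" using elim by simp
    finally have den: "3 powr (real (2 * b + 3 * 2 ^ g) / real b) \<le> 243 / (26::real)" by simp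
    have "(5 / 2 :: real) \<le> exp 1" using exp_lower_Taylor_quadratic[of 1] by simp
    then have "1 / (6 * exp 1) * l \<le> 1 / 15 * l"
      using l by (intro mult_right_mono) (auto simp: field_simps)
    also have "\<dots> \<le> (2 / 3 * l - 1) / (243 / 26)" using l by (simp add: field_simps)
    also have "\<dots> \<le> real g / 3 powr (real (2 * b + 3 * 2 ^ g) / real b)"
      using g(1) den l by (intro frac_le) auto
    finally have "ereal (1 / (6 * exp 1) * l) \<le> ereal (real g / 3 powr (real (2 * b + 3 * 2 ^ g) / real b))"
      by simp
    also have "\<dots> \<le> rho b" using elim by (intro rho_ge g3)
    finally show ?case by (simp add: l_def)
  qed
qed

theorem mainTheorem1:
  shows "asymp_le (\<lambda>b. ereal (1 / (6 * exp 1) * log 2 (real b))) rho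
       \<and> asymp_le rho (\<lambda>b. ereal (4 * log 2 (8 / 3 * real b)))"
proof
  have "eventually (\<lambda>b. ereal (1 / (6 * exp 1) * log 2 (real b)) / rho b \<le> 1) sequentially"
    using eventually_rho_ge eventually_gt_at_top[of 1]
  proof eventually_elim
    case (elim b)
    let ?f = "1 / (6 * exp 1) * log 2 (real b)"
    have f: "0 < ?f" using elim by simp
    show ?case
    proof (cases "rho b")
      case (real r)
      then have "?f \<le> r" using elim by simp
      then show ?thesis using f real by (simp add: divide_le_eq del: times_divide_eq_left)
    next
      case PInf
      then show ?thesis by simp
    next
      case MInf
      then show ?thesis using elim by simp
    qed
  qed
  then show "asymp_le (\<lambda>b. ereal (1 / (6 * exp 1) * log 2 (real b))) rho"
    unfolding asymp_le_def by (rule Limsup_bounded)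
next
  let ?K = "\<lambda>b::nat. 4 * (log 2 (real b) + 2)" and ?G = "\<lambda>b::nat. 4 * log 2 (8 / 3 * real b)"
  have "eventually (\<lambda>b::nat. 0 < ?G b) sequentially" by real_asymp
  then have "eventually (\<lambda>b. rho b / ereal (?G b) \<le> ereal (?K b / ?G b)) sequentially"
    using eventually_ge_at_top[of 1]
  proof eventually_elim
    case (elim b)
    have "rho b / ereal (?G b) \<le> ereal (?K b) / ereal (?G b)"
      using rho_le[OF elim(2)] elim(1) by (intro ereal_divide_right_mono) auto
    then show ?case using elim(1) by simp
  qed
  then have "limsup (\<lambda>b. rho b / ereal (?G b)) \<le> limsup (\<lambda>b. ereal (?K b / ?G b))"
    by (rule Limsup_mono)
  also have "limsup (\<lambda>b. ereal (?K b / ?G b)) = ereal 1"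
  proof (rule lim_imp_Limsup)
    have "((\<lambda>b. ?K b / ?G b) \<longlongrightarrow> 1) sequentially" by real_asymp
    then show "((\<lambda>b. ereal (?K b / ?G b)) \<longlongrightarrow> ereal 1) sequentially" by (intro tendsto_ereal)
  qed simp
  finally show "asymp_le rho (\<lambda>b. ereal (4 * log 2 (8 / 3 * real b)))"
    by (simp add: asymp_le_def one_ereal_def)
qed

end
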